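(* Let $k$ be a field of prime characteristic $p$ and let $n\ge1$. There are isomorphisms of sets $$H^0(O(n),O(n))\simeq \mathrm{Hom}_{V(O(n))}(\Omega_p(O(n)),O(n))\simeq W_n ,$$ where the coefficient module $O(n)$ is the $V(O(n))$-module given by multiplication and the zero action of $P$.
   Context: Let $k$ be a field of prime characteristic $p$. An object of $pdCom_k$ (a divided powers algebra) is a commutative augmented $k$-algebra $A=k\oplus A_+$ with a system of divided powers $\gamma_i$ on $A_+$; it is determined by its $p$-map $\pi=\gamma_p:A_+\to A_+$. Morphisms are homomorphisms of $k$-algebras preserving augmentation ideals and commuting with the $p$-maps. Let $k[P]=\{\sum_{i}\lambda_iP^i\}$ be the skew polynomial ring with $P\lambda=\lambda^pP$ for $\lambda\in k$. The ring $V(A)$ has underlying $k$-module $A\otimes_k k[P]$, with multiplication determined by $(a\otimes1)(a'\otimes1)=aa'\otimes1$, $(1\otimes q)(1\otimes q')=1\otimes qq'$, $(a\otimes1)(1\otimes P)=a\otimes P$; $(1\otimes P)(a\otimes1)=0$ for $a\in A_+$; $(1\otimes P)(\lambda\otimes1)=\lambda^p\otimes P$ for $\lambda\in k$. A $V(A)$-module is the same as a Beck $A$-module, i.e. an $A$-module $M$ with an additive map $P:M\to M$ such that $P(\lambda m)=\lambda^pPm$ for $\lambda\in k$ and $P(am)=0$ for $a\in A_+$. For a $V(A)$-module $M$ and an object $B\to A$ of the slice category $pdCom_k/A$ (so that $M$ is a $V(B)$-module via $V(B)\to V(A)$), put $\mathrm{Der}_p(B,M)=\{D\in \mathrm{Der}_k(B,M)\mid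 D(\pi(b))=PD(b)-b^{p-1}D(b)\ \forall b\in B_+\}$ (Beck derivations). Quillen–Barr–Beck cohomology: $H^*(A,M)$ is the cotriple cohomology of $A$ with coefficients in the functor $\mathrm{Der}_p(-,M)$, that is, the cohomology of the cosimplicial abelian group $\mathrm{Der}_p(\mathbb{G}_*(A),M)$, where $\mathbb{G}_*(A)\to A$ is the cotriple resolution for the cotriple $\mathbb{G}$ of the adjunction between the forgetful functor $pdCom_k\to Sets$, $A\mapsto A_+$, and its left adjoint (the free divided powers algebra functor). $\Omega_p(A)$ is the $V(A)$-module generated by symbols $da$, $a\in A$, with relations $d(\lambda)=0$, $d(\lambda a+\mu b)=\lambda\,da+\mu\,db$, $d(ab)=a\,db+b\,da$, $d(\pi(c))=P\,dc-c^{p-1}dc$, for $a,b\in A$, $c\in A_+$, $\lambda,\mu\in k$. $O(n)$ is the commutative $k$-algebra generated by $x_i^{(r)}$, $1\le i\le n$, $r\ge0$, with relations $x_i^{(0)}=1$ and $x_i^{(s)}x_i^{(t)}=\frac{(s+t)!}{s!\,t!}x_i^{(s+t)}$; write $x_i=x_i^{(1)}$. Its augmentation ideal $m^1$ is the span of the monomials $x_1^{(a_1)}\cdots x_n^{(a_n)}$ with $a_1+\dots+a_n\ge1$. It is an object of $pdCom_k$ with divided powers on $m^1$ determined by $\gamma_r(x_i)=x_i^{(r)}$. $W_n$ (the Witt algebra) is the Lie algebra of all special derivations of $O(n)$, i.e. $k$-derivations $D$ of $O(n)$ with $D(\gamma_i(x))=\gamma_{i-1}(x)D(x)$ for all $x\in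 m^1$, $i\ge0$ (with $\gamma_{-1}=0$). *)

theory Defs
  imports "HOL-Library.Poly_Mapping" "HOL-Algebra.Algebra"
begin

section \<open>Divided powers algebras\<close>

text \<open>
  The ground field is a type \<open>'k\<close> of class \<open>field\<close>, with characteristic \<open>CHAR('k)\<close>.
  Algebras are carrier-based records. The field \<open>aug\<close> is the augmentation \<open>A \<rightarrow> k\<close>, so that
  \<open>A\<^sub>+\<close> is its kernel; \<open>dpow A i\<close> is \<open>\<gamma>\<^sub>i\<close> and only its values on \<open>A\<^sub>+\<close> matter.
  The \<open>p\<close>-map is \<open>dpow A CHAR('k)\<close>.
\<close>

record ('k, 'a) pdalg = "('k, 'a) module" +
  aug :: "'a \<Rightarrow> 'k"
  dpow :: "nat \<Rightarrow> 'a \<Rightarrow> 'a"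

definition plus_ideal :: "('k::field, 'a) pdalg \<Rightarrow> 'a set" where
  "plus_ideal A = {a \<in> carrier A. aug A a = 0}"

locale pd_algebra =
  fixes A :: "('k::field, 'a) pdalg" (structure)
  assumes algebra: "algebra (ring_of_type_algebra :: 'k ring) A"
    and aug_hom: "aug A \<in> ring_hom A ring_of_type_algebra"
    and aug_smult_one: "aug A (c \<odot> \<one>) = c"
    and dpow_0: "x \<in> plus_ideal A \<Longrightarrow> dpow A 0 x = \<one>"
    and dpow_1: "x \<in> plus_ideal A \<Longrightarrow> dpow A 1 x = x"
    and dpow_closed: "x \<in> plus_ideal A \<Longrightarrow> 0 < i \<Longrightarrow> dpow A i x \<in> plus_ideal A"
    and dpow_add: "x \<in> plus_ideal A \<Longrightarrow> y \<in> plus_ideal A \<Longrightarrow>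
          dpow A m (x \<oplus> y) = (\<Oplus>i\<in>{..m}. dpow A i x \<otimes> dpow A (m - i) y)"
    and dpow_mult: "a \<in> carrier A \<Longrightarrow> x \<in> plus_ideal A \<Longrightarrow>
          dpow A m (a \<otimes> x) = (a [^] m) \<otimes> dpow A m x"
    and dpow_mult_dpow: "x \<in> plus_ideal A \<Longrightarrow>
          dpow A i x \<otimes> dpow A j x = add_pow A ((i + j) choose i) (dpow A (i + j) x)"
    and dpow_dpow: "x \<in> plus_ideal A \<Longrightarrow> 0 < j \<Longrightarrow>
          dpow A i (dpow A j x) =
            add_pow A (fact (i * j) div (fact i * fact j ^ i) :: nat) (dpow A (i * j) x)"


abbreviation "lookup \<equiv> Poly_Mapping.lookup"
abbreviation "keys \<equiv> Poly_Mapping.keys"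


section \<open>Free divided powers algebras\<close>

text \<open>
  The free divided powers algebra on a set \<open>S\<close>, that is, the commutative algebra with generators
  \<open>x\<^bsup>(r)\<^esup>\<close> for \<open>x \<in> S\<close>, \<open>r \<ge> 0\<close> and relations \<open>x\<^bsup>(0)\<^esup> = 1\<close>, \<open>x\<^bsup>(s)\<^esup> x\<^bsup>(t)\<^esup> = (s+t)!/(s! t!) x\<^bsup>(s+t)\<^esup>\<close>,
  is modelled on its basis of monomials \<open>e(u) = \<Prod>x\<in>S. x\<^bsup>(u x)\<^esup>\<close> for finitely supported exponents
  \<open>u\<close>: an element is the finitely supported function of its coefficients, and \<open>dp_mult\<close> is the
  bilinear product that the relations force on the basis. Beware that it is not the (polynomial)
  product of the type class instance for finitely supported functions.
\<close>

type_synonym ('x, 'k) dpoly = "('x \<Rightarrow>\<^sub>0 nat) \<Rightarrow>\<^sub>0 'k"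

definition dp_mult :: "('x, 'k::field) dpoly \<Rightarrow> ('x, 'k) dpoly \<Rightarrow> ('x, 'k) dpoly" where
  "dp_mult f g =
     (\<Sum>u\<in>keys f. \<Sum>v\<in>keys g. Poly_Mapping.single (u + v)
        (of_nat (\<Prod>i\<in>keys u \<union> keys v. (lookup u i + lookup v i) choose lookup u i)
          * lookup f u * lookup g v))"

definition dp_monoid :: "('x, 'k::field) dpoly monoid" where
  "dp_monoid = \<lparr>carrier = UNIV, monoid.mult = dp_mult, one = Poly_Mapping.single 0 1\<rparr>"

definition dp_smult :: "'k \<Rightarrow> ('x, 'k::field) dpoly \<Rightarrow> ('x, 'k) dpoly" where
  "dp_smult c f = Poly_Mapping.map ((*) c) f"

text \<open>
  \<open>\<gamma>\<^sub>j(e(u)) = ((\<Prod>x. (j u(x))! / u(x)!\<^sup>j) / j!) e(j u)\<close>, as one sees by computing with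
  \<open>\<gamma>\<^sub>j(y) = y\<^sup>j / j!\<close> over the rationals; for \<open>u \<noteq> 0\<close> both divisions are exact.
\<close>

definition dp_dpow_monom :: "nat \<Rightarrow> ('x \<Rightarrow>\<^sub>0 nat) \<Rightarrow> ('x, 'k::field) dpoly" where
  "dp_dpow_monom j u = Poly_Mapping.single (Poly_Mapping.map ((*) j) u)
     (of_nat ((\<Prod>i\<in>keys u. fact (j * lookup u i) div fact (lookup u i) ^ j) div fact j))"

text \<open>
  The rules for sums and scalar multiples give \<open>\<gamma>\<^sub>m\<close> of \<open>\<Sum>u. c(u) e(u)\<close> as the sum, over the
  families \<open>\<mu>\<close> of natural numbers with total \<open>m\<close>, of the products over \<open>u\<close> of
  \<open>c(u)\<^bsup>\<mu>(u)\<^esup> \<gamma>\<^bsub>\<mu>(u)\<^esub>(e(u))\<close>.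
\<close>

definition dp_dpow :: "nat \<Rightarrow> ('x, 'k::field) dpoly \<Rightarrow> ('x, 'k) dpoly" where
  "dp_dpow m f =
     (\<Sum>\<mu> \<in> {\<mu> \<in> keys f \<rightarrow>\<^sub>E {..m}. (\<Sum>u\<in>keys f. \<mu> u) = m}.
        finprod dp_monoid (\<lambda>u. dp_smult (lookup f u ^ \<mu> u) (dp_dpow_monom (\<mu> u) u)) (keys f))"

definition free_pd :: "'x set \<Rightarrow> ('k::field, ('x, 'k) dpoly) pdalg" where
  "free_pd S = \<lparr>carrier = {f. \<forall>u\<in>keys f. keys u \<subseteq> S},
     monoid.mult = dp_mult, one = Poly_Mapping.single 0 1, ring.zero = 0, add = (+),
     smult = dp_smult, aug = (\<lambda>f. lookup f 0), dpow = dp_dpow\<rparr>"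

definition dp_gen :: "'x \<Rightarrow> ('x, 'k::field) dpoly" where
  "dp_gen x = Poly_Mapping.single (Poly_Mapping.single x 1) 1"

text \<open>The morphism \<open>free_pd S \<rightarrow> B\<close> extending a map \<open>g : S \<rightarrow> B\<^sub>+\<close>, i.e. \<open>x\<^bsup>(r)\<^esup> \<mapsto> \<gamma>\<^sub>r(g x)\<close>.\<close>

definition pd_lift ::
  "('k::field, 'b) pdalg \<Rightarrow> ('x \<Rightarrow> 'b) \<Rightarrow> ('x, 'k) dpoly \<Rightarrow> 'b" where
  "pd_lift B g f =
     (\<Oplus>\<^bsub>B\<^esub>u\<in>keys f. lookup f u \<odot>\<^bsub>B\<^esub> (\<Otimes>\<^bsub>B\<^esub>x\<in>keys u. dpow B (lookup u x) (g x)))"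

definition divided_power_algebra :: "nat \<Rightarrow> ('k::field, (nat, 'k) dpoly) pdalg" where
  "divided_power_algebra n = free_pd {1..n}"


section \<open>The ring \<open>V(A)\<close> and its modules\<close>

text \<open>
  As \<open>k[P]\<close> has the left \<open>k\<close>-basis \<open>P\<^sup>i\<close>, an element \<open>\<Sum>i. a\<^sub>i \<otimes> P\<^sup>i\<close> of \<open>A \<otimes>\<^sub>k k[P]\<close> is a finitely
  supported sequence. Moving \<open>P\<^sup>i\<close> past \<open>a\<close> gives
  \<open>(1 \<otimes> P\<^sup>i) (a \<otimes> 1) = \<epsilon>(a)\<^bsup>p^i\<^esup> \<otimes> P\<^sup>i\<close> for \<open>i > 0\<close>, with \<open>\<epsilon>\<close> the augmentation.
\<close>

definition V_twist :: "('k::field, 'a) pdalg \<Rightarrow> nat \<Rightarrow> 'a \<Rightarrow> 'a" where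
  "V_twist A i a = (if i = 0 then a else (aug A a ^ (CHAR('k) ^ i)) \<odot>\<^bsub>A\<^esub> \<one>\<^bsub>A\<^esub>)"

definition V_monom :: "('k::field, 'a) pdalg \<Rightarrow> 'a \<Rightarrow> nat \<Rightarrow> (nat \<Rightarrow> 'a)" where
  "V_monom A a i = (\<lambda>j. if j = i then a else \<zero>\<^bsub>A\<^esub>)"

definition V :: "('k::field, 'a) pdalg \<Rightarrow> (nat \<Rightarrow> 'a) ring" where
  "V A = \<lparr>carrier = {q. (\<forall>i. q i \<in> carrier A) \<and> finite {i. q i \<noteq> \<zero>\<^bsub>A\<^esub>}},
     monoid.mult = (\<lambda>q r l. \<Oplus>\<^bsub>A\<^esub>i\<in>{..l}. q i \<otimes>\<^bsub>A\<^esub> V_twist A i (r (l - i))),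
     one = V_monom A \<one>\<^bsub>A\<^esub> 0,
     ring.zero = (\<lambda>_. \<zero>\<^bsub>A\<^esub>),
     add = (\<lambda>q r i. q i \<oplus>\<^bsub>A\<^esub> r i)\<rparr>"

definition V_map :: "('b \<Rightarrow> 'a) \<Rightarrow> (nat \<Rightarrow> 'b) \<Rightarrow> (nat \<Rightarrow> 'a)" where
  "V_map f q = f \<circ> q"

text \<open>
  The library's modules are over commutative rings only. In the module records below the
  multiplicative fields \<open>mult\<close> and \<open>one\<close> have no meaning.
\<close>

locale left_module = R?: ring R + M?: abelian_group M
  for R :: "('r, 't) ring_scheme" (structure) and M :: "('r, 'm) module" (structure) +
  assumes "a \<in> carrier R \<Longrightarrow> x \<in> carrier M \<Longrightarrow> a \<odot>\<^bsub>M\<^esub> x \<in> carrier M"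
    and "a \<in> carrier R \<Longrightarrow> b \<in> carrier R \<Longrightarrow> x \<in> carrier M \<Longrightarrow>
          (a \<oplus>\<^bsub>R\<^esub> b) \<odot>\<^bsub>M\<^esub> x = a \<odot>\<^bsub>M\<^esub> x \<oplus>\<^bsub>M\<^esub> b \<odot>\<^bsub>M\<^esub> x"
    and "a \<in> carrier R \<Longrightarrow> x \<in> carrier M \<Longrightarrow> y \<in> carrier M \<Longrightarrow>
          a \<odot>\<^bsub>M\<^esub> (x \<oplus>\<^bsub>M\<^esub> y) = a \<odot>\<^bsub>M\<^esub> x \<oplus>\<^bsub>M\<^esub> a \<odot>\<^bsub>M\<^esub> y"
    and "a \<in> carrier R \<Longrightarrow> b \<in> carrier R \<Longrightarrow> x \<in> carrier M \<Longrightarrow>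
          (a \<otimes>\<^bsub>R\<^esub> b) \<odot>\<^bsub>M\<^esub> x = a \<odot>\<^bsub>M\<^esub> (b \<odot>\<^bsub>M\<^esub> x)"
    and "x \<in> carrier M \<Longrightarrow> \<one>\<^bsub>R\<^esub> \<odot>\<^bsub>M\<^esub> x = x"

definition restrict_scalars :: "('s \<Rightarrow> 'r) \<Rightarrow> ('r, 'm) module \<Rightarrow> ('s, 'm) module" where
  "restrict_scalars h M = \<lparr>carrier = carrier M, monoid.mult = monoid.mult M, one = one M,
     ring.zero = ring.zero M, add = add M, smult = (\<lambda>s. smult M (h s))\<rparr>"

definition module_homs :: "('s, 't) ring_scheme \<Rightarrow> ('s, 'm) module \<Rightarrow> ('s, 'n) module \<Rightarrow> ('m \<Rightarrow> 'n) set"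
  where
  "module_homs R M N = {h \<in> carrier M \<rightarrow>\<^sub>E carrier N.
     (\<forall>x\<in>carrier M. \<forall>y\<in>carrier M. h (x \<oplus>\<^bsub>M\<^esub> y) = h x \<oplus>\<^bsub>N\<^esub> h y) \<and>
     (\<forall>r\<in>carrier R. \<forall>x\<in>carrier M. h (r \<odot>\<^bsub>M\<^esub> x) = r \<odot>\<^bsub>N\<^esub> h x)}"

definition self_module :: "('k::field, 'a) pdalg \<Rightarrow> ('a, 'a) module" where
  "self_module A = \<lparr>carrier = carrier A, monoid.mult = monoid.mult A, one = one A,
     ring.zero = ring.zero A, add = add A, smult = monoid.mult A\<rparr>"

text \<open>\<open>A\<close> as a \<open>V(A)\<close>-module with zero action of \<open>P\<close>: \<open>\<Sum>i. a\<^sub>i \<otimes> P\<^sup>i\<close> acts as \<open>a\<^sub>0\<close>.\<close>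

definition trivial_P_module :: "('k::field, 'a) pdalg \<Rightarrow> (nat \<Rightarrow> 'a, 'a) module" where
  "trivial_P_module A = restrict_scalars (\<lambda>q. q 0) (self_module A)"


section \<open>Derivations\<close>

definition derivations :: "('k::field, 'b) pdalg \<Rightarrow> ('b, 'm) module \<Rightarrow> ('b \<Rightarrow> 'm) set" where
  "derivations B M = {D \<in> carrier B \<rightarrow>\<^sub>E carrier M.
     (\<forall>a\<in>carrier B. \<forall>b\<in>carrier B. D (a \<oplus>\<^bsub>B\<^esub> b) = D a \<oplus>\<^bsub>M\<^esub> D b) \<and>
     (\<forall>c. \<forall>a\<in>carrier B. D (c \<odot>\<^bsub>B\<^esub> a) = (c \<odot>\<^bsub>B\<^esub> \<one>\<^bsub>B\<^esub>) \<odot>\<^bsub>M\<^esub> D a) \<and>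
     (\<forall>a\<in>carrier B. \<forall>b\<in>carrier B.
        D (a \<otimes>\<^bsub>B\<^esub> b) = a \<odot>\<^bsub>M\<^esub> D b \<oplus>\<^bsub>M\<^esub> b \<odot>\<^bsub>M\<^esub> D a)}"

text \<open>
  \<open>Der\<^sub>p(B,M)\<close> for a \<open>V(B)\<close>-module \<open>M\<close>. For \<open>f : B \<rightarrow> A\<close> and a \<open>V(A)\<close>-module \<open>M\<close>, take
  \<open>restrict_scalars (V_map f) M\<close>.
\<close>

definition beck_derivations ::
  "('k::field, 'b) pdalg \<Rightarrow> (nat \<Rightarrow> 'b, 'm) module \<Rightarrow> ('b \<Rightarrow> 'm) set" where
  "beck_derivations B M =
     {D \<in> derivations B (restrict_scalars (\<lambda>b. V_monom B b 0) M).
        \<forall>b\<in>plus_ideal B. D (dpow B CHAR('k) b) =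
          V_monom B \<one>\<^bsub>B\<^esub> 1 \<odot>\<^bsub>M\<^esub> D b
            \<ominus>\<^bsub>M\<^esub> V_monom B (b [^]\<^bsub>B\<^esub> (CHAR('k) - 1 :: nat)) 0 \<odot>\<^bsub>M\<^esub> D b}"

text \<open>The abelian group of Beck derivations; only the additive fields have a meaning.\<close>

definition beck_derivation_group ::
  "('k::field, 'b) pdalg \<Rightarrow> (nat \<Rightarrow> 'b, 'm) module \<Rightarrow> ('b \<Rightarrow> 'm) ring" where
  "beck_derivation_group B M = \<lparr>carrier = beck_derivations B M,
     monoid.mult = undefined, one = undefined,
     ring.zero = (\<lambda>b\<in>carrier B. \<zero>\<^bsub>M\<^esub>),
     add = (\<lambda>D E. \<lambda>b\<in>carrier B. D b \<oplus>\<^bsub>M\<^esub> E b)\<rparr>"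

definition special_derivations :: "('k::field, 'a) pdalg \<Rightarrow> ('a \<Rightarrow> 'a) set" where
  "special_derivations A = {D \<in> derivations A (self_module A).
     \<forall>x\<in>plus_ideal A. \<forall>i. D (dpow A i x) =
       (if i = 0 then \<zero>\<^bsub>A\<^esub> else dpow A (i - 1) x \<otimes>\<^bsub>A\<^esub> D x)}"

definition Witt :: "nat \<Rightarrow> ((nat, 'k::field) dpoly \<Rightarrow> (nat, 'k) dpoly) set" where
  "Witt n = special_derivations (divided_power_algebra n)"


section \<open>Cotriple cohomology in degree zero\<close>

definition cotriple :: "('k::field, 'a) pdalg \<Rightarrow> ('k, ('a, 'k) dpoly) pdalg" where
  "cotriple A = free_pd (plus_ideal A)"

definition counit :: "('k::field, 'a) pdalg \<Rightarrow> ('a, 'k) dpoly \<Rightarrow> 'a" where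
  "counit A = pd_lift A (\<lambda>a. a)"

definition cotriple_map ::
  "('k::field, 'b) pdalg \<Rightarrow> ('a \<Rightarrow> 'b) \<Rightarrow> ('a, 'k) dpoly \<Rightarrow> ('b, 'k) dpoly" where
  "cotriple_map B f = pd_lift (cotriple B) (\<lambda>a. dp_gen (f a))"

text \<open>
  The cotriple resolution has \<open>\<GG>\<^sub>n(A) = \<GG>\<^bsup>n+1\<^esup>(A)\<close>; its faces \<open>\<GG>\<^sub>1(A) \<rightarrow> \<GG>\<^sub>0(A)\<close> are the counit at
  \<open>\<GG>(A)\<close> and \<open>\<GG>\<close> applied to the counit at \<open>A\<close>. Both compose with the augmentation
  \<open>\<GG>\<^sub>0(A) \<rightarrow> A\<close> to the same map \<open>\<GG>\<^sub>1(A) \<rightarrow> A\<close>. The cohomology in degree \<open>0\<close> is the kernel of the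
  alternating sum of the cofaces from degree \<open>0\<close> to degree \<open>1\<close>.
\<close>

definition cochains0 ::
  "('k::field, 'a) pdalg \<Rightarrow> (nat \<Rightarrow> 'a, 'm) module \<Rightarrow> (('a, 'k) dpoly \<Rightarrow> 'm) ring" where
  "cochains0 A M =
     beck_derivation_group (cotriple A) (restrict_scalars (V_map (counit A)) M)"

definition cochains1 ::
  "('k::field, 'a) pdalg \<Rightarrow> (nat \<Rightarrow> 'a, 'm) module \<Rightarrow> ((('a, 'k) dpoly, 'k) dpoly \<Rightarrow> 'm) ring"
  where
  "cochains1 A M =
     beck_derivation_group (cotriple (cotriple A))
       (restrict_scalars (V_map (counit A \<circ> counit (cotriple A))) M)"

definition coboundary0 ::
  "('k::field, 'a) pdalg \<Rightarrow> (nat \<Rightarrow> 'a, 'm) module \<Rightarrow>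
     (('a, 'k) dpoly \<Rightarrow> 'm) \<Rightarrow> (('a, 'k) dpoly, 'k) dpoly \<Rightarrow> 'm" where
  "coboundary0 A M D = (\<lambda>x\<in>carrier (cotriple (cotriple A)).
     D (counit (cotriple A) x) \<ominus>\<^bsub>M\<^esub> D (cotriple_map A (counit A) x))"

definition cohomology0 ::
  "('k::field, 'a) pdalg \<Rightarrow> (nat \<Rightarrow> 'a, 'm) module \<Rightarrow> (('a, 'k) dpoly \<Rightarrow> 'm) set" where
  "cohomology0 A M = a_kernel (cochains0 A M) (cochains1 A M) (coboundary0 A M)"


section \<open>The module \<open>\<Omega>\<^sub>p(A)\<close>\<close>

text \<open>The free left module on a set \<open>S\<close>: finitely supported functions, zero outside \<open>S\<close>.\<close>

definition free_left_module :: "('r, 't) ring_scheme \<Rightarrow> 's set \<Rightarrow> ('r, 's \<Rightarrow> 'r) module" where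
  "free_left_module R S = \<lparr>carrier = {w. (\<forall>s\<in>S. w s \<in> carrier R) \<and>
       (\<forall>s. s \<notin> S \<longrightarrow> w s = \<zero>\<^bsub>R\<^esub>) \<and> finite {s. w s \<noteq> \<zero>\<^bsub>R\<^esub>}},
     monoid.mult = undefined, one = undefined,
     ring.zero = (\<lambda>_. \<zero>\<^bsub>R\<^esub>),
     add = (\<lambda>w z s. w s \<oplus>\<^bsub>R\<^esub> z s),
     smult = (\<lambda>r w s. r \<otimes>\<^bsub>R\<^esub> w s)\<rparr>"

definition generated_submodule :: "('r, 't) ring_scheme \<Rightarrow> ('r, 'm) module \<Rightarrow> 'm set \<Rightarrow> 'm set" where
  "generated_submodule R M S = \<Inter>{N. submodule N R M \<and> S \<subseteq> N}"

definition quotient_module :: "('r, 'm) module \<Rightarrow> 'm set \<Rightarrow> ('r, 'm set) module" where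
  "quotient_module M N = \<lparr>carrier = a_rcosets\<^bsub>M\<^esub> N,
     monoid.mult = undefined, one = undefined,
     ring.zero = N, add = set_add M,
     smult = (\<lambda>r C. \<Union>x\<in>C. N +>\<^bsub>M\<^esub> (r \<odot>\<^bsub>M\<^esub> x))\<rparr>"

definition omega_free :: "('k::field, 'a) pdalg \<Rightarrow> (nat \<Rightarrow> 'a, 'a \<Rightarrow> nat \<Rightarrow> 'a) module" where
  "omega_free A = free_left_module (V A) (carrier A)"

definition omega_symbol :: "('k::field, 'a) pdalg \<Rightarrow> 'a \<Rightarrow> ('a \<Rightarrow> nat \<Rightarrow> 'a)" where
  "omega_symbol A a = (\<lambda>b. if b = a then \<one>\<^bsub>V A\<^esub> else \<zero>\<^bsub>V A\<^esub>)"

definition omega_relations :: "('k::field, 'a) pdalg \<Rightarrow> ('a \<Rightarrow> nat \<Rightarrow> 'a) set" where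
  "omega_relations A =
     (let F = omega_free A; d = omega_symbol A;
          sc = (\<lambda>c. c \<odot>\<^bsub>A\<^esub> \<one>\<^bsub>A\<^esub>); el = (\<lambda>a. V_monom A a 0); P = V_monom A \<one>\<^bsub>A\<^esub> 1 in
      {d (sc c) |c. True} \<union>
      {d (c \<odot>\<^bsub>A\<^esub> a \<oplus>\<^bsub>A\<^esub> c' \<odot>\<^bsub>A\<^esub> b)
         \<ominus>\<^bsub>F\<^esub> (el (sc c) \<odot>\<^bsub>F\<^esub> d a \<oplus>\<^bsub>F\<^esub> el (sc c') \<odot>\<^bsub>F\<^esub> d b)
         |c c' a b. a \<in> carrier A \<and> b \<in> carrier A} \<union>
      {d (a \<otimes>\<^bsub>A\<^esub> b) \<ominus>\<^bsub>F\<^esub> (el a \<odot>\<^bsub>F\<^esub> d b \<oplus>\<^bsub>F\<^esub> el b \<odot>\<^bsub>F\<^esub> d a)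
         |a b. a \<in> carrier A \<and> b \<in> carrier A} \<union>
      {d (dpow A CHAR('k) a)
         \<ominus>\<^bsub>F\<^esub> (P \<odot>\<^bsub>F\<^esub> d a \<ominus>\<^bsub>F\<^esub> el (a [^]\<^bsub>A\<^esub> (CHAR('k) - 1 :: nat)) \<odot>\<^bsub>F\<^esub> d a)
         |a. a \<in> plus_ideal A})"

definition omega_submodule :: "('k::field, 'a) pdalg \<Rightarrow> ('a \<Rightarrow> nat \<Rightarrow> 'a) set" where
  "omega_submodule A = generated_submodule (V A) (omega_free A) (omega_relations A)"

definition Omega :: "('k::field, 'a) pdalg \<Rightarrow> (nat \<Rightarrow> 'a, ('a \<Rightarrow> nat \<Rightarrow> 'a) set) module" where
  "Omega A = quotient_module (omega_free A) (omega_submodule A)"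

definition universal_derivation :: "('k::field, 'a) pdalg \<Rightarrow> 'a \<Rightarrow> ('a \<Rightarrow> nat \<Rightarrow> 'a) set" where
  "universal_derivation A a = omega_submodule A +>\<^bsub>omega_free A\<^esub> omega_symbol A a"

end

theory Submission
  imports Defs "HOL-Computational_Algebra.Formal_Power_Series" "HOL-Number_Theory.Residues"
begin

text \<open>
  With \<open>P\<close> acting as zero, homomorphisms \<open>\<Omega>\<^sub>p(A) \<rightarrow> A\<close> are Beck derivations of \<open>A\<close> by the universal
  property of \<open>\<Omega>\<^sub>p(A)\<close>. A Beck derivation satisfies \<open>D(\<gamma>\<^sub>p(x)) = -x\<^bsup>p-1\<^esup> D(x) = \<gamma>\<^bsub>p-1\<^esub>(x) D(x)\<close> by Wilson's
  theorem, and as \<open>\<gamma>\<^sub>p\<close> determines all \<open>\<gamma>\<^sub>i\<close>, it is special: if \<open>p\<close> does not divide \<open>i\<close>, then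
  \<open>i \<gamma>\<^sub>i(x) = \<gamma>\<^bsub>i-1\<^esub>(x) x\<close>, and \<open>\<gamma>\<^bsub>pm\<^esub>(x)\<close> is \<open>\<gamma>\<^sub>m(\<gamma>\<^sub>p(x))\<close> up to a number prime to \<open>p\<close>. A degree 0
  cocycle takes equal values on elements of \<open>\<GG>(A)\<close> with the same image in \<open>A\<close>, so it is the pullback
  of a unique Beck derivation of \<open>A\<close>; that such a pullback is a cocycle rests on the universal
  property of the free divided power algebra. The laws for \<open>\<gamma>\<^sub>i\<close> on that algebra extend from
  monomials to sums.
\<close>

section \<open>Factorials of multi-indices\<close>

text \<open>Over the rationals \<open>e(u)\<close> is the ordinary monomial divided by
  \<open>mfact u\<close>, and \<open>\<gamma>\<^sub>j(y) = y\<^sup>j / j!\<close>, so every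
  structure constant is a quotient of factorials. Such quotients cannot be formed in a field of
  characteristic \<open>p\<close>. The identities between them are therefore proved for natural
  numbers, by multiplying with factorials and cancelling, and only then mapped to \<open>k\<close>.
  The sum rule becomes multiplicativity of generating series. The composite rule is the obstacle:
  the expansion of \<open>\<gamma>\<^sub>i(\<gamma>\<^sub>j(F + G))\<close> has coefficients given
  only by a recursion. They are evaluated over the rationals, where divided powers are determined by
  ordinary powers. On the side of cohomology, generators of \<open>\<GG>(\<GG>(A))\<close> come only
  from the augmentation ideal of \<open>\<GG>(A)\<close>, so constants have to be split off before a
  cocycle can be compared on two elements; this is harmless because the product rule gives
  \<open>D(1) = 0\<close>.\<close>

definition mfact :: "('x \<Rightarrow>\<^sub>0 nat) \<Rightarrow> nat" where
  "mfact u = (\<Prod>x\<in>keys u. fact (lookup u x))"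

text \<open>The structure constant in \<open>e(u) e(v) = mbinom u v e(u + v)\<close>.\<close>

definition mbinom :: "('x \<Rightarrow>\<^sub>0 nat) \<Rightarrow> ('x \<Rightarrow>\<^sub>0 nat) \<Rightarrow> nat" where
  "mbinom u v = (\<Prod>i\<in>keys u \<union> keys v. (lookup u i + lookup v i) choose lookup u i)"

definition mscale :: "nat \<Rightarrow> ('x \<Rightarrow>\<^sub>0 nat) \<Rightarrow> ('x \<Rightarrow>\<^sub>0 nat)" where
  "mscale j u = Poly_Mapping.map ((*) j) u"

text \<open>The number of partitions of a set of size \<open>ij\<close> into \<open>i\<close> blocks of size \<open>j > 0\<close>.\<close>

definition block_count :: "nat \<Rightarrow> nat \<Rightarrow> nat" where
  "block_count i j = fact (i * j) div (fact i * fact j ^ i)"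

text \<open>A multinomial coefficient: the \<open>j\<close>-th power of \<open>x^(a)\<close> is this
  multiple of \<open>x^(j a)\<close>.\<close>

definition power_coeff :: "nat \<Rightarrow> nat \<Rightarrow> nat" where
  "power_coeff j a = fact (j * a) div fact a ^ j"

definition mpower_coeff :: "nat \<Rightarrow> ('x \<Rightarrow>\<^sub>0 nat) \<Rightarrow> nat" where
  "mpower_coeff j u = (\<Prod>i\<in>keys u. power_coeff j (lookup u i))"

text \<open>The coefficient of \<open>e(j u)\<close> in \<open>\<gamma>\<^sub>j(e(u))\<close>. At
  \<open>u = 0\<close> the quotient is \<open>1 div fact j\<close>, which has no such meaning for
  \<open>j > 1\<close>; hence the condition \<open>u \<noteq> 0\<close> in the identities
  below.\<close>

definition mblock_count :: "nat \<Rightarrow> ('x \<Rightarrow>\<^sub>0 nat) \<Rightarrow> nat" where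
  "mblock_count j u = mpower_coeff j u div fact j"

lemma lookup_mscale [simp]: "lookup (mscale j u) x = j * lookup u x"
  by (simp add: mscale_def Poly_Mapping.map.rep_eq when_def)

lemma mfact_superset:
  assumes "finite U" "keys u \<subseteq> U"
  shows "mfact u = (\<Prod>x\<in>U. fact (lookup u x))"
  unfolding mfact_def using assms
  by (intro prod.mono_neutral_left) (auto simp: in_keys_iff)

lemma mfact_pos [simp]: "mfact u > 0"
  by (simp add: mfact_def prod_pos)

lemma mfact_nonzero [simp]: "mfact u \<noteq> 0"
  using mfact_pos[of u] by linarith

text \<open>On the common index set \<open>keys u \<union> keys v\<close> this is the factorial
  formula for binomial coefficients, variable by variable. As \<open>mfact\<close> is positive, the
  equation determines \<open>mbinom u v\<close>; identities for it follow by multiplying with the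
  missing factorials and cancelling them.\<close>

lemma mbinom_mfact: "mbinom u v * mfact u * mfact v = mfact (u + v)"
proof -
  let ?U = "keys u \<union> keys v"
  have sub: "keys (u + v) \<subseteq> ?U" by (rule Poly_Mapping.keys_add)
  have "mbinom u v * mfact u * mfact v = (\<Prod>i\<in>?U. (lookup u i + lookup v i choose lookup u i)
      * fact (lookup u i) * fact (lookup v i))"
    unfolding mbinom_def by (simp add: mfact_superset[of ?U] prod.distrib)
  also have "\<dots> = (\<Prod>i\<in>?U. fact (lookup (u + v) i))"
  proof (rule prod.cong)
    fix i
    show "(lookup u i + lookup v i choose lookup u i) * fact (lookup u i) * fact (lookup v i)
        = fact (lookup (u + v) i)"
      using binomial_fact_lemma[of "lookup u i" "lookup u i + lookup v i"]
      by (simp add: lookup_add algebra_simps)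
  qed simp
  finally show ?thesis using sub by (simp add: mfact_superset[of ?U])
qed

lemma keys_mscale: "keys (mscale j u) \<subseteq> keys u"
  by (auto simp: in_keys_iff)

lemma mscale_0 [simp]: "mscale 0 u = 0"
  by (rule poly_mapping_eqI) simp

lemma mscale_1 [simp]: "mscale (Suc 0) u = u"
  by (rule poly_mapping_eqI) simp

lemma mscale_zero [simp]: "mscale j 0 = 0"
  by (rule poly_mapping_eqI) simp

lemma mscale_add: "mscale i u + mscale j u = mscale (i + j) u"
  by (rule poly_mapping_eqI) (simp add: lookup_add algebra_simps)

lemma mscale_plus: "mscale i (u + v) = mscale i u + mscale i v"
  by (rule poly_mapping_eqI) (simp add: lookup_add algebra_simps)

lemma mscale_mscale: "mscale i (mscale j u) = mscale (i * j) u"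
  by (rule poly_mapping_eqI) simp

lemma mscale_eq_0_iff: "mscale j u = 0 \<longleftrightarrow> j = 0 \<or> u = 0"
proof
  assume "mscale j u = 0"
  hence "j * lookup u x = 0" for x by (metis lookup_mscale lookup_zero)
  thus "j = 0 \<or> u = 0" by (cases "j = 0") (auto intro!: poly_mapping_eqI)
qed auto

section \<open>Counting partitions into blocks of equal size\<close>

lemma block_dvd: "j > 0 \<Longrightarrow> fact i * fact j ^ i dvd (fact (i * j) :: nat)"
proof (induction i)
  case (Suc i)
  obtain m where m: "j = Suc m" using Suc.prems by (cases j) auto
  define n where "n = Suc i * j"
  have n: "n = Suc (n - 1)" "n - j = i * j" "j \<le> n" using Suc.prems by (auto simp: n_def)
  \<comment> \<open>Absorption: \<open>n choose j\<close> is \<open>i + 1\<close> times the number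
    of ways to choose the \<open>j - 1\<close> companions of a fixed element. The factor
    \<open>i + 1\<close> completes \<open>fact i\<close> to \<open>fact (Suc i)\<close>.\<close>
  have "Suc (n - 1) * ((n - 1) choose m) = (n choose j) * j"
    using Suc_times_binomial_eq[of "n - 1" m] n(1) m by simp
  moreover have "Suc (n - 1) = Suc i * j"
    using n(1) by (simp only: n_def)
  ultimately have "(n choose j) * j = Suc i * ((n - 1) choose m) * j"
    by (simp only: mult_ac)
  hence c: "n choose j = Suc i * ((n - 1) choose m)"
    using Suc.prems by simp
  obtain q :: nat where q: "fact (i * j) = fact i * fact j ^ i * q"
    using Suc by (auto simp: dvd_def)
  have "fact n = fact j * fact (n - j) * (n choose j)"
    using binomial_fact_lemma[OF n(3)] by simp
  also have "\<dots> = fact j * (fact i * fact j ^ i * q) * (Suc i * ((n - 1) choose m))"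
    by (simp only: n(2) q c)
  also have "\<dots> = (fact (Suc i) * fact j ^ Suc i) * (q * ((n - 1) choose m))"
    by (simp only: fact_Suc power_Suc of_nat_id mult_ac)
  finally have "fact (Suc i * j) = (fact (Suc i) * fact j ^ Suc i) * (q * ((n - 1) choose m))"
    by (simp only: n_def)
  thus ?case by (rule dvdI)
qed simp

lemma block_count_fact:
  "j > 0 \<Longrightarrow> block_count i j * (fact i * fact j ^ i) = fact (i * j)"
  unfolding block_count_def using block_dvd by simp

lemma power_coeff_dvd: "fact a ^ j dvd (fact (j * a) :: nat)"
proof (cases "a = 0")
  case False
  thus ?thesis using block_dvd[of a j] dvd_trans dvd_triv_right by blast
qed simp

lemma power_coeff_fact: "power_coeff j a * fact a ^ j = fact (j * a)"
  unfolding power_coeff_def using power_coeff_dvd by simp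

text \<open>Sequences of blocks against unordered families: \<open>j\<close> disjoint nonempty
  blocks have \<open>fact j\<close> orderings. Empty blocks cannot be told apart, so
  \<open>a > 0\<close> matters.\<close>

lemma power_coeff_block_count: "a > 0 \<Longrightarrow> power_coeff j a = block_count j a * fact j"
proof -
  assume a: "a > 0"
  have "power_coeff j a * fact a ^ j = block_count j a * fact j * fact a ^ j"
    using block_count_fact[OF a, of j] power_coeff_fact[of j a] by (simp add: algebra_simps)
  thus ?thesis by simp
qed

text \<open>The passage to the next power of \<open>x^(a)\<close>: multiplying
  \<open>x^(j a)\<close> by \<open>x^(a)\<close> contributes the binomial coefficient.\<close>

lemma power_coeff_Suc:
  "power_coeff j a * ((j * a + a) choose (j * a)) = power_coeff (Suc j) a"
proof -
  have "power_coeff j a * ((j * a + a) choose (j * a)) * fact a ^ Suc j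
     = (power_coeff j a * fact a ^ j) * (fact a * ((j * a + a) choose (j * a)))"
    by simp
  also have "\<dots> = fact (Suc j * a)"
    using binomial_fact_lemma[of "j * a" "j * a + a"]
    by (simp add: power_coeff_fact algebra_simps)
  finally show ?thesis using power_coeff_fact[of "Suc j" a]
    by (metis fact_nonzero mult_right_cancel power_not_zero)
qed

lemma power_coeff_0 [simp]: "power_coeff 0 a = 1"
  by (simp add: power_coeff_def)

lemma mpower_coeff_mfact: "mpower_coeff j u * mfact u ^ j = mfact (mscale j u)"
proof -
  have "mpower_coeff j u * mfact u ^ j
      = (\<Prod>i\<in>keys u. power_coeff j (lookup u i) * fact (lookup u i) ^ j)"
    by (simp add: mpower_coeff_def mfact_def prod_power_distrib prod.distrib)
  also have "\<dots> = mfact (mscale j u)"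
    by (simp add: power_coeff_fact mfact_superset[OF finite_keys keys_mscale])
  finally show ?thesis .
qed

text \<open>One variable with positive exponent supplies the factor \<open>fact j\<close>, as its
  power coefficient counts ordered blocks. This makes the division in \<open>mblock_count\<close>
  exact.\<close>

lemma mpower_coeff_split:
  assumes "x \<in> keys u"
  shows "mpower_coeff j u =
    fact j * (block_count j (lookup u x) * (\<Prod>i\<in>keys u - {x}. power_coeff j (lookup u i)))"
proof -
  have "lookup u x > 0" using assms by (simp add: in_keys_iff)
  thus ?thesis
    using prod.remove[OF finite_keys assms, of "\<lambda>i. power_coeff j (lookup u i)"]
    by (simp add: mpower_coeff_def power_coeff_block_count algebra_simps)
qed

lemma mblock_count_split:
  assumes "x \<in> keys u"
  shows "mblock_count j u =
    block_count j (lookup u x) * (\<Prod>i\<in>keys u - {x}. power_coeff j (lookup u i))"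
  unfolding mblock_count_def mpower_coeff_split[OF assms] by simp

lemma mblock_count_mfact:
  assumes "u \<noteq> 0"
  shows "mblock_count j u * fact j * mfact u ^ j = mfact (mscale j u)"
proof -
  obtain x where x: "x \<in> keys u" using assms by (metis all_not_in_conv keys_eq_empty)
  have "mblock_count j u * fact j = mpower_coeff j u"
    unfolding mblock_count_def mpower_coeff_split[OF x] by simp
  thus ?thesis by (simp add: mpower_coeff_mfact)
qed

lemma mblock_count_0 [simp]: "mblock_count 0 u = 1"
  by (simp add: mblock_count_def mpower_coeff_def)

lemma mblock_count_Suc_0 [simp]: "mblock_count (Suc 0) u = 1"
  by (simp add: mblock_count_def mpower_coeff_def power_coeff_def)

lemma mbinom_zero [simp]: "mbinom 0 v = 1" "mbinom u 0 = 1"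
  by (simp_all add: mbinom_def)

lemma mbinom_commute: "mbinom u v = mbinom v u"
proof -
  have "mbinom u v * (mfact u * mfact v) = mbinom v u * (mfact u * mfact v)"
    using mbinom_mfact[of u v] mbinom_mfact[of v u] by (simp add: algebra_simps)
  thus ?thesis by simp
qed

text \<open>Associativity of the product on monomials: multiplied by
  \<open>mfact u * mfact v * mfact w\<close>, both sides become
  \<open>mfact (u + v + w)\<close>.\<close>

lemma mbinom_assoc: "mbinom (u + v) w * mbinom u v = mbinom u (v + w) * mbinom v w"
proof -
  have "mbinom (u + v) w * mbinom u v * (mfact u * mfact v * mfact w)
      = mbinom (u + v) w * (mbinom u v * mfact u * mfact v) * mfact w"
    by (simp only: mult_ac)
  also have "\<dots> = mfact (u + v + w)"
    by (simp only: mbinom_mfact)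
  also have "\<dots> = mbinom u (v + w) * mfact u * (mbinom v w * mfact v * mfact w)"
    by (simp only: mbinom_mfact add.assoc)
  also have "\<dots> = mbinom u (v + w) * mbinom v w * (mfact u * mfact v * mfact w)"
    by (simp only: mult_ac)
  finally show ?thesis by simp
qed

text \<open>The coefficients in the rule for
  \<open>\<gamma>\<^sub>i(e(u)) \<gamma>\<^sub>j(e(u))\<close>.\<close>

lemma mblock_count_mbinom:
  assumes "u \<noteq> 0"
  shows "mbinom (mscale i u) (mscale j u) * mblock_count i u * mblock_count j u
    = ((i + j) choose i) * mblock_count (i + j) u"
proof -
  let ?F = "fact i * fact j * mfact u ^ (i + j)"
  have "mbinom (mscale i u) (mscale j u) * mblock_count i u * mblock_count j u * ?F
     = mbinom (mscale i u) (mscale j u) * (mblock_count i u * fact i * mfact u ^ i)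
         * (mblock_count j u * fact j * mfact u ^ j)"
    by (simp add: power_add mult_ac)
  also have "\<dots> = mblock_count (i + j) u * fact (i + j) * mfact u ^ (i + j)"
    by (simp only: mblock_count_mfact[OF assms] mbinom_mfact mscale_add)
  also have "\<dots> = ((i + j) choose i) * mblock_count (i + j) u * ?F"
    using binomial_fact_lemma[of i "i + j"] by (simp add: algebra_simps)
  finally show ?thesis by simp
qed

text \<open>The identity behind \<open>\<gamma>\<^sub>m(e(v) e(u)) = e(v)\<^sup>m \<gamma>\<^sub>m(e(u))\<close>.\<close>

lemma mblock_count_add:
  assumes "u \<noteq> 0"
  shows "mbinom u v ^ m * mblock_count m (u + v)
    = mbinom (mscale m u) (mscale m v) * mblock_count m u * mpower_coeff m v"
proof -
  have nz: "u + v \<noteq> 0" using assms(1)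
    by (metis add_eq_0_iff_both_eq_0 lookup_add lookup_zero poly_mapping_eqI)
  let ?F = "fact m * (mfact u * mfact v) ^ m"
  have "mbinom u v ^ m * mblock_count m (u + v) * ?F
      = mblock_count m (u + v) * fact m * (mbinom u v * mfact u * mfact v) ^ m"
    by (simp only: mult_ac power_mult_distrib)
  also have "\<dots> = mfact (mscale m (u + v))"
    by (simp only: mbinom_mfact mblock_count_mfact[OF nz])
  also have "\<dots> = mbinom (mscale m u) (mscale m v) * (mblock_count m u * fact m * mfact u ^ m)
      * (mpower_coeff m v * mfact v ^ m)"
    by (simp only: mblock_count_mfact[OF assms] mpower_coeff_mfact mbinom_mfact mscale_plus)
  also have "\<dots> = mbinom (mscale m u) (mscale m v) * mblock_count m u * mpower_coeff m v * ?F"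
    by (simp only: mult_ac power_mult_distrib)
  finally show ?thesis by simp
qed

text \<open>The coefficients in the rule for
  \<open>\<gamma>\<^sub>i(\<gamma>\<^sub>j(e(u)))\<close>: the inner coefficient leaves
  \<open>\<gamma>\<^sub>i\<close> as an \<open>i\<close>-th power, and
  \<open>\<gamma>\<^sub>i\<close> then acts on \<open>e(j u)\<close>.\<close>

lemma mblock_count_mscale:
  assumes "u \<noteq> 0" "j > 0"
  shows "mblock_count j u ^ i * mblock_count i (mscale j u)
    = block_count i j * mblock_count (i * j) u"
proof -
  let ?F = "(fact j * mfact u ^ j) ^ i * fact i"
  have nz: "mscale j u \<noteq> 0" using assms by (simp add: mscale_eq_0_iff)
  have "mblock_count j u ^ i * mblock_count i (mscale j u) * ?F
      = mblock_count i (mscale j u) * fact i * (mblock_count j u * fact j * mfact u ^ j) ^ i"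
    by (simp only: mult_ac power_mult_distrib)
  also have "\<dots> = mfact (mscale (i * j) u)"
    by (simp only: mblock_count_mfact[OF assms(1)] mblock_count_mfact[OF nz] mscale_mscale)
  also have "\<dots> = mblock_count (i * j) u * (block_count i j * (fact i * fact j ^ i)) * mfact u ^ (i * j)"
    by (simp only: mblock_count_mfact[OF assms(1)] block_count_fact[OF assms(2)])
  also have "mfact u ^ (i * j) = (mfact u ^ j) ^ i"
    by (simp add: power_mult[symmetric] mult.commute)
  also have "mblock_count (i * j) u * (block_count i j * (fact i * fact j ^ i)) * (mfact u ^ j) ^ i
      = block_count i j * mblock_count (i * j) u * ?F"
    by (simp only: mult_ac power_mult_distrib)
  finally show ?thesis by simp
qed

section \<open>The ring of divided power polynomials\<close>

lemma poly_mapping_sum_single: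
  fixes f :: "'a \<Rightarrow>\<^sub>0 'b::comm_monoid_add"
  assumes "finite U" "keys f \<subseteq> U"
  shows "f = (\<Sum>u\<in>U. Poly_Mapping.single u (lookup f u))"
proof (rule poly_mapping_eqI)
  fix v
  have "lookup (\<Sum>u\<in>U. Poly_Mapping.single u (lookup f u)) v
      = (\<Sum>u\<in>U. if u = v then lookup f v else 0)"
    by (auto simp: lookup_sum lookup_single when_def intro!: sum.cong)
  also have "\<dots> = lookup f v"
    using assms by (auto simp: in_keys_iff)
  finally show "lookup f v = lookup (\<Sum>u\<in>U. Poly_Mapping.single u (lookup f u)) v" ..
qed

text \<open>The monomial case concerns only keys of the given \<open>F\<close>. A restriction on the
  variables of \<open>F\<close> thus remains available throughout the induction.\<close>

lemma poly_mapping_single_induct [case_names zero single add]: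
  fixes F :: "'a \<Rightarrow>\<^sub>0 'b::comm_monoid_add"
  assumes "P 0" and "\<And>u c. u \<in> keys F \<Longrightarrow> P (Poly_Mapping.single u c)"
    and "\<And>f g. P f \<Longrightarrow> P g \<Longrightarrow> P (f + g)"
  shows "P F"
proof -
  have "P (\<Sum>u\<in>U. Poly_Mapping.single u (lookup F u))" if "U \<subseteq> keys F" for U
    using finite_subset[OF that finite_keys] that
    by (induction U rule: finite_induct) (auto intro: assms)
  from this[OF subset_refl] show ?thesis
    by (subst poly_mapping_sum_single[OF finite_keys subset_refl])
qed

lemma dp_mult_superset:
  assumes "finite U" "finite W" "keys f \<subseteq> U" "keys g \<subseteq> W"
  shows "dp_mult f g = (\<Sum>u\<in>U. \<Sum>v\<in>W.
    Poly_Mapping.single (u + v) (of_nat (mbinom u v) * lookup f u * lookup g v))"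
proof -
  have "dp_mult f g = (\<Sum>u\<in>keys f. \<Sum>v\<in>W.
    Poly_Mapping.single (u + v) (of_nat (mbinom u v) * lookup f u * lookup g v))"
    unfolding dp_mult_def mbinom_def using assms
    by (intro sum.cong refl sum.mono_neutral_left) (auto simp: in_keys_iff)
  also have "\<dots> = (\<Sum>u\<in>U. \<Sum>v\<in>W.
    Poly_Mapping.single (u + v) (of_nat (mbinom u v) * lookup f u * lookup g v))"
    using assms by (intro sum.mono_neutral_left) (auto simp: in_keys_iff)
  finally show ?thesis .
qed

lemma dp_mult_add_left: "dp_mult (f + g) h = dp_mult f h + dp_mult g h"
proof -
  let ?U = "keys f \<union> keys g"
  have "keys (f + g) \<subseteq> ?U" by (rule Poly_Mapping.keys_add)
  thus ?thesis
    by (simp add: dp_mult_superset[of ?U "keys h"] lookup_add algebra_simps single_add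
        sum.distrib)
qed

lemma dp_mult_single:
  "dp_mult (Poly_Mapping.single u a) (Poly_Mapping.single v b)
     = Poly_Mapping.single (u + v) (of_nat (mbinom u v) * a * b)"
  by (subst dp_mult_superset[of "{u}" "{v}"]) auto

lemma dp_mult_commute: "dp_mult f g = dp_mult g f"
  unfolding dp_mult_superset[OF finite_keys finite_keys subset_refl subset_refl]
  by (subst sum.swap) (simp add: mbinom_commute add.commute mult_ac)

lemma dp_mult_add_right: "dp_mult h (f + g) = dp_mult h f + dp_mult h g"
  using dp_mult_add_left[of f g h] by (simp add: dp_mult_commute)

lemma dp_mult_zero [simp]: "dp_mult 0 f = 0" "dp_mult f 0 = 0"
  by (simp_all add: dp_mult_def)

text \<open>Both sides are additive in each argument, which leaves monomials and
  \<open>mbinom_assoc\<close>.\<close>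

lemma dp_mult_assoc: "dp_mult (dp_mult f g) h = dp_mult f (dp_mult g h)"
proof (induction f rule: poly_mapping_single_induct)
  case (single u a)
  show ?case
  proof (induction g rule: poly_mapping_single_induct)
    case (single v b)
    show ?case
    proof (induction h rule: poly_mapping_single_induct)
      case (single w c)
      have "of_nat (mbinom (u + v) w) * (of_nat (mbinom u v) * a * b) * c
          = of_nat (mbinom (u + v) w * mbinom u v) * (a * b * c)"
        by simp
      also have "\<dots> = of_nat (mbinom u (v + w)) * a * (of_nat (mbinom v w) * b * c)"
        unfolding mbinom_assoc by simp
      finally show ?case by (simp only: dp_mult_single add.assoc)
    qed (simp_all add: dp_mult_add_right)
  qed (simp_all add: dp_mult_add_right dp_mult_add_left)
qed (simp_all add: dp_mult_add_left)

lemma dp_mult_one: "dp_mult (Poly_Mapping.single 0 1) f = f"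
  by (induction f rule: poly_mapping_single_induct)
    (simp_all add: dp_mult_single dp_mult_add_right flip: single_one)

text \<open>
  The type class instance for the type of coefficient functions provides the polynomial product;
  the divided power product becomes an instance on a copy of that type.
\<close>

typedef (overloaded) ('x, 'k::field) dpa = "UNIV :: ('x, 'k) dpoly set"
  morphisms coeffs of_coeffs ..

setup_lifting type_definition_dpa

instantiation dpa :: (type, field) comm_ring_1
begin

lift_definition zero_dpa :: "('a, 'b) dpa" is 0 .
lift_definition one_dpa :: "('a, 'b) dpa" is "Poly_Mapping.single 0 1" .
lift_definition plus_dpa :: "('a, 'b) dpa \<Rightarrow> ('a, 'b) dpa \<Rightarrow> ('a, 'b) dpa" is "(+)" .
lift_definition minus_dpa :: "('a, 'b) dpa \<Rightarrow> ('a, 'b) dpa \<Rightarrow> ('a, 'b) dpa" is "(-)" .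
lift_definition uminus_dpa :: "('a, 'b) dpa \<Rightarrow> ('a, 'b) dpa" is "uminus" .
lift_definition times_dpa :: "('a, 'b) dpa \<Rightarrow> ('a, 'b) dpa \<Rightarrow> ('a, 'b) dpa" is dp_mult .

instance
proof
  fix a b c :: "('a, 'b) dpa"
  show "a * b * c = a * (b * c)" by transfer (rule dp_mult_assoc)
  show "a * b = b * a" by transfer (rule dp_mult_commute)
  show "1 * a = a" by transfer (rule dp_mult_one)
  show "(a + b) * c = a * c + b * c" by transfer (rule dp_mult_add_left)
  show "(0::('a, 'b) dpa) \<noteq> 1"
    by transfer (metis lookup_single_eq lookup_zero zero_neq_one)
qed (transfer, simp add: algebra_simps)+

end

section \<open>Monomials, coefficients and supports\<close>

definition dmon :: "('x \<Rightarrow>\<^sub>0 nat) \<Rightarrow> 'k \<Rightarrow> ('x, 'k::field) dpa" where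
  "dmon u c = of_coeffs (Poly_Mapping.single u c)"

definition dcoeff :: "('x, 'k::field) dpa \<Rightarrow> ('x \<Rightarrow>\<^sub>0 nat) \<Rightarrow> 'k" where
  "dcoeff F = lookup (coeffs F)"

definition dsupp :: "('x, 'k::field) dpa \<Rightarrow> ('x \<Rightarrow>\<^sub>0 nat) set" where
  "dsupp F = keys (coeffs F)"

lemma coeffs_simps [simp]:
  "coeffs 0 = 0" "coeffs (F + G) = coeffs F + coeffs G"
  "coeffs (- F) = - coeffs F" "coeffs (F - G) = coeffs F - coeffs G"
  "coeffs (F * G) = dp_mult (coeffs F) (coeffs G)" "coeffs 1 = Poly_Mapping.single 0 1"
  "coeffs (dmon u c) = Poly_Mapping.single u c"
  by (simp_all add: zero_dpa.rep_eq plus_dpa.rep_eq uminus_dpa.rep_eq minus_dpa.rep_eq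
      times_dpa.rep_eq one_dpa.rep_eq dmon_def of_coeffs_inverse)

lemma dmon_mult: "dmon u a * dmon v b = dmon (u + v) (of_nat (mbinom u v) * a * b)"
  by (simp add: coeffs_inject[symmetric] dp_mult_single)

lemma dmon_zero [simp]: "dmon u 0 = 0"
  by (simp add: coeffs_inject[symmetric])

lemma dmon_one: "dmon 0 1 = 1"
  by (simp add: coeffs_inject[symmetric])

lemma dmon_add: "dmon u (a + b) = dmon u a + dmon u b"
  by (simp add: coeffs_inject[symmetric] single_add)

lemma of_nat_dpa: "of_nat n = dmon 0 (of_nat n)"
  by (induction n) (simp_all add: dmon_add dmon_one)

lemma dcoeff_add [simp]: "dcoeff (F + G) u = dcoeff F u + dcoeff G u"
  by (simp add: dcoeff_def lookup_add)

lemma dcoeff_zero [simp]: "dcoeff 0 u = 0"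
  by (simp add: dcoeff_def)

lemma dcoeff_sum: "dcoeff (sum F U) u = (\<Sum>x\<in>U. dcoeff (F x) u)"
  by (induction U rule: infinite_finite_induct) auto

lemma dcoeff_dmon: "dcoeff (dmon v c) u = (if u = v then c else 0)"
  by (auto simp: dcoeff_def lookup_single when_def)

lemma of_nat_mult_dmon: "of_nat n * dmon u a = dmon u (of_nat n * a)"
  by (simp add: of_nat_dpa dmon_mult)

lemma dcoeff_of_nat_mult: "dcoeff (of_nat n * F) u = of_nat n * dcoeff F u"
  by (induction n) (simp_all add: algebra_simps)

lemma finite_dsupp [simp]: "finite (dsupp F)"
  by (simp add: dsupp_def)

lemma in_dsupp_iff: "u \<in> dsupp F \<longleftrightarrow> dcoeff F u \<noteq> 0"
  by (simp add: dsupp_def dcoeff_def in_keys_iff)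

lemma dpa_eqI: "(\<And>u. dcoeff F u = dcoeff G u) \<Longrightarrow> F = G"
  by (auto simp: coeffs_inject[symmetric] dcoeff_def intro: poly_mapping_eqI)

lemma dpa_induct [case_names zero monom add]:
  assumes "P 0" and "\<And>u c. u \<in> dsupp F \<Longrightarrow> P (dmon u c)"
    and "\<And>F G. P F \<Longrightarrow> P G \<Longrightarrow> P (F + G)"
  shows "P F"
proof -
  have "P (of_coeffs (coeffs F))"
    using assms
    by (intro poly_mapping_single_induct[where P = "\<lambda>f. P (of_coeffs f)" and F = "coeffs F"])
      (auto simp: zero_dpa_def dsupp_def dmon_def simp flip: plus_dpa.abs_eq)
  thus ?thesis by (simp add: coeffs_inverse)
qed

text \<open>Exponents are natural numbers, so a product of monomials is constant only if both
  factors are. Multiplicativity of the augmentation rests on this.\<close>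

lemma dcoeff_mult_0: "dcoeff (F * G) 0 = dcoeff F 0 * dcoeff G 0"
proof (induction F rule: dpa_induct)
  case (monom u a)
  show ?case
  proof (induction G rule: dpa_induct)
    case (monom v b)
    have "u + v = 0 \<longleftrightarrow> u = 0 \<and> v = 0"
      by (metis add_eq_0_iff_both_eq_0 lookup_add lookup_zero poly_mapping_eqI)
    thus ?case by (auto simp: dmon_mult dcoeff_dmon)
  qed (simp_all add: distrib_left)
qed (simp_all add: distrib_right)

lemma dmon_power: "dmon v a ^ m = dmon (mscale m v) (of_nat (mpower_coeff m v) * a ^ m)"
proof (induction m)
  case 0
  show ?case by (simp add: dmon_one mpower_coeff_def)
next
  case (Suc m)
  have "mbinom v (mscale m v) * mpower_coeff m v * mfact v ^ Suc m
      = mbinom v (mscale m v) * mfact v * (mpower_coeff m v * mfact v ^ m)"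
    by (simp only: power_Suc mult_ac)
  also have "\<dots> = mfact (v + mscale m v)"
    by (simp only: mpower_coeff_mfact mbinom_mfact)
  also have "v + mscale m v = mscale (Suc m) v"
    using mscale_add[of 1 v m] by simp
  also have "mfact (mscale (Suc m) v) = mpower_coeff (Suc m) v * mfact v ^ Suc m"
    by (simp only: mpower_coeff_mfact)
  finally have "mbinom v (mscale m v) * mpower_coeff m v = mpower_coeff (Suc m) v"
    by simp
  thus ?case using Suc.IH mscale_add[of 1 v m]
    by (simp add: dmon_mult mult_ac flip: of_nat_mult mult.assoc)
qed

section \<open>Divided powers of divided power polynomials\<close>

lemma dmon_sum: "dmon u (\<Sum>x\<in>Z. f x) = (\<Sum>x\<in>Z. dmon u (f x))"
  by (induction Z rule: infinite_finite_induct) (auto simp: dmon_add)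

lemma of_coeffs_simps:
  "of_coeffs 0 = 0" "of_coeffs (f + g) = of_coeffs f + of_coeffs g"
  "of_coeffs (dp_mult f g) = of_coeffs f * of_coeffs g"
  "of_coeffs (Poly_Mapping.single 0 1) = 1"
  by (simp_all add: coeffs_inject[symmetric] of_coeffs_inverse)

lemma of_coeffs_sum: "of_coeffs (\<Sum>x\<in>Z. f x) = (\<Sum>x\<in>Z. of_coeffs (f x))"
  by (induction Z rule: infinite_finite_induct) (auto simp: of_coeffs_simps)

lemma comm_monoid_dp_monoid: "comm_monoid (dp_monoid :: ('x, 'k::field) dpoly monoid)"
proof (rule comm_monoidI)
  fix x y z :: "('x, 'k) dpoly"
  show "(x \<otimes>\<^bsub>dp_monoid\<^esub> y) \<otimes>\<^bsub>dp_monoid\<^esub> z = x \<otimes>\<^bsub>dp_monoid\<^esub> (y \<otimes>\<^bsub>dp_monoid\<^esub> z)"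
    by (simp add: dp_monoid_def dp_mult_assoc)
  show "\<one>\<^bsub>dp_monoid\<^esub> \<otimes>\<^bsub>dp_monoid\<^esub> x = x"
    using dp_mult_one[of x] by (simp add: dp_monoid_def)
  show "x \<otimes>\<^bsub>dp_monoid\<^esub> y = y \<otimes>\<^bsub>dp_monoid\<^esub> x"
    by (simp add: dp_monoid_def dp_mult_commute)
qed (simp_all add: dp_monoid_def)

lemma of_coeffs_finprod_dp_monoid:
  assumes "finite Z"
  shows "of_coeffs (finprod dp_monoid f Z) = (\<Prod>x\<in>Z. of_coeffs (f x))"
  using assms
proof (induction Z rule: finite_induct)
  case empty
  show ?case using of_coeffs_simps(4)
    by (simp add: comm_monoid.finprod_empty[OF comm_monoid_dp_monoid]) (simp add: dp_monoid_def)
next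
  case (insert x Z)
  have "f \<in> Z \<rightarrow> carrier dp_monoid" "f x \<in> carrier dp_monoid"
    by (auto simp: dp_monoid_def)
  hence "of_coeffs (finprod dp_monoid f (insert x Z))
      = of_coeffs (dp_mult (f x) (finprod dp_monoid f Z))"
    using insert by (subst comm_monoid.finprod_insert[OF comm_monoid_dp_monoid])
      (auto simp: dp_monoid_def)
  thus ?case using insert by (simp add: of_coeffs_simps)
qed

definition gmon :: "nat \<Rightarrow> ('x \<Rightarrow>\<^sub>0 nat) \<Rightarrow> 'k \<Rightarrow> ('x, 'k::field) dpa" where
  "gmon j u c = dmon (mscale j u) (of_nat (mblock_count j u) * c ^ j)"

definition gam :: "nat \<Rightarrow> ('x, 'k::field) dpa \<Rightarrow> ('x, 'k) dpa" where
  "gam m F = of_coeffs (dp_dpow m (coeffs F))"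

text \<open>The series \<open>\<Sum>j. \<gamma>\<^sub>j(c e(u)) T\<^sup>j\<close>. The divided
  powers of a sum of monomials are the coefficients of the product of their series.\<close>

definition gseries :: "('x \<Rightarrow>\<^sub>0 nat) \<Rightarrow> 'k \<Rightarrow> ('x, 'k::field) dpa fps" where
  "gseries u c = Abs_fps (\<lambda>j. gmon j u c)"

text \<open>The families on the right are those in \<open>dp_dpow\<close>, so the defining sum there
  is a coefficient of a product of power series.\<close>

lemma fps_nth_prod_PiE:
  fixes f :: "'a \<Rightarrow> 'b::comm_ring_1 fps"
  assumes "finite U"
  shows "fps_nth (\<Prod>u\<in>U. f u) m =
    (\<Sum>\<mu>\<in>{\<mu> \<in> U \<rightarrow>\<^sub>E {..m}. (\<Sum>u\<in>U. \<mu> u) = m}. \<Prod>u\<in>U. fps_nth (f u) (\<mu> u))"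
  using assms
proof (induction U arbitrary: m rule: finite_induct)
  case empty
  show ?case by (cases "m = 0") (auto simp: fps_one_nth)
next
  case (insert w U)
  define T where "T = (\<lambda>(U::'a set) m. {\<mu> \<in> U \<rightarrow>\<^sub>E {..m::nat}. (\<Sum>u\<in>U. \<mu> u) = m})"
  have "fps_nth (\<Prod>u\<in>insert w U. f u) m
      = (\<Sum>i\<in>{0..m}. \<Sum>\<mu>\<in>T U (m - i). fps_nth (f w) i * (\<Prod>u\<in>U. fps_nth (f u) (\<mu> u)))"
    using insert by (simp add: fps_mult_nth T_def sum_distrib_left)
  also have "\<dots> = (\<Sum>(i, \<mu>)\<in>Sigma {0..m} (\<lambda>i. T U (m - i)).
      fps_nth (f w) i * (\<Prod>u\<in>U. fps_nth (f u) (\<mu> u)))"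
    using insert by (intro sum.Sigma) (auto simp: T_def intro!: finite_Collect_conjI disjI1 finite_PiE)
  also have "\<dots> = (\<Sum>\<mu>\<in>T (insert w U) m. \<Prod>u\<in>insert w U. fps_nth (f u) (\<mu> u))"
  \<comment> \<open>A family on \<open>insert w U\<close> is its value at \<open>w\<close> together
    with a family on \<open>U\<close> of the remaining total. Resetting the value at
    \<open>w\<close> to \<open>undefined\<close> keeps the latter extensional.\<close>
  proof (rule sum.reindex_bij_witness
      [of _ "\<lambda>\<mu>. (\<mu> w, \<mu>(w := undefined))" "\<lambda>(i, \<mu>). \<mu>(w := i)"])
    fix z assume "z \<in> Sigma {0..m} (\<lambda>i. T U (m - i))"
    then obtain i \<mu> where z: "z = (i, \<mu>)" and i: "i \<le> m" and \<mu>: "\<mu> \<in> T U (m - i)"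
      by auto
    have eqU: "(\<Sum>u\<in>U. (\<mu>(w := i)) u) = (\<Sum>u\<in>U. \<mu> u)"
      using insert by (intro sum.cong) auto
    show "((case z of (i, \<mu>) \<Rightarrow> \<mu>(w := i)) w, (case z of (i, \<mu>) \<Rightarrow> \<mu>(w := i))(w := undefined)) = z"
      using \<mu> insert by (auto simp: z T_def PiE_def extensional_def fun_eq_iff)
    show "(case z of (i, \<mu>) \<Rightarrow> \<mu>(w := i)) \<in> T (insert w U) m"
      using i \<mu> insert eqU by (force simp: z T_def PiE_def extensional_def Pi_def)
    have "(\<Prod>u\<in>U. fps_nth (f u) ((\<mu>(w := i)) u)) = (\<Prod>u\<in>U. fps_nth (f u) (\<mu> u))"
      using insert by (intro prod.cong) auto
    thus "(\<Prod>u\<in>insert w U. fps_nth (f u) ((case z of (i, \<mu>) \<Rightarrow> \<mu>(w := i)) u))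
        = (case z of (i, \<mu>) \<Rightarrow> fps_nth (f w) i * (\<Prod>u\<in>U. fps_nth (f u) (\<mu> u)))"
      using insert by (simp add: z)
  next
    fix \<mu> assume \<mu>: "\<mu> \<in> T (insert w U) m"
    have eqU: "(\<Sum>u\<in>U. (\<mu>(w := undefined)) u) = (\<Sum>u\<in>U. \<mu> u)"
      using insert by (intro sum.cong) auto
    have tot: "\<mu> w + (\<Sum>u\<in>U. \<mu> u) = m"
      using \<mu> insert by (simp add: T_def)
    have le: "\<mu> u \<le> m - \<mu> w" if "u \<in> U" for u
      using tot member_le_sum[OF that, of \<mu>] insert by simp
    show "(case (\<mu> w, \<mu>(w := undefined)) of (i, \<mu>) \<Rightarrow> \<mu>(w := i)) = \<mu>" by simp
    show "(\<mu> w, \<mu>(w := undefined)) \<in> Sigma {0..m} (\<lambda>i. T U (m - i))"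
      using \<mu> tot le insert eqU by (auto simp: T_def PiE_def extensional_def Pi_def)
  qed
  finally show ?case by (simp add: T_def)
qed

lemma gam_eq_fps:
  assumes "finite U" "dsupp F \<subseteq> U"
  shows "gam m F = fps_nth (\<Prod>u\<in>U. gseries u (dcoeff F u)) m"
proof -
  have mon: "of_coeffs (dp_smult c (dp_dpow_monom j u)) = gmon j u d"
    if "c = d ^ j" for c d :: 'b and j and u :: "'a \<Rightarrow>\<^sub>0 nat"
    using that by (simp add: dp_smult_def dp_dpow_monom_def gmon_def dmon_def mult.commute
        mblock_count_def mpower_coeff_def power_coeff_def mscale_def)
  have "gam m F = fps_nth (\<Prod>u\<in>dsupp F. gseries u (dcoeff F u)) m"
    by (simp add: gam_def dp_dpow_def of_coeffs_sum of_coeffs_finprod_dp_monoid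
        fps_nth_prod_PiE dsupp_def gseries_def dcoeff_def mon)
  \<comment> \<open>Since \<open>0 ^ j\<close> vanishes except at \<open>j = 0\<close>, exponents
    outside the support contribute the factor \<open>1\<close> and may be added to the
    product.\<close>
  also have "gseries u 0 = 1" for u :: "'a \<Rightarrow>\<^sub>0 nat"
    by (rule fps_ext) (simp add: gseries_def gmon_def dmon_one power_0_left)
  hence "(\<Prod>u\<in>dsupp F. gseries u (dcoeff F u)) = (\<Prod>u\<in>U. gseries u (dcoeff F u))"
    using assms by (intro prod.mono_neutral_left) (auto simp: in_dsupp_iff)
  finally show ?thesis .
qed

text \<open>The binomial theorem: \<open>mblock_count_mbinom\<close> turns the product of the two
  coefficients into \<open>m choose i\<close> times a factor that does not depend on
  \<open>i\<close>.\<close>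

lemma gseries_add:
  assumes "u \<noteq> 0"
  shows "gseries u (c + d) = gseries u c * gseries u d"
proof (rule fps_ext)
  fix m
  have "fps_nth (gseries u c * gseries u d) m
     = (\<Sum>i=0..m. dmon (mscale m u) (of_nat (mblock_count m u) * (of_nat (m choose i) * c ^ i * d ^ (m - i))))"
    unfolding fps_mult_nth gseries_def fps_nth_Abs_fps gmon_def dmon_mult
  proof (rule sum.cong)
    fix i assume "i \<in> {0..m}"
    hence "i + (m - i) = m" by simp
    with mblock_count_mbinom[OF assms, of i "m - i"] mscale_add[of i u "m - i"]
    have *: "mbinom (mscale i u) (mscale (m - i) u) * mblock_count i u * mblock_count (m - i) u
        = (m choose i) * mblock_count m u"
      and **: "mscale i u + mscale (m - i) u = mscale m u" by simp_all
    have "of_nat (mbinom (mscale i u) (mscale (m - i) u)) * (of_nat (mblock_count i u) * c ^ i) *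
        (of_nat (mblock_count (m - i) u) * d ^ (m - i))
        = of_nat (mbinom (mscale i u) (mscale (m - i) u) * mblock_count i u * mblock_count (m - i) u)
          * (c ^ i * d ^ (m - i))" by (simp add: mult_ac)
    also have "\<dots> = of_nat (mblock_count m u) * (of_nat (m choose i) * c ^ i * d ^ (m - i))"
      by (subst *) (simp add: mult_ac)
    finally show "dmon (mscale i u + mscale (m - i) u)
        (of_nat (mbinom (mscale i u) (mscale (m - i) u)) * (of_nat (mblock_count i u) * c ^ i) *
         (of_nat (mblock_count (m - i) u) * d ^ (m - i)))
        = dmon (mscale m u) (of_nat (mblock_count m u) * (of_nat (m choose i) * c ^ i * d ^ (m - i)))"
      by (simp only: **)
  qed simp
  also have "\<dots> = fps_nth (gseries u (c + d)) m"
    by (simp add: gseries_def gmon_def binomial_ring dmon_sum sum_distrib_left atMost_atLeast0)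
  finally show "fps_nth (gseries u (c + d)) m = fps_nth (gseries u c * gseries u d) m" ..
qed

text \<open>Over the union of the supports the products of series multiply factor by factor. The
  vanishing constant terms keep the exponent \<open>0\<close>, excluded in
  \<open>gseries_add\<close>, out of this union.\<close>

lemma gam_add:
  assumes "dcoeff F 0 = 0" "dcoeff G 0 = 0"
  shows "gam m (F + G) = (\<Sum>i\<le>m. gam i F * gam (m - i) G)"
proof -
  let ?U = "dsupp F \<union> dsupp G"
  have U: "0 \<notin> ?U" "dsupp (F + G) \<subseteq> ?U" using assms by (auto simp: in_dsupp_iff)
  have "(\<Prod>u\<in>?U. gseries u (dcoeff (F + G) u))
      = (\<Prod>u\<in>?U. gseries u (dcoeff F u)) * (\<Prod>u\<in>?U. gseries u (dcoeff G u))"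
    unfolding prod.distrib[symmetric] dcoeff_add
    using U by (intro prod.cong refl gseries_add) auto
  thus ?thesis using U(2)
    by (simp add: gam_eq_fps[of ?U] fps_mult_nth atMost_atLeast0)
qed

lemma gam_dmon: "gam m (dmon u c) = gmon m u c"
  by (subst gam_eq_fps[of "{u}"]) (auto simp: in_dsupp_iff dcoeff_dmon gseries_def split: if_splits)

lemma gam_zero: "gam m 0 = (if m = 0 then 1 else 0)"
  by (subst gam_eq_fps[of "{}"]) (auto simp: in_dsupp_iff)

text \<open>The claim is strengthened by \<open>dcoeff F 0 = 0\<close>, so that in the sum case both
  summands are known to lie in the augmentation ideal.\<close>

lemma dpa_pos_induct [consumes 1, case_names zero monom add]:
  assumes "dcoeff F 0 = 0"
    and "P 0" and "\<And>u c. u \<in> dsupp F \<Longrightarrow> u \<noteq> 0 \<Longrightarrow> P (dmon u c)"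
    and "\<And>F G. dcoeff F 0 = 0 \<Longrightarrow> dcoeff G 0 = 0 \<Longrightarrow> P F \<Longrightarrow> P G \<Longrightarrow> P (F + G)"
  shows "P F"
proof -
  have nz: "u \<noteq> 0" if "u \<in> dsupp F" for u using that assms(1) by (auto simp: in_dsupp_iff)
  have "dcoeff F 0 = 0 \<and> P F"
    by (induction F rule: dpa_induct) (use assms(2-4) nz in \<open>auto simp: dcoeff_dmon\<close>)
  thus ?thesis ..
qed

lemma gam_0 [simp]: "dcoeff F 0 = 0 \<Longrightarrow> gam 0 F = 1"
  by (induction F rule: dpa_pos_induct) (simp_all add: gam_zero gam_dmon gmon_def dmon_one gam_add)

lemma gam_1: "dcoeff F 0 = 0 \<Longrightarrow> gam (Suc 0) F = F"
  by (induction F rule: dpa_pos_induct) (simp_all add: gam_zero gam_dmon gmon_def gam_add)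

lemma dcoeff_gam_0: "dcoeff F 0 = 0 \<Longrightarrow> m > 0 \<Longrightarrow> dcoeff (gam m F) 0 = 0"
proof (induction F arbitrary: m rule: dpa_pos_induct)
  case (add F G)
  \<comment> \<open>As \<open>m > 0\<close>, one of \<open>i\<close> and \<open>m - i\<close> is
    positive, and the corresponding factor has no constant term.\<close>
  have "dcoeff (gam i F) 0 * dcoeff (gam (m - i) G) 0 = 0" if "i \<le> m" for i
    using add.IH(1)[of i] add.IH(2)[of "m - i"] add.prems that by (cases "i = 0") auto
  hence "(\<Sum>i\<le>m. dcoeff (gam i F) 0 * dcoeff (gam (m - i) G) 0) = 0"
    by (intro sum.neutral) auto
  thus ?case using add.hyps by (simp add: gam_add dcoeff_sum dcoeff_mult_0)
qed (auto simp: gam_zero gam_dmon gmon_def dcoeff_dmon mscale_eq_0_iff eq_commute[of 0])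

text \<open>Shifts the index by \<open>s\<close> and pads with zeros up to a bound free of
  \<open>s\<close>; inner sums of different lengths then acquire a common range and can be
  interchanged with an outer sum.\<close>

lemma sum_shift:
  fixes M s N :: nat
  assumes "M + s \<le> N"
  shows "(\<Sum>b\<le>M. f b) = (\<Sum>b\<le>N. if s \<le> b \<and> b - s \<le> M then f (b - s) else (0::'a::comm_monoid_add))"
proof -
  have "(\<Sum>b\<le>N. if s \<le> b \<and> b - s \<le> M then f (b - s) else 0)
      = (\<Sum>b\<in>{b. b \<le> N \<and> s \<le> b \<and> b - s \<le> M}. f (b - s))"
    by (rule sum.mono_neutral_cong_right) auto
  also have "\<dots> = (\<Sum>b\<le>M. f b)"
    by (rule sum.reindex_bij_witness[of _ "\<lambda>b. b + s" "\<lambda>b. b - s"]) (use assms in auto)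
  finally show ?thesis ..
qed

text \<open>For \<open>F + G\<close> both sides are combinations of the products
  \<open>gam l F * gam (i + j - l) G\<close>, and equality of the coefficients is Vandermonde's
  identity.\<close>

lemma gam_mult_gam:
  assumes "dcoeff F 0 = 0"
  shows "gam i F * gam j F = of_nat ((i + j) choose i) * gam (i + j) F"
  using assms
proof (induction F arbitrary: i j rule: dpa_pos_induct)
  case (monom u c)
  have "of_nat (mbinom (mscale i u) (mscale j u)) * (of_nat (mblock_count i u) * c ^ i)
      * (of_nat (mblock_count j u) * c ^ j)
      = of_nat (mbinom (mscale i u) (mscale j u) * mblock_count i u * mblock_count j u) * c ^ (i + j)"
    by (simp add: power_add mult_ac)
  also have "\<dots> = of_nat ((i + j) choose i) * (of_nat (mblock_count (i + j) u) * c ^ (i + j))"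
    by (subst mblock_count_mbinom[OF monom(2)]) (simp add: mult_ac)
  finally show ?case
    by (simp only: gam_dmon gmon_def dmon_mult of_nat_mult_dmon mscale_add)
next
  case (add F G)
  let ?Z = "\<lambda>l. gam l F * gam (i + j - l) G"
  let ?c = "\<lambda>a l. ((l choose a) * ((i + j - l) choose (i - a)) :: nat)"
  have "gam i (F + G) * gam j (F + G)
      = (\<Sum>a\<le>i. \<Sum>b\<le>j. (gam a F * gam b F) * (gam (i - a) G * gam (j - b) G))"
    using add.hyps by (simp add: gam_add sum_product mult_ac)
  also have "\<dots> = (\<Sum>a\<le>i. \<Sum>b\<le>j. of_nat (?c a (b + a)) * ?Z (b + a))"
  proof (intro sum.cong refl)
    fix a b assume "a \<in> {..i}" "b \<in> {..j}"
    hence "i - a + (j - b) = i + j - (b + a)" by auto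
    thus "gam a F * gam b F * (gam (i - a) G * gam (j - b) G) = of_nat (?c a (b + a)) * ?Z (b + a)"
      by (simp add: add.IH mult_ac add.commute)
  qed
  also have "\<dots> = (\<Sum>a\<le>i. \<Sum>l\<le>i + j. of_nat (?c a l) * ?Z l)"
  proof (rule sum.cong[OF refl])
    fix a assume a: "a \<in> {..i}"
    have "(\<Sum>b\<le>j. of_nat (?c a (b + a)) * ?Z (b + a))
       = (\<Sum>l\<le>i + j. if a \<le> l \<and> l - a \<le> j then of_nat (?c a l) * ?Z l else 0)"
      using a by (subst sum_shift[of _ a "i + j"]) (auto intro!: sum.cong)
    \<comment> \<open>Outside the range one binomial coefficient vanishes: the first if
      \<open>l < a\<close>, the second if \<open>l - a > j\<close>.\<close>
    also have "\<dots> = (\<Sum>l\<le>i + j. of_nat (?c a l) * ?Z l)"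
      using a by (intro sum.cong refl) (auto simp: not_le binomial_eq_0)
    finally show "(\<Sum>b\<le>j. of_nat (?c a (b + a)) * ?Z (b + a)) = (\<Sum>l\<le>i + j. of_nat (?c a l) * ?Z l)" .
  qed
  also have "\<dots> = (\<Sum>l\<le>i + j. of_nat (\<Sum>a\<le>i. ?c a l) * ?Z l)"
    by (subst sum.swap) (simp add: sum_distrib_right)
  also have "\<dots> = (\<Sum>l\<le>i + j. of_nat ((i + j) choose i) * ?Z l)"
    by (intro sum.cong refl) (simp add: vandermonde)
  also have "\<dots> = of_nat ((i + j) choose i) * gam (i + j) (F + G)"
    using add.hyps by (simp add: gam_add sum_distrib_left)
  finally show ?case .
qed (auto simp: gam_zero)

text \<open>For \<open>a = 1\<close> this is \<open>F ^ i = i! \<gamma>\<^sub>i(F)\<close>, which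
  pins down the divided powers over the rationals.\<close>

lemma gam_power:
  assumes "dcoeff F 0 = 0"
  shows "gam a F ^ i = of_nat (power_coeff i a) * gam (i * a) F"
proof (induction i)
  case (Suc i)
  have "gam a F ^ Suc i = of_nat (power_coeff i a) * (gam (i * a) F * gam a F)"
    by (simp add: Suc mult_ac)
  also have "\<dots> = of_nat (power_coeff i a * ((i * a + a) choose (i * a))) * gam (i * a + a) F"
    by (simp only: gam_mult_gam[OF assms] of_nat_mult mult.assoc)
  finally show ?case by (simp only: power_coeff_Suc) (simp add: add.commute)
qed (simp add: assms)

text \<open>Induction on \<open>F\<close> and, once \<open>F\<close> is a monomial, on
  \<open>A\<close>. For two monomials the coefficients agree by
  \<open>mblock_count_add\<close>.\<close>

lemma gam_mult:
  assumes "dcoeff F 0 = 0"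
  shows "gam m (A * F) = A ^ m * gam m F"
  using assms
proof (induction F arbitrary: m rule: dpa_pos_induct)
  case (monom u c)
  have F: "dcoeff (dmon u c) 0 = 0" using monom by (simp add: dcoeff_dmon)
  show ?case
  proof (induction A arbitrary: m rule: dpa_induct)
    case (monom v d)
    have "of_nat (mblock_count m (v + u)) * (of_nat (mbinom v u) * d * c) ^ m
       = of_nat (mbinom u v ^ m * mblock_count m (u + v)) * (d ^ m * c ^ m)"
      by (simp add: power_mult_distrib mult_ac mbinom_commute add.commute)
    also have "\<dots> = of_nat (mbinom (mscale m v) (mscale m u)) * (of_nat (mpower_coeff m v) * d ^ m)
        * (of_nat (mblock_count m u) * c ^ m)"
      by (subst mblock_count_add[OF \<open>u \<noteq> 0\<close>]) (simp add: mult_ac mbinom_commute)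
    finally show ?case
      by (simp only: dmon_mult gam_dmon gmon_def dmon_power mscale_plus)
  next
    case (add A B)
    let ?F = "dmon u c"
    have "gam m ((A + B) * ?F) = (\<Sum>i\<le>m. gam i (A * ?F) * gam (m - i) (B * ?F))"
      using F by (simp add: distrib_right gam_add dcoeff_mult_0)
    also have "\<dots> = (\<Sum>i\<le>m. A ^ i * B ^ (m - i) * (gam i ?F * gam (m - i) ?F))"
      by (simp only: add.IH) (simp add: mult_ac)
    \<comment> \<open>The products \<open>gam i ?F * gam (m - i) ?F\<close> supply exactly the
      binomial coefficients of \<open>(A + B) ^ m\<close>.\<close>
    also have "\<dots> = (A + B) ^ m * gam m ?F"
      by (simp add: gam_mult_gam[OF F] binomial_ring sum_distrib_left mult_ac)
    finally show ?case .
  qed (use F in \<open>auto simp: gam_zero power_0_left\<close>)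
next
  case (add F G)
  have "(A ^ i * gam i F) * (A ^ (m - i) * gam (m - i) G) = A ^ m * (gam i F * gam (m - i) G)"
    if "i \<le> m" for i
  proof -
    have "A ^ m = A ^ i * A ^ (m - i)" using that by (simp flip: power_add)
    thus ?thesis by (simp only: mult_ac)
  qed
  thus ?case using add by (simp add: distrib_left gam_add dcoeff_mult_0 sum_distrib_left)
qed (auto simp: gam_zero power_0_left)

text \<open>
  In the expansion of \<open>\<gamma>\<^sub>i(\<Sum>l<L. \<gamma>\<^sub>l(F) \<gamma>\<^bsub>j-l\<^esub>(G))\<close> by the rules for sums, products and composites,
  \<open>comp_coeff j L i b\<close> is the coefficient of \<open>\<gamma>\<^sub>b(F) \<gamma>\<^bsub>ij-b\<^esub>(G)\<close>. It depends neither on \<open>F\<close> and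
  \<open>G\<close> nor on the field, so for \<open>L = j + 1\<close> it can be read off from the case of two variables over
  the rationals.
\<close>

definition term_coeff :: "nat \<Rightarrow> nat \<Rightarrow> nat \<Rightarrow> nat" where
  "term_coeff j l m = (if l = 0 then block_count m j else power_coeff m (j - l) * block_count m l)"

primrec comp_coeff :: "nat \<Rightarrow> nat \<Rightarrow> nat \<Rightarrow> nat \<Rightarrow> nat" where
  "comp_coeff j 0 i b = (if i = 0 \<and> b = 0 then 1 else 0)"
| "comp_coeff j (Suc L) i b = (\<Sum>m\<le>i. if m * L \<le> b \<and> b - m * L \<le> (i - m) * j
     then comp_coeff j L (i - m) (b - m * L) * term_coeff j L m *
       (b choose (m * L)) * ((i * j - b) choose (m * (j - L))) else 0)"

text \<open>The composite rule as a property of a single element, for all indices at once, so that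
  it can be assumed of each summand separately.\<close>

definition gam_comp :: "('x, 'k::field) dpa \<Rightarrow> bool" where
  "gam_comp F \<longleftrightarrow> (\<forall>i j. j > 0 \<longrightarrow> gam i (gam j F) = of_nat (block_count i j) * gam (i * j) F)"

lemma gam_comp_dmon:
  assumes "u \<noteq> 0"
  shows "gam_comp (dmon u c)"
  unfolding gam_comp_def
proof (intro allI impI)
  fix i j :: nat assume j: "j > 0"
  have "of_nat (mblock_count i (mscale j u)) * (of_nat (mblock_count j u) * c ^ j) ^ i
      = of_nat (mblock_count j u ^ i * mblock_count i (mscale j u)) * c ^ (i * j)"
    by (simp add: power_mult_distrib power_mult[symmetric] mult_ac)
  also have "\<dots> = of_nat (block_count i j) * (of_nat (mblock_count (i * j) u) * c ^ (i * j))"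
    by (subst mblock_count_mscale[OF assms j]) (simp add: mult_ac)
  finally show "gam i (gam j (dmon u c)) = of_nat (block_count i j) * gam (i * j) (dmon u c)"
    by (simp only: gam_dmon gmon_def of_nat_mult_dmon mscale_mscale)
qed

text \<open>The product rule needs one factor in the augmentation ideal. For \<open>l > 0\<close>
  this is \<open>gam l F\<close>, and the other factor leaves as an \<open>m\<close>-th power. For
  \<open>l = 0\<close> the first factor is \<open>1\<close> and the composite rule for
  \<open>G\<close> applies directly; hence the two cases in \<open>term_coeff\<close>.\<close>

lemma gam_term:
  assumes F: "dcoeff F 0 = 0" and G: "dcoeff G 0 = 0" and "gam_comp F" "gam_comp G"
    and j: "j > 0" and l: "l \<le> j"
  shows "gam m (gam l F * gam (j - l) G)
    = of_nat (term_coeff j l m) * (gam (m * l) F * gam (m * (j - l)) G)"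
proof (cases "l = 0")
  case True
  thus ?thesis using assms by (simp add: term_coeff_def gam_comp_def)
next
  case False
  have "gam m (gam (j - l) G * gam l F) = gam (j - l) G ^ m * gam m (gam l F)"
    using False F by (intro gam_mult dcoeff_gam_0) auto
  thus ?thesis using False assms
    by (simp add: term_coeff_def gam_power[OF G] gam_comp_def mult_ac)
qed

text \<open>The sum rule gives divided power \<open>m\<close> to the last term and
  \<open>i - m\<close> to the earlier ones. Collecting the two divided powers of \<open>F\<close>,
  and likewise those of \<open>G\<close>, produces the two binomial coefficients in the recursion
  for \<open>comp_coeff\<close>.\<close>

lemma gam_sum_terms:
  assumes F: "dcoeff F 0 = 0" and G: "dcoeff G 0 = 0" and "gam_comp F" "gam_comp G"
    and j: "j > 0" and "L \<le> Suc j"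
  shows "gam i (\<Sum>l<L. gam l F * gam (j - l) G)
    = (\<Sum>b\<le>i * j. of_nat (comp_coeff j L i b) * (gam b F * gam (i * j - b) G))"
  using \<open>L \<le> Suc j\<close>
proof (induction L arbitrary: i)
  case 0
  show ?case
  proof (cases "i = 0")
    case False
    thus ?thesis by (simp add: gam_zero)
  qed (simp add: gam_zero F G)
next
  case (Suc L)
  \<comment> \<open>For \<open>l = 0\<close> the factor \<open>gam j G\<close> has no constant term
    because \<open>j > 0\<close>; for \<open>l > 0\<close> the factor \<open>gam l F\<close> has
    none.\<close>
  have pos: "dcoeff (gam l F * gam (j - l) G) 0 = 0" for l
    using dcoeff_gam_0[OF F, of l] dcoeff_gam_0[OF G, of j] j
    by (cases "l = 0") (auto simp: dcoeff_mult_0)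
  let ?s = "\<Sum>l<L. gam l F * gam (j - l) G" and ?t = "gam L F * gam (j - L) G"
  let ?Y = "\<lambda>b. gam b F * gam (i * j - b) G"
  let ?c = "\<lambda>m b. comp_coeff j L (i - m) (b - m * L) * term_coeff j L m *
       (b choose (m * L)) * ((i * j - b) choose (m * (j - L)))"
  have "gam i (\<Sum>l<Suc L. gam l F * gam (j - l) G) = gam i (?t + ?s)"
    by (simp add: add.commute)
  also have "\<dots> = (\<Sum>m\<le>i. gam m ?t * gam (i - m) ?s)"
    by (rule gam_add) (simp_all add: pos dcoeff_sum)
  also have "\<dots> = (\<Sum>m\<le>i. \<Sum>b\<le>i * j. of_nat (if m * L \<le> b \<and> b - m * L \<le> (i - m) * j then ?c m b else 0) * ?Y b)"
  proof (intro sum.cong refl)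
    fix m assume "m \<in> {..i}"
    hence m: "m \<le> i" by simp
    \<comment> \<open>Writing \<open>j = L + d\<close> and \<open>i = m + e\<close> removes the
      truncated subtractions from the index arithmetic.\<close>
    obtain d where d: "j = L + d" using Suc.prems by (metis Suc_le_mono le_iff_add)
    obtain e where e: "i = m + e" using m by (metis le_iff_add)
    have le: "(i - m) * j + m * L \<le> i * j"
      by (simp add: d e algebra_simps)
    have prodY: "gam (m * L) F * gam (m * (j - L)) G * (gam b F * gam ((i - m) * j - b) G)
        = of_nat (((b + m * L) choose (m * L)) * ((i * j - (b + m * L)) choose (m * (j - L))))
          * ?Y (b + m * L)" if "b \<le> (i - m) * j" for b
    proof -
      have eq: "m * (j - L) + ((i - m) * j - b) = i * j - (b + m * L)"
        using that by (simp add: d e algebra_simps)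
      have "gam (m * L) F * gam (m * (j - L)) G * (gam b F * gam ((i - m) * j - b) G)
        = (gam (m * L) F * gam b F) * (gam (m * (j - L)) G * gam ((i - m) * j - b) G)"
        by (simp only: mult_ac)
      also have "\<dots> = of_nat (((b + m * L) choose (m * L)) * ((i * j - (b + m * L)) choose (m * (j - L))))
          * ?Y (b + m * L)"
        unfolding gam_mult_gam[OF F] gam_mult_gam[OF G] eq
        by (simp add: mult_ac add.commute)
      finally show ?thesis .
    qed
    have "gam m ?t * gam (i - m) ?s = (\<Sum>b\<le>(i - m) * j. of_nat (comp_coeff j L (i - m) b)
        * of_nat (term_coeff j L m) *
        (gam (m * L) F * gam (m * (j - L)) G * (gam b F * gam ((i - m) * j - b) G)))"
      using Suc gam_term[OF F G assms(3,4) j, of L m]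
      by (simp add: sum_distrib_left mult_ac)
    also have "\<dots> = (\<Sum>b\<le>(i - m) * j. of_nat (?c m (b + m * L)) * ?Y (b + m * L))"
      by (intro sum.cong refl) (simp only: prodY atMost_iff, simp add: mult_ac)
    also have "\<dots> = (\<Sum>b\<le>i * j. of_nat (if m * L \<le> b \<and> b - m * L \<le> (i - m) * j then ?c m b else 0) * ?Y b)"
      by (subst sum_shift[OF le]) (auto intro!: sum.cong)
    finally show "gam m ?t * gam (i - m) ?s = \<dots>" .
  qed
  also have "\<dots> = (\<Sum>b\<le>i * j. of_nat (comp_coeff j (Suc L) i b) * ?Y b)"
    by (subst sum.swap) (simp only: comp_coeff.simps of_nat_sum sum_distrib_right)
  finally show ?case .
qed

lemma gam_comp_expansion:
  assumes "dcoeff F 0 = 0" "dcoeff G 0 = 0" "gam_comp F" "gam_comp G" "j > 0"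
  shows "gam i (gam j (F + G))
    = (\<Sum>b\<le>i * j. of_nat (comp_coeff j (Suc j) i b) * (gam b F * gam (i * j - b) G))"
  using gam_sum_terms[OF assms, of "Suc j" i] assms(1,2)
  by (simp only: gam_add lessThan_Suc_atMost order_refl)

lemma power_coeff_1: "power_coeff i (Suc 0) = fact i"
  by (simp add: power_coeff_def)

text \<open>Since \<open>n! \<gamma>\<^sub>n(H) = H\<^sup>n\<close>, both sides become
  \<open>F ^ (i * j)\<close> after multiplication by \<open>fact i * fact j ^ i\<close>, and over
  the rationals this number cancels in every coefficient.\<close>

lemma gam_comp_rat:
  fixes F :: "('x, rat) dpa"
  assumes F: "dcoeff F 0 = 0"
  shows "gam_comp F"
  unfolding gam_comp_def
proof (intro allI impI)
  fix i j :: nat assume j: "j > 0"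
  have fact_gam: "of_nat (fact n) * gam n H = H ^ n" if "dcoeff H 0 = 0" for n and H :: "('x, rat) dpa"
    using gam_power[OF that, of "Suc 0" n] by (simp add: gam_1[OF that] power_coeff_1)
  have "of_nat (fact i * fact j ^ i) * gam i (gam j F) = of_nat (fact j) ^ i * gam j F ^ i"
    using fact_gam[OF dcoeff_gam_0[OF F j], of i, symmetric] by (simp add: mult_ac)
  also have "\<dots> = F ^ (i * j)"
    using fact_gam[OF F, of j] by (simp add: power_mult_distrib[symmetric] power_mult[symmetric] mult.commute)
  also have "\<dots> = of_nat (block_count i j * (fact i * fact j ^ i)) * gam (i * j) F"
    using fact_gam[OF F, of "i * j"] by (simp only: block_count_fact[OF j])
  finally have eq: "of_nat (fact i * fact j ^ i) * gam i (gam j F)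
      = of_nat (fact i * fact j ^ i) * (of_nat (block_count i j) * gam (i * j) F)"
    by (simp add: mult_ac)
  show "gam i (gam j F) = of_nat (block_count i j) * gam (i * j) F"
  proof (rule dpa_eqI)
    fix u
    show "dcoeff (gam i (gam j F)) u = dcoeff (of_nat (block_count i j) * gam (i * j) F) u"
      using arg_cong[OF eq, of "\<lambda>H. dcoeff H u"] unfolding dcoeff_of_nat_mult by simp
  qed
qed

text \<open>For two independent variables over the rationals the products
  \<open>gam b F * gam (i * j - b) G\<close> are nonzero multiples of monomials that differ in the
  exponent \<open>b\<close> of the first variable. Hence an equation between their combinations can
  be compared term by term.\<close>

lemma comp_coeff_eq_block_count:
  assumes j: "j > 0" and b: "b \<le> i * j"
  shows "comp_coeff j (Suc j) i b = block_count i j"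
proof -
  let ?x = "Poly_Mapping.single (0::nat) (1::nat)" and ?y = "Poly_Mapping.single (1::nat) (1::nat)"
  define F G :: "(nat, rat) dpa" where "F = dmon ?x 1" and "G = dmon ?y 1"
  have pos: "dcoeff F 0 = 0" "dcoeff G 0 = 0"
    by (auto simp: F_def G_def dcoeff_dmon dest: arg_cong[of _ _ keys])
  define M where "M = (\<lambda>b. mscale b ?x + mscale (i * j - b) ?y)"
  define w where "w = (\<lambda>b. of_nat (mbinom (mscale b ?x) (mscale (i * j - b) ?y)
      * mblock_count b ?x * mblock_count (i * j - b) ?y) :: rat)"
  have FG: "gam b F * gam (i * j - b) G = dmon (M b) (w b)" for b
    by (simp add: F_def G_def gam_dmon gmon_def dmon_mult M_def w_def)
  have M_inj: "M b = M b' \<longleftrightarrow> b = b'" for b b'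
  proof
    assume "M b = M b'"
    hence "lookup (M b) 0 = lookup (M b') 0" by simp
    thus "b = b'" by (simp add: M_def lookup_add lookup_single)
  qed simp
  have nz: "w b \<noteq> 0" for b
  proof -
    have "mbinom u v \<noteq> 0" for u v :: "nat \<Rightarrow>\<^sub>0 nat"
      using mbinom_mfact[of u v] mfact_nonzero[of "u + v"] by (metis mult_zero_left)
    moreover have "mblock_count n u \<noteq> 0" if "u \<noteq> 0" for n and u :: "nat \<Rightarrow>\<^sub>0 nat"
      using mblock_count_mfact[OF that, of n] mfact_nonzero[of "mscale n u"] by (metis mult_zero_left)
    moreover have "?x \<noteq> 0" "?y \<noteq> 0" by (auto dest: arg_cong[of _ _ keys])
    ultimately show ?thesis by (simp add: w_def)
  qed
  \<comment> \<open>The same element is computed once by the general expansion and once by the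
    composite rule over the rationals.\<close>
  have "(\<Sum>b\<le>i * j. of_nat (comp_coeff j (Suc j) i b) * dmon (M b) (w b))
      = gam i (gam j (F + G))"
    using pos j by (simp only: gam_comp_expansion gam_comp_rat FG)
  also have "\<dots> = of_nat (block_count i j) * gam (i * j) (F + G)"
    using gam_comp_rat[of "F + G"] pos j by (simp add: gam_comp_def)
  also have "\<dots> = (\<Sum>b\<le>i * j. of_nat (block_count i j) * dmon (M b) (w b))"
    by (simp add: gam_add pos FG sum_distrib_left)
  finally have "dcoeff (\<Sum>b\<le>i * j. of_nat (comp_coeff j (Suc j) i b) * dmon (M b) (w b)) (M b)
      = dcoeff (\<Sum>b\<le>i * j. of_nat (block_count i j) * dmon (M b) (w b)) (M b)"
    by simp
  hence "of_nat (comp_coeff j (Suc j) i b) * w b = of_nat (block_count i j) * w b"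
    using b by (simp add: dcoeff_sum of_nat_mult_dmon dcoeff_dmon M_inj del: comp_coeff.simps)
  thus ?thesis using nz[of b] by (simp del: comp_coeff.simps)
qed

text \<open>For \<open>F + G\<close> over any field, all coefficients of the expansion equal
  \<open>block_count i j\<close>, so the sum rule contracts it to a multiple of
  \<open>gam (i * j) (F + G)\<close>.\<close>

theorem gam_gam:
  assumes "dcoeff F 0 = 0" "j > 0"
  shows "gam i (gam j F) = of_nat (block_count i j) * gam (i * j) F"
proof -
  have "gam_comp F" using assms(1)
  proof (induction F rule: dpa_pos_induct)
    case zero
    have "block_count 0 j = 1" for j by (simp add: block_count_def)
    thus ?case by (auto simp: gam_comp_def gam_zero)
  next
    case (add F G)
    show ?case unfolding gam_comp_def
    proof (intro allI impI)
      fix i j :: nat assume "j > 0"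
      thus "gam i (gam j (F + G)) = of_nat (block_count i j) * gam (i * j) (F + G)"
        using add
        by (subst gam_comp_expansion)
          (simp_all add: comp_coeff_eq_block_count gam_add sum_distrib_left del: comp_coeff.simps)
    qed
  qed (rule gam_comp_dmon)
  thus ?thesis using assms(2) by (simp add: gam_comp_def)
qed

section \<open>Divided power algebras\<close>

text \<open>
  The locale \<open>pd_algebra\<close> cannot serve here: its \<open>ring_of_type_algebra\<close> is not a library constant
  but a free variable, hence any ring whatsoever, and so the locale has no model. Below, the
  scalars are the type \<open>'k\<close> itself, and integer multiples are written as scalar multiples.
\<close>

locale pd_alg = cring A for A :: "('k::field, 'a) pdalg" (structure) +
  assumes smult_closed [simp, intro]: "x \<in> carrier A \<Longrightarrow> c \<odot> x \<in> carrier A"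
    and smult_l_distr: "x \<in> carrier A \<Longrightarrow> (c + d) \<odot> x = c \<odot> x \<oplus> d \<odot> x"
    and smult_r_distr: "x \<in> carrier A \<Longrightarrow> y \<in> carrier A \<Longrightarrow> c \<odot> (x \<oplus> y) = c \<odot> x \<oplus> c \<odot> y"
    and smult_assoc1: "x \<in> carrier A \<Longrightarrow> (c * d) \<odot> x = c \<odot> (d \<odot> x)"
    and smult_one [simp]: "x \<in> carrier A \<Longrightarrow> 1 \<odot> x = x"
    and smult_assoc2: "x \<in> carrier A \<Longrightarrow> y \<in> carrier A \<Longrightarrow> (c \<odot> x) \<otimes> y = c \<odot> (x \<otimes> y)"
    and aug_add: "x \<in> carrier A \<Longrightarrow> y \<in> carrier A \<Longrightarrow> aug A (x \<oplus> y) = aug A x + aug A y"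
    and aug_mult: "x \<in> carrier A \<Longrightarrow> y \<in> carrier A \<Longrightarrow> aug A (x \<otimes> y) = aug A x * aug A y"
    and aug_smult_one: "aug A (c \<odot> \<one>) = c"
    and dpow_0: "x \<in> plus_ideal A \<Longrightarrow> dpow A 0 x = \<one>"
    and dpow_1: "x \<in> plus_ideal A \<Longrightarrow> dpow A (Suc 0) x = x"
    and dpow_closed: "x \<in> plus_ideal A \<Longrightarrow> 0 < i \<Longrightarrow> dpow A i x \<in> plus_ideal A"
    and dpow_add: "x \<in> plus_ideal A \<Longrightarrow> y \<in> plus_ideal A \<Longrightarrow>
          dpow A m (x \<oplus> y) = (\<Oplus>i\<in>{..m}. dpow A i x \<otimes> dpow A (m - i) y)"
    and dpow_mult: "a \<in> carrier A \<Longrightarrow> x \<in> plus_ideal A \<Longrightarrow>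
          dpow A m (a \<otimes> x) = (a [^] m) \<otimes> dpow A m x"
    and dpow_mult_dpow: "x \<in> plus_ideal A \<Longrightarrow>
          dpow A i x \<otimes> dpow A j x = of_nat ((i + j) choose i) \<odot> dpow A (i + j) x"
    and dpow_dpow: "x \<in> plus_ideal A \<Longrightarrow> 0 < j \<Longrightarrow>
          dpow A i (dpow A j x) = of_nat (block_count i j) \<odot> dpow A (i * j) x"

section \<open>The axioms for the free divided power algebra\<close>

definition dsub :: "'x set \<Rightarrow> ('x, 'k::field) dpa set" where
  "dsub S = {F. \<forall>u\<in>dsupp F. keys u \<subseteq> S}"

lemma dsupp_add: "dsupp (F + G) \<subseteq> dsupp F \<union> dsupp G"
  by (auto simp: in_dsupp_iff)

lemma dsupp_zero [simp]: "dsupp 0 = {}"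
  by (auto simp: in_dsupp_iff)

lemma dsub_zero [simp]: "0 \<in> dsub S"
  by (simp add: dsub_def)

lemma dsub_add: "F \<in> dsub S \<Longrightarrow> G \<in> dsub S \<Longrightarrow> F + G \<in> dsub S"
  using dsupp_add[of F G] by (auto simp: dsub_def)

lemma dsub_dmon: "keys u \<subseteq> S \<Longrightarrow> dmon u c \<in> dsub S"
  by (auto simp: dsub_def in_dsupp_iff dcoeff_dmon split: if_splits)

lemma dsub_one [simp]: "1 \<in> dsub S"
  using dsub_dmon[of 0 S 1] by (simp add: dmon_one)

lemma dsub_sum: "(\<And>i. i \<in> I \<Longrightarrow> F i \<in> dsub S) \<Longrightarrow> (\<Sum>i\<in>I. F i) \<in> dsub S"
  by (induction I rule: infinite_finite_induct) (auto intro: dsub_add)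

lemma dsub_mult:
  assumes "F \<in> dsub S" "G \<in> dsub S"
  shows "F * G \<in> dsub S"
proof -
  have mon: "dmon u a * G \<in> dsub S" if u: "keys u \<subseteq> S" for u a
  proof (induction G rule: dpa_induct)
    case (monom v b)
    hence "keys v \<subseteq> S" using assms(2) by (simp add: dsub_def)
    hence "keys (u + v) \<subseteq> S" using u Poly_Mapping.keys_add[of u v] by blast
    thus ?case by (simp only: dmon_mult dsub_dmon)
  qed (simp_all add: distrib_left dsub_add)
  show ?thesis
  proof (induction F rule: dpa_induct)
    case (monom u a)
    hence "keys u \<subseteq> S" using assms(1) by (simp add: dsub_def)
    thus ?case by (rule mon)
  qed (simp_all add: distrib_right dsub_add)
qed

lemma dsub_gam:
  assumes "F \<in> dsub S" "dcoeff F 0 = 0"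
  shows "gam m F \<in> dsub S"
proof -
  have *: "keys u \<subseteq> S" if "u \<in> dsupp F" for u using assms(1) that by (simp add: dsub_def)
  have "\<forall>m. gam m F \<in> dsub S" using assms(2)
  proof (induction F rule: dpa_pos_induct)
    case (monom u c)
    thus ?case using *[of u] keys_mscale by (fastforce simp: gam_dmon gmon_def intro!: dsub_dmon)
  qed (auto simp: gam_zero gam_add intro!: dsub_sum dsub_mult)
  thus ?thesis ..
qed

lemma free_pd_simps [simp]:
  "\<zero>\<^bsub>free_pd S\<^esub> = 0" "\<one>\<^bsub>free_pd S\<^esub> = Poly_Mapping.single 0 1"
  "f \<oplus>\<^bsub>free_pd S\<^esub> g = f + g" "f \<otimes>\<^bsub>free_pd S\<^esub> g = dp_mult f g"
  "c \<odot>\<^bsub>free_pd S\<^esub> f = dp_smult c f" "aug (free_pd S) f = lookup f 0"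
  "dpow (free_pd S) = dp_dpow"
  by (simp_all add: free_pd_def)

lemma free_pd_carrier: "f \<in> carrier (free_pd S) \<longleftrightarrow> of_coeffs f \<in> dsub S"
  by (simp add: free_pd_def dsub_def dsupp_def of_coeffs_inverse)

lemma free_pd_plus:
  "f \<in> plus_ideal (free_pd S) \<longleftrightarrow> of_coeffs f \<in> dsub S \<and> dcoeff (of_coeffs f) 0 = 0"
  by (simp add: plus_ideal_def free_pd_carrier dcoeff_def of_coeffs_inverse)

lemma of_coeffs_dp_dpow: "of_coeffs (dp_dpow m f) = gam m (of_coeffs f)"
  by (simp add: gam_def of_coeffs_inverse)

lemma of_coeffs_dp_smult:
  fixes f :: "('x, 'k::field) dpoly"
  shows "of_coeffs (dp_smult c f) = dmon 0 c * of_coeffs f"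
proof (rule dpa_eqI)
  fix u
  have *: "dcoeff (dmon 0 c * F) u = c * dcoeff F u" for F :: "('x, 'k) dpa"
    by (induction F rule: dpa_induct) (simp_all add: dmon_mult dcoeff_dmon algebra_simps)
  show "dcoeff (of_coeffs (dp_smult c f)) u = dcoeff (dmon 0 c * of_coeffs f) u"
    using *[of "of_coeffs f"]
    by (simp add: dp_smult_def dcoeff_def of_coeffs_inverse Poly_Mapping.map.rep_eq when_def)
qed

lemma of_coeffs_single: "of_coeffs (Poly_Mapping.single u c) = dmon u c"
  by (simp add: dmon_def)

lemmas of_coeffs_hom = of_coeffs_simps of_coeffs_dp_dpow of_coeffs_dp_smult

lemma of_coeffs_eq_iff: "of_coeffs f = of_coeffs g \<longleftrightarrow> f = g"
  by (simp add: of_coeffs_inject)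

lemma cring_free_pd: "cring (free_pd S :: ('k::field, ('x, 'k) dpoly) pdalg)"
proof (rule cringI)
  show "abelian_group (free_pd S :: ('k, ('x, 'k) dpoly) pdalg)"
  proof (rule abelian_groupI)
    fix f :: "('x, 'k) dpoly" assume f: "f \<in> carrier (free_pd S)"
    hence "- f \<in> carrier (free_pd S)" by (simp add: free_pd_def)
    thus "\<exists>g\<in>carrier (free_pd S). g \<oplus>\<^bsub>free_pd S\<^esub> f = \<zero>\<^bsub>free_pd S\<^esub>"
      by (intro bexI[of _ "- f"]) auto
  qed (auto simp: free_pd_carrier of_coeffs_simps add_ac intro: dsub_add)
  show "comm_monoid (free_pd S :: ('k, ('x, 'k) dpoly) pdalg)"
    by (rule comm_monoidI)
      (auto simp: free_pd_carrier dsub_mult mult_ac of_coeffs_simps dsub_one simp flip: of_coeffs_eq_iff simp del: single_one)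
qed (simp add: dp_mult_add_left)

lemma of_coeffs_free_pd_pow:
  fixes f :: "('x, 'k::field) dpoly"
  shows "of_coeffs (f [^]\<^bsub>free_pd S\<^esub> (n::nat)) = of_coeffs f ^ n"
proof -
  interpret cring "free_pd S :: ('k, ('x, 'k) dpoly) pdalg" by (rule cring_free_pd)
  show ?thesis
    by (induction n) (simp_all add: of_coeffs_simps mult.commute del: single_one)
qed

lemma of_coeffs_free_pd_finsum:
  fixes f :: "'i \<Rightarrow> ('x, 'k::field) dpoly"
  assumes "\<And>i. i \<in> I \<Longrightarrow> f i \<in> carrier (free_pd S)"
  shows "of_coeffs (\<Oplus>\<^bsub>free_pd S\<^esub>i\<in>I. f i) = (\<Sum>i\<in>I. of_coeffs (f i))"
proof -
  interpret cring "free_pd S :: ('k, ('x, 'k) dpoly) pdalg" by (rule cring_free_pd)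
  show ?thesis using assms
    by (induction I rule: infinite_finite_induct) (simp_all add: of_coeffs_simps Pi_def)
qed

text \<open>All operations commute with the passage \<open>of_coeffs\<close> to the copied type,
  where each axiom is an identity already shown for \<open>gam\<close>.\<close>

theorem pd_alg_free_pd: "pd_alg (free_pd S :: ('k::field, ('x, 'k) dpoly) pdalg)"
proof -
  interpret cring "free_pd S :: ('k, ('x, 'k) dpoly) pdalg" by (rule cring_free_pd)
  note [simp] = free_pd_carrier free_pd_plus of_coeffs_hom of_coeffs_free_pd_pow dsub_add dsub_mult
    dsub_dmon dsub_gam
  \<comment> \<open>The unit has to keep the form \<open>Poly_Mapping.single 0 1\<close>; as the
    \<open>1\<close> of the coefficient functions it would belong to the polynomial product.\<close>
  note [simp del] = single_one
  show ?thesis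
  proof (unfold_locales)
    fix f g :: "('x, 'k) dpoly" and c d :: 'k
    show "f \<in> carrier (free_pd S) \<Longrightarrow> c \<odot>\<^bsub>free_pd S\<^esub> f \<in> carrier (free_pd S)" by simp
    show "(c + d) \<odot>\<^bsub>free_pd S\<^esub> f = c \<odot>\<^bsub>free_pd S\<^esub> f \<oplus>\<^bsub>free_pd S\<^esub> d \<odot>\<^bsub>free_pd S\<^esub> f"
      by (simp add: dmon_add distrib_right flip: of_coeffs_eq_iff)
    show "c \<odot>\<^bsub>free_pd S\<^esub> (f \<oplus>\<^bsub>free_pd S\<^esub> g) = c \<odot>\<^bsub>free_pd S\<^esub> f \<oplus>\<^bsub>free_pd S\<^esub> c \<odot>\<^bsub>free_pd S\<^esub> g"
      by (simp add: distrib_left flip: of_coeffs_eq_iff)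
    show "(c * d) \<odot>\<^bsub>free_pd S\<^esub> f = c \<odot>\<^bsub>free_pd S\<^esub> (d \<odot>\<^bsub>free_pd S\<^esub> f)"
      by (simp add: dmon_mult flip: of_coeffs_eq_iff mult.assoc)
    show "1 \<odot>\<^bsub>free_pd S\<^esub> f = f"
      by (simp add: dmon_one flip: of_coeffs_eq_iff)
    show "c \<odot>\<^bsub>free_pd S\<^esub> f \<otimes>\<^bsub>free_pd S\<^esub> g = c \<odot>\<^bsub>free_pd S\<^esub> (f \<otimes>\<^bsub>free_pd S\<^esub> g)"
      by (simp add: mult.assoc flip: of_coeffs_eq_iff)
    show "aug (free_pd S) (f \<oplus>\<^bsub>free_pd S\<^esub> g) = aug (free_pd S) f + aug (free_pd S) g"
      by (simp add: lookup_add)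
    show "aug (free_pd S) (f \<otimes>\<^bsub>free_pd S\<^esub> g) = aug (free_pd S) f * aug (free_pd S) g"
      using dcoeff_mult_0[of "of_coeffs f" "of_coeffs g"] by (simp add: dcoeff_def of_coeffs_inverse)
    show "aug (free_pd S) (c \<odot>\<^bsub>free_pd S\<^esub> \<one>\<^bsub>free_pd S\<^esub>) = c"
      by (simp add: dp_smult_def)
    fix i j m :: nat
    assume f: "f \<in> plus_ideal (free_pd S)"
    show "dpow (free_pd S) 0 f = \<one>\<^bsub>free_pd S\<^esub>" "dpow (free_pd S) (Suc 0) f = f"
      using f by (simp_all add: gam_1 flip: of_coeffs_eq_iff)
    show "0 < i \<Longrightarrow> dpow (free_pd S) i f \<in> plus_ideal (free_pd S)"
      using f by (simp add: dcoeff_gam_0)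
    show "dpow (free_pd S) m (f \<oplus>\<^bsub>free_pd S\<^esub> g) =
        (\<Oplus>\<^bsub>free_pd S\<^esub>i\<in>{..m}. dpow (free_pd S) i f \<otimes>\<^bsub>free_pd S\<^esub> dpow (free_pd S) (m - i) g)"
      if "g \<in> plus_ideal (free_pd S)"
      using f that by (simp add: gam_add of_coeffs_free_pd_finsum flip: of_coeffs_eq_iff)
    show "dpow (free_pd S) m (g \<otimes>\<^bsub>free_pd S\<^esub> f)
        = g [^]\<^bsub>free_pd S\<^esub> m \<otimes>\<^bsub>free_pd S\<^esub> dpow (free_pd S) m f"
      using f by (simp add: gam_mult flip: of_coeffs_eq_iff)
    show "dpow (free_pd S) i f \<otimes>\<^bsub>free_pd S\<^esub> dpow (free_pd S) j f
        = of_nat ((i + j) choose i) \<odot>\<^bsub>free_pd S\<^esub> dpow (free_pd S) (i + j) f"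
      using f by (simp add: gam_mult_gam of_nat_dpa flip: of_coeffs_eq_iff)
    show "0 < j \<Longrightarrow> dpow (free_pd S) i (dpow (free_pd S) j f)
        = of_nat (block_count i j) \<odot>\<^bsub>free_pd S\<^esub> dpow (free_pd S) (i * j) f"
      using f by (simp add: gam_gam of_nat_dpa flip: of_coeffs_eq_iff)
  qed
qed

subsection \<open>The universal property of the free divided power algebra\<close>

context pd_alg
begin

lemma plus_carrier [dest]: "x \<in> plus_ideal A \<Longrightarrow> x \<in> carrier A"
  by (simp add: plus_ideal_def)

lemma dpow_carrier [simp]: "x \<in> plus_ideal A \<Longrightarrow> dpow A i x \<in> carrier A"
  using plus_carrier by (cases "i = 0") (simp_all add: dpow_0 dpow_closed)

lemma smult_zero_left [simp]: "x \<in> carrier A \<Longrightarrow> 0 \<odot> x = \<zero>"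
  using smult_l_distr[of x 0 0] smult_closed[of x 0] by (simp add: add.l_cancel_one')

lemma smult_zero_right [simp]: "c \<odot> \<zero> = \<zero>"
  using smult_r_distr[of \<zero> \<zero> c] smult_closed[of \<zero> c] by (simp add: add.l_cancel_one')

lemma smult_minus_left: "x \<in> carrier A \<Longrightarrow> (- c) \<odot> x = \<ominus> (c \<odot> x)"
  using smult_l_distr[of x "- c" c] by (intro sum_zero_eq_neg) simp_all

lemma smult_mult_right:
  "x \<in> carrier A \<Longrightarrow> y \<in> carrier A \<Longrightarrow> x \<otimes> (c \<odot> y) = c \<odot> (x \<otimes> y)"
  using smult_assoc2[of y x c] by (simp add: m_comm)

lemma smult_one_mult: "x \<in> carrier A \<Longrightarrow> (c \<odot> \<one>) \<otimes> x = c \<odot> x"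
  by (simp add: smult_assoc2)

lemma smult_mult_smult:
  "x \<in> carrier A \<Longrightarrow> y \<in> carrier A \<Longrightarrow> (c \<odot> x) \<otimes> (d \<odot> y) = (c * d) \<odot> (x \<otimes> y)"
  by (simp add: smult_assoc2 smult_mult_right smult_assoc1[symmetric] mult.commute)

lemma smult_smult: "x \<in> carrier A \<Longrightarrow> c \<odot> (d \<odot> x) = (c * d) \<odot> x"
  by (simp add: smult_assoc1)

lemma smult_pow: "x \<in> carrier A \<Longrightarrow> (c \<odot> x) [^] (n::nat) = c ^ n \<odot> (x [^] n)"
  by (induction n) (simp_all add: smult_mult_smult mult.commute)

lemma aug_smult: "x \<in> carrier A \<Longrightarrow> aug A (c \<odot> x) = c * aug A x"
  using aug_mult[of "c \<odot> \<one>" x] by (simp add: smult_one_mult aug_smult_one)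

lemma aug_one [simp]: "aug A \<one> = 1"
  using aug_smult_one[of 1] by simp

lemma aug_zero [simp]: "aug A \<zero> = 0"
  using aug_smult[of \<zero> 0] by simp

lemma plus_zero [simp]: "\<zero> \<in> plus_ideal A"
  by (simp add: plus_ideal_def)

lemma plus_mult [simp]: "x \<in> carrier A \<Longrightarrow> y \<in> plus_ideal A \<Longrightarrow> x \<otimes> y \<in> plus_ideal A"
  by (simp add: plus_ideal_def aug_mult)

declare plus_carrier [simp]

lemma dpow_smult: "x \<in> plus_ideal A \<Longrightarrow> dpow A m (c \<odot> x) = c ^ m \<odot> dpow A m x"
  using dpow_mult[of "c \<odot> \<one>" x m] by (simp add: smult_one_mult smult_pow)

lemma dpow_zero: "dpow A m \<zero> = (if m = 0 then \<one> else \<zero>)"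
  using dpow_smult[of \<zero> m 0] by (cases "m = 0") (simp_all add: dpow_0 power_0_left)

lemma dpow_pow:
  assumes "x \<in> plus_ideal A"
  shows "dpow A a x [^] i = of_nat (power_coeff i a) \<odot> dpow A (i * a) x"
proof (induction i)
  case (Suc i)
  have "dpow A a x [^] Suc i = of_nat (power_coeff i a) \<odot> (dpow A (i * a) x \<otimes> dpow A a x)"
    using assms by (simp add: Suc smult_assoc2)
  also have "\<dots> = of_nat (power_coeff i a * ((i * a + a) choose (i * a))) \<odot> dpow A (i * a + a) x"
    using assms by (simp add: dpow_mult_dpow smult_smult)
  finally show ?case by (simp only: power_coeff_Suc) (simp add: add.commute)
qed (simp add: assms dpow_0)

lemma finprod_smult:
  assumes "finite U" "y \<in> U \<rightarrow> carrier A"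
  shows "(\<Otimes>x\<in>U. c x \<odot> y x) = (\<Prod>x\<in>U. c x) \<odot> (\<Otimes>x\<in>U. y x)"
  using assms by (induction U rule: finite_induct) (simp_all add: Pi_def smult_mult_smult)

lemma finprod_pow:
  assumes "finite U" "y \<in> U \<rightarrow> carrier A"
  shows "(\<Otimes>x\<in>U. y x) [^] (n::nat) = (\<Otimes>x\<in>U. y x [^] n)"
  using assms by (induction U rule: finite_induct) (simp_all add: Pi_def nat_pow_distrib)

text \<open>The value forced on the monomial \<open>e(u)\<close> by a morphism with
  \<open>x \<mapsto> g x\<close>.\<close>

definition mon :: "('x \<Rightarrow> 'a) \<Rightarrow> ('x \<Rightarrow>\<^sub>0 nat) \<Rightarrow> 'a" where
  "mon g u = (\<Otimes>x\<in>keys u. dpow A (lookup u x) (g x))"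

end

locale pd_alg_lift = pd_alg A for A :: "('k::field, 'a) pdalg" (structure) +
  fixes S :: "'x set" and g :: "'x \<Rightarrow> 'a"
  assumes g: "x \<in> S \<Longrightarrow> g x \<in> plus_ideal A"
begin

lemma mon_superset:
  assumes "finite U" "keys u \<subseteq> U" "U \<subseteq> S"
  shows "mon g u = (\<Otimes>x\<in>U. dpow A (lookup u x) (g x))"
  unfolding mon_def using assms g
  by (intro finprod_mono_neutral_cong_left) (auto simp: in_keys_iff dpow_0)

lemma mon_closed [simp]: "keys u \<subseteq> S \<Longrightarrow> mon g u \<in> carrier A"
  unfolding mon_def using g by (intro finprod_closed) auto

lemma mon_0 [simp]: "mon g 0 = \<one>"
  by (simp add: mon_def)

lemma mon_mult:
  assumes u: "keys u \<subseteq> S" and v: "keys v \<subseteq> S"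
  shows "mon g u \<otimes> mon g v = of_nat (mbinom u v) \<odot> mon g (u + v)"
proof -
  let ?U = "keys u \<union> keys v"
  have U: "finite ?U" "?U \<subseteq> S" "keys (u + v) \<subseteq> ?U"
    using u v Poly_Mapping.keys_add[of u v] by auto
  have g': "\<And>x n. x \<in> ?U \<Longrightarrow> dpow A n (g x) \<in> carrier A" using U(2) g by auto
  have "mon g u \<otimes> mon g v
      = (\<Otimes>x\<in>?U. dpow A (lookup u x) (g x) \<otimes> dpow A (lookup v x) (g x))"
    using U g' by (simp add: mon_superset[of ?U] finprod_multf Pi_def)
  also have "\<dots> = (\<Otimes>x\<in>?U. of_nat (lookup u x + lookup v x choose lookup u x)
      \<odot> dpow A (lookup (u + v) x) (g x))"
    using U g by (intro finprod_cong') (auto simp: dpow_mult_dpow lookup_add)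
  also have "\<dots> = of_nat (mbinom u v) \<odot> mon g (u + v)"
    using U g' by (simp add: finprod_smult Pi_def mbinom_def mon_superset[of ?U])
  finally show ?thesis .
qed

text \<open>Isolates a factor in the augmentation ideal, from which both membership and the divided
  powers of the whole product are computed.\<close>

lemma mon_split:
  assumes "x \<in> keys u" "keys u \<subseteq> S"
  shows "mon g u = (\<Otimes>y\<in>keys u - {x}. dpow A (lookup u y) (g y)) \<otimes> dpow A (lookup u x) (g x)"
proof -
  have "mon g u = (\<Otimes>y\<in>insert x (keys u - {x}). dpow A (lookup u y) (g y))"
    unfolding mon_def using assms by (simp add: insert_absorb)
  also have "\<dots> = dpow A (lookup u x) (g x) \<otimes> (\<Otimes>y\<in>keys u - {x}. dpow A (lookup u y) (g y))"
    using assms g by (subst finprod_insert) auto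
  also have "\<dots> = (\<Otimes>y\<in>keys u - {x}. dpow A (lookup u y) (g y)) \<otimes> dpow A (lookup u x) (g x)"
    using assms g by (intro m_comm finprod_closed) auto
  finally show ?thesis .
qed

lemma mon_plus:
  assumes "u \<noteq> 0" "keys u \<subseteq> S"
  shows "mon g u \<in> plus_ideal A"
proof -
  obtain x where x: "x \<in> keys u" using assms by (metis all_not_in_conv keys_eq_empty)
  hence "lookup u x > 0" by (simp add: in_keys_iff)
  thus ?thesis unfolding mon_split[OF x assms(2)]
    using x assms(2) g by (intro plus_mult dpow_closed finprod_closed) auto
qed

text \<open>By the product rule only the isolated factor receives a divided power, while the others
  are raised to the power \<open>j\<close>. The coefficients combine as in
  \<open>mblock_count_split\<close>.\<close>

lemma dpow_mon:
  assumes "u \<noteq> 0" "keys u \<subseteq> S"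
  shows "dpow A j (mon g u) = of_nat (mblock_count j u) \<odot> mon g (mscale j u)"
proof -
  obtain x where x: "x \<in> keys u" using assms by (metis all_not_in_conv keys_eq_empty)
  hence pos: "lookup u x > 0" by (simp add: in_keys_iff)
  let ?W = "keys u - {x}"
  have gx: "g x \<in> plus_ideal A" using x assms g by auto
  have g': "\<And>y n. y \<in> ?W \<Longrightarrow> dpow A n (g y) \<in> carrier A" using assms(2) g by auto
  have "(\<Otimes>y\<in>?W. dpow A (lookup u y) (g y)) [^] j
      = (\<Otimes>y\<in>?W. of_nat (power_coeff j (lookup u y)) \<odot> dpow A (j * lookup u y) (g y))"
    using g' assms(2) g by (subst finprod_pow) (auto intro!: finprod_cong' simp: dpow_pow)
  also have "\<dots> = of_nat (\<Prod>y\<in>?W. power_coeff j (lookup u y))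
      \<odot> (\<Otimes>y\<in>?W. dpow A (j * lookup u y) (g y))" (is "_ = ?c \<odot> ?p")
    using g' by (simp add: finprod_smult Pi_def)
  finally have p: "(\<Otimes>y\<in>?W. dpow A (lookup u y) (g y)) [^] j = ?c \<odot> ?p" .
  have p_closed: "?p \<in> carrier A" using g' by (intro finprod_closed) auto
  have "dpow A j (mon g u) = (\<Otimes>y\<in>?W. dpow A (lookup u y) (g y)) [^] j
      \<otimes> dpow A j (dpow A (lookup u x) (g x))"
    unfolding mon_split[OF x assms(2)] using g' gx pos
    by (intro dpow_mult finprod_closed dpow_closed) auto
  also have "\<dots> = (?c \<odot> ?p) \<otimes> (of_nat (block_count j (lookup u x)) \<odot> dpow A (j * lookup u x) (g x))"
    using gx pos by (simp only: p dpow_dpow)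
  also have "\<dots> = of_nat (mblock_count j u) \<odot> (?p \<otimes> dpow A (j * lookup u x) (g x))"
    using p_closed gx by (simp add: smult_mult_smult mblock_count_split[OF x] mult.commute)
  also have "?p \<otimes> dpow A (j * lookup u x) (g x) = (\<Otimes>y\<in>insert x ?W. dpow A (j * lookup u y) (g y))"
    using p_closed gx g' by (subst finprod_insert) (auto intro!: m_comm)
  also have "\<dots> = mon g (mscale j u)"
    using x assms keys_mscale[of j u]
    by (subst mon_superset[of "keys u"]) (auto simp: insert_absorb)
  finally show ?thesis .
qed

abbreviation lift :: "('x, 'k) dpoly \<Rightarrow> 'a" where
  "lift \<equiv> pd_lift A g"

lemma lift_superset:
  assumes "f \<in> carrier (free_pd S)" "finite U" "keys f \<subseteq> U" "\<And>u. u \<in> U \<Longrightarrow> keys u \<subseteq> S"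
  shows "lift f = (\<Oplus>u\<in>U. lookup f u \<odot> mon g u)"
  unfolding pd_lift_def mon_def[symmetric] using assms
  by (intro add.finprod_mono_neutral_cong_left) (auto simp: in_keys_iff)

lemma lift_closed [simp]: "f \<in> carrier (free_pd S) \<Longrightarrow> lift f \<in> carrier A"
  unfolding pd_lift_def mon_def[symmetric] by (intro finsum_closed) (auto simp: free_pd_def)

lemma lift_zero [simp]: "lift 0 = \<zero>"
  by (simp add: pd_lift_def)

lemma lift_add:
  assumes "f \<in> carrier (free_pd S)" "h \<in> carrier (free_pd S)"
  shows "lift (f + h) = lift f \<oplus> lift h"
proof -
  let ?U = "keys f \<union> keys h"
  have c: "f + h \<in> carrier (free_pd S)"
    using assms by (simp add: free_pd_carrier of_coeffs_simps dsub_add)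
  have U: "keys (f + h) \<subseteq> ?U" by (rule Poly_Mapping.keys_add)
  have S: "\<And>u. u \<in> ?U \<Longrightarrow> keys u \<subseteq> S" using assms by (auto simp: free_pd_def)
  have "lift p = (\<Oplus>u\<in>?U. lookup p u \<odot> mon g u)" if "p \<in> {f, h, f + h}" for p
    using assms c U S that by (intro lift_superset) auto
  hence sum: "lift (f + h) = (\<Oplus>u\<in>?U. lookup (f + h) u \<odot> mon g u)"
    and fh: "lift f = (\<Oplus>u\<in>?U. lookup f u \<odot> mon g u)" "lift h = (\<Oplus>u\<in>?U. lookup h u \<odot> mon g u)"
    by simp_all
  note sum
  also have "(\<Oplus>u\<in>?U. lookup (f + h) u \<odot> mon g u)
      = (\<Oplus>u\<in>?U. lookup f u \<odot> mon g u \<oplus> lookup h u \<odot> mon g u)"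
    using S by (intro add.finprod_cong') (auto simp: lookup_add smult_l_distr)
  also have "\<dots> = lift f \<oplus> lift h"
    unfolding fh using S by (intro finsum_addf) auto
  finally show ?thesis .
qed

lemma lift_single:
  assumes "keys u \<subseteq> S"
  shows "lift (Poly_Mapping.single u c) = c \<odot> mon g u"
proof -
  have "lift (Poly_Mapping.single u c) = (\<Oplus>v\<in>{u}. lookup (Poly_Mapping.single u c) v \<odot> mon g v)"
    using assms by (intro lift_superset) (auto simp: free_pd_def)
  thus ?thesis using assms by simp
qed

lemma lift_mult:
  assumes "f \<in> carrier (free_pd S)" "h \<in> carrier (free_pd S)"
  shows "lift (dp_mult f h) = lift f \<otimes> lift h"
proof -
  have closed: "dp_mult a b \<in> carrier (free_pd S)" "a + b \<in> carrier (free_pd S)"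
    if "a \<in> carrier (free_pd S)" "b \<in> carrier (free_pd S)" for a b :: "('x, 'k) dpoly"
    using that by (simp_all add: free_pd_carrier of_coeffs_simps dsub_mult dsub_add)
  have single: "Poly_Mapping.single u a \<in> carrier (free_pd S)" if "keys u \<subseteq> S" for u and a :: 'k
    using that by (auto simp: free_pd_def)
  \<comment> \<open>Membership is part of the claim because \<open>lift_add\<close> requires it of
    both summands.\<close>
  have "h \<in> carrier (free_pd S) \<and> lift (dp_mult (Poly_Mapping.single u a) h)
      = lift (Poly_Mapping.single u a) \<otimes> lift h" if u: "keys u \<subseteq> S" for u a
  proof (induction h rule: poly_mapping_single_induct)
    case zero
    thus ?case using u by (simp add: free_pd_def single)
  next
    case (single v b)
    hence v: "keys v \<subseteq> S" using assms(2) by (auto simp: free_pd_def)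
    have uv: "keys (u + v) \<subseteq> S" using u v Poly_Mapping.keys_add[of u v] by blast
    have "Poly_Mapping.single v b \<in> carrier (free_pd S)" using v by (auto simp: free_pd_def)
    thus ?case using u v uv
      by (simp add: dp_mult_single lift_single smult_mult_smult mon_mult smult_smult mult_ac)
  next
    case (add p q)
    thus ?case using u by (auto simp: dp_mult_add_right lift_add closed single r_distr)
  qed
  hence *: "lift (dp_mult (Poly_Mapping.single u a) h) = lift (Poly_Mapping.single u a) \<otimes> lift h"
    if "keys u \<subseteq> S" for u a using that by blast
  have "f \<in> carrier (free_pd S) \<and> lift (dp_mult f h) = lift f \<otimes> lift h"
  proof (induction f rule: poly_mapping_single_induct)
    case zero
    thus ?case using assms(2) by (simp add: free_pd_def)
  next
    case (single u a)
    hence "keys u \<subseteq> S" using assms(1) by (auto simp: free_pd_def)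
    thus ?case using * by (auto simp: free_pd_def)
  next
    case (add p q)
    thus ?case using assms(2) by (auto simp: dp_mult_add_left lift_add closed l_distr)
  qed
  thus ?thesis ..
qed

lemma lift_smult:
  assumes "f \<in> carrier (free_pd S)"
  shows "lift (dp_smult c f) = c \<odot> lift f"
proof -
  have "dp_smult c f = dp_mult (Poly_Mapping.single 0 c) f"
    by (simp add: of_coeffs_dp_smult of_coeffs_simps of_coeffs_single flip: of_coeffs_eq_iff)
  thus ?thesis using assms
    by (simp add: lift_mult free_pd_def lift_single smult_one_mult)
qed

lemma lift_sum:
  assumes "\<And>i. i \<in> I \<Longrightarrow> f i \<in> dsub S"
  shows "lift (coeffs (\<Sum>i\<in>I. f i)) = (\<Oplus>i\<in>I. lift (coeffs (f i)))"
  using assms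
  by (induction I rule: infinite_finite_induct)
    (simp_all add: lift_add free_pd_carrier coeffs_inverse dsub_sum Pi_def)

lemma lift_aug:
  assumes "f \<in> carrier (free_pd S)"
  shows "aug A (lift f) = lookup f 0"
proof -
  have "f \<in> carrier (free_pd S) \<and> aug A (lift f) = lookup f 0"
  proof (induction f rule: poly_mapping_single_induct)
    case (single u c)
    hence u: "keys u \<subseteq> S" using assms by (auto simp: free_pd_def)
    hence "aug A (mon g u) = (if u = 0 then 1 else 0)"
      using mon_plus[of u] by (auto simp: plus_ideal_def simp del: plus_carrier)
    thus ?case using u
      by (auto simp: free_pd_def lift_single aug_smult lookup_single when_def)
  next
    case (add p q)
    thus ?case by (auto simp: lift_add aug_add lookup_add free_pd_carrier of_coeffs_simps dsub_add)
  qed (simp add: free_pd_def)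
  thus ?thesis ..
qed

text \<open>Homogeneity and \<open>dpow_mon\<close> settle a single monomial; sums follow because
  both algebras obey the same sum rule.\<close>

lemma lift_gam:
  assumes "F \<in> dsub S" "dcoeff F 0 = 0"
  shows "lift (coeffs (gam m F)) = dpow A m (lift (coeffs F))"
proof -
  have S: "keys u \<subseteq> S" if "u \<in> dsupp F" for u using assms(1) that by (simp add: dsub_def)
  have cf: "coeffs H \<in> carrier (free_pd S) \<longleftrightarrow> H \<in> dsub S" for H
    by (simp add: free_pd_carrier coeffs_inverse)
  have pl: "lift (coeffs H) \<in> plus_ideal A" if "H \<in> dsub S" "dcoeff H 0 = 0" for H
    using that lift_aug[of "coeffs H"] by (simp add: plus_ideal_def cf dcoeff_def del: plus_carrier)
  have "F \<in> dsub S \<and> (\<forall>m. lift (coeffs (gam m F)) = dpow A m (lift (coeffs F)))"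
    using assms(2)
  proof (induction F rule: dpa_pos_induct)
    case zero
    have "lift 1 = \<one>" using lift_single[of 0 1] by simp
    thus ?case by (simp add: gam_zero dpow_zero)
  next
    case (monom u c)
    note u = S[OF monom(1)]
    have "keys (mscale m u) \<subseteq> S" for m using u keys_mscale[of m u] by blast
    thus ?case using u monom(2) mon_plus[of u]
      by (simp add: gam_dmon gmon_def lift_single dpow_smult dpow_mon smult_smult dsub_dmon mult.commute)
  next
    case (add F G)
    hence "F \<in> dsub S" "G \<in> dsub S" by auto
    thus ?case using add
      by (simp add: gam_add lift_sum dsub_mult dsub_gam lift_mult lift_add cf dpow_add pl dsub_add
          del: coeffs_simps(5)) (simp add: lift_mult cf dsub_gam)
  qed
  thus ?thesis by blast
qed

lemma lift_dpow:
  assumes "f \<in> plus_ideal (free_pd S)"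
  shows "lift (dp_dpow m f) = dpow A m (lift f)"
  using lift_gam[of "of_coeffs f" m] assms
  by (simp add: free_pd_plus gam_def of_coeffs_inverse)

end

section \<open>Monomials as products of divided powers of generators\<close>

lemma mblock_count_single_1 [simp]: "mblock_count j (Poly_Mapping.single x (Suc 0)) = 1"
  by (simp add: mblock_count_def mpower_coeff_def power_coeff_def)

lemma mscale_single: "mscale j (Poly_Mapping.single x a) = Poly_Mapping.single x (j * a)"
  by (rule poly_mapping_eqI) (simp add: lookup_single when_def)

text \<open>Monomials in different variables have disjoint keys, so every binomial coefficient in
  their product is \<open>1\<close>.\<close>

lemma prod_dmon_single:
  assumes "finite U"
  shows "(\<Prod>x\<in>U. dmon (Poly_Mapping.single x (n x)) 1) = dmon (\<Sum>x\<in>U. Poly_Mapping.single x (n x)) 1"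
  using assms
proof (induction U rule: finite_induct)
  case (insert x U)
  have "lookup (\<Sum>x\<in>U. Poly_Mapping.single x (n x)) x = 0"
    using insert by (auto simp: lookup_sum lookup_single when_def)
  hence "mbinom (Poly_Mapping.single x (n x)) (\<Sum>x\<in>U. Poly_Mapping.single x (n x)) = 1"
    unfolding mbinom_def by (intro prod.neutral) (auto simp: lookup_single when_def)
  thus ?case using insert by (simp add: dmon_mult)
qed (simp add: dmon_one)

lemma dp_gen_plus: "x \<in> S \<Longrightarrow> dp_gen x \<in> plus_ideal (free_pd S)"
  by (auto simp: dp_gen_def plus_ideal_def free_pd_def lookup_single when_def
      dest: arg_cong[of _ _ keys])

lemma dpow_dp_gen: "dp_dpow j (dp_gen x) = Poly_Mapping.single (Poly_Mapping.single x j) 1"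
  by (simp add: dp_gen_def of_coeffs_dp_dpow of_coeffs_single gam_dmon gmon_def mscale_single
      flip: of_coeffs_eq_iff)

lemma of_coeffs_free_pd_finprod:
  fixes f :: "'i \<Rightarrow> ('x, 'k::field) dpoly"
  assumes "\<And>i. i \<in> I \<Longrightarrow> f i \<in> carrier (free_pd S)"
  shows "of_coeffs (\<Otimes>\<^bsub>free_pd S\<^esub>i\<in>I. f i) = (\<Prod>i\<in>I. of_coeffs (f i))"
proof -
  interpret cring "free_pd S :: ('k, ('x, 'k) dpoly) pdalg" by (rule cring_free_pd)
  show ?thesis using assms
    by (induction I rule: infinite_finite_induct)
      (simp_all add: of_coeffs_simps Pi_def del: single_one)
qed

lemma single_eq_finprod_gens:
  fixes u :: "'x \<Rightarrow>\<^sub>0 nat"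
  assumes "keys u \<subseteq> S"
  shows "Poly_Mapping.single u (1::'k::field)
    = (\<Otimes>\<^bsub>free_pd S\<^esub>x\<in>keys u. dpow (free_pd S) (lookup u x) (dp_gen x))"
proof -
  have "of_coeffs (\<Otimes>\<^bsub>free_pd S\<^esub>x\<in>keys u. dpow (free_pd S) (lookup u x) (dp_gen x))
      = (\<Prod>x\<in>keys u. dmon (Poly_Mapping.single x (lookup u x)) (1::'k))"
    using assms by (subst of_coeffs_free_pd_finprod)
      (auto simp: dpow_dp_gen of_coeffs_single free_pd_carrier intro!: dsub_dmon split: if_splits)
  also have "\<dots> = dmon u 1"
    by (simp add: prod_dmon_single flip: poly_mapping_sum_single)
  finally show ?thesis
    by (simp add: of_coeffs_single flip: of_coeffs_eq_iff)
qed

text \<open>Compatibility is demanded for every \<open>dpow A i\<close>, so that the value at a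
  generator fixes the values at all its divided powers.\<close>

definition pd_hom :: "('k::field, 'a) pdalg \<Rightarrow> ('k, 'b) pdalg \<Rightarrow> ('a \<Rightarrow> 'b) \<Rightarrow> bool" where
  "pd_hom A B h \<longleftrightarrow> h \<in> carrier A \<rightarrow> carrier B \<and>
     (\<forall>a\<in>carrier A. \<forall>b\<in>carrier A. h (a \<oplus>\<^bsub>A\<^esub> b) = h a \<oplus>\<^bsub>B\<^esub> h b) \<and>
     (\<forall>a\<in>carrier A. \<forall>b\<in>carrier A. h (a \<otimes>\<^bsub>A\<^esub> b) = h a \<otimes>\<^bsub>B\<^esub> h b) \<and>
     h \<one>\<^bsub>A\<^esub> = \<one>\<^bsub>B\<^esub> \<and>
     (\<forall>c. \<forall>a\<in>carrier A. h (c \<odot>\<^bsub>A\<^esub> a) = c \<odot>\<^bsub>B\<^esub> h a) \<and>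
     (\<forall>a\<in>carrier A. aug B (h a) = aug A a) \<and>
     (\<forall>a\<in>plus_ideal A. \<forall>i. h (dpow A i a) = dpow B i (h a))"

lemma pd_homD:
  assumes "pd_hom A B h"
  shows "a \<in> carrier A \<Longrightarrow> h a \<in> carrier B"
    and "a \<in> carrier A \<Longrightarrow> b \<in> carrier A \<Longrightarrow> h (a \<oplus>\<^bsub>A\<^esub> b) = h a \<oplus>\<^bsub>B\<^esub> h b"
    and "a \<in> carrier A \<Longrightarrow> b \<in> carrier A \<Longrightarrow> h (a \<otimes>\<^bsub>A\<^esub> b) = h a \<otimes>\<^bsub>B\<^esub> h b"
    and "h \<one>\<^bsub>A\<^esub> = \<one>\<^bsub>B\<^esub>"
    and "a \<in> carrier A \<Longrightarrow> h (c \<odot>\<^bsub>A\<^esub> a) = c \<odot>\<^bsub>B\<^esub> h a"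
    and "a \<in> carrier A \<Longrightarrow> aug B (h a) = aug A a"
    and "a \<in> plus_ideal A \<Longrightarrow> h (dpow A i a) = dpow B i (h a)"
    and "a \<in> plus_ideal A \<Longrightarrow> h a \<in> plus_ideal B"
  using assms by (auto simp: pd_hom_def plus_ideal_def)

lemma pd_hom_comp:
  assumes "pd_hom A B h" "pd_hom B C k"
  shows "pd_hom A C (k \<circ> h)"
  unfolding pd_hom_def[of A C] comp_def
  by (intro conjI ballI allI funcsetI) (simp_all add: pd_homD[OF assms(1)] pd_homD[OF assms(2)])

lemma pd_hom_zero:
  assumes "pd_alg A" "pd_alg B" "pd_hom A B h"
  shows "h \<zero>\<^bsub>A\<^esub> = \<zero>\<^bsub>B\<^esub>"
proof -
  interpret A: pd_alg A by fact
  interpret B: pd_alg B by fact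
  have "h (0 \<odot>\<^bsub>A\<^esub> \<zero>\<^bsub>A\<^esub>) = 0 \<odot>\<^bsub>B\<^esub> h \<zero>\<^bsub>A\<^esub>"
    by (rule pd_homD(5)[OF assms(3)]) simp
  thus ?thesis using pd_homD(1)[OF assms(3), of "\<zero>\<^bsub>A\<^esub>"] by simp
qed

lemma pd_hom_finprod:
  assumes "pd_alg A" "pd_alg B" "pd_hom A B h" "finite I" "f \<in> I \<rightarrow> carrier A"
  shows "h (\<Otimes>\<^bsub>A\<^esub>i\<in>I. f i) = (\<Otimes>\<^bsub>B\<^esub>i\<in>I. h (f i))"
proof -
  interpret A: pd_alg A by fact
  interpret B: pd_alg B by fact
  note hom = pd_homD[OF assms(3)]
  show ?thesis using assms(4,5)
    by (induction I rule: finite_induct) (simp_all add: Pi_def hom)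
qed

context pd_alg_lift
begin

theorem pd_hom_lift: "pd_hom (free_pd S) A lift"
  using lift_single[of 0 1]
  by (auto simp: pd_hom_def lift_add lift_mult lift_smult lift_aug lift_dpow)

lemma lift_dp_gen: "x \<in> S \<Longrightarrow> lift (dp_gen x) = g x"
  using g[of x] by (simp add: dp_gen_def lift_single mon_def dpow_1)

text \<open>A monomial is a product of divided powers of generators, so \<open>h\<close> has the
  prescribed value \<open>mon g u\<close> there; the monomials span.\<close>

theorem lift_unique:
  assumes h: "pd_hom (free_pd S) A h" and eq: "\<And>x. x \<in> S \<Longrightarrow> h (dp_gen x) = g x"
    and f: "f \<in> carrier (free_pd S)"
  shows "h f = lift f"
proof -
  note hom = pd_homD[OF h]
  have F: "pd_alg (free_pd S :: ('k, ('x, 'k) dpoly) pdalg)" by (rule pd_alg_free_pd)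
  interpret F: pd_alg "free_pd S :: ('k, ('x, 'k) dpoly) pdalg" by (rule F)
  have single: "h (Poly_Mapping.single u c) = c \<odot> mon g u" if u: "keys u \<subseteq> S" for u c
  proof -
    have c: "Poly_Mapping.single u 1 \<in> carrier (free_pd S)" using u by (auto simp: free_pd_def)
    have gen: "dpow (free_pd S) n (dp_gen x :: ('x, 'k) dpoly) \<in> carrier (free_pd S)"
      if "x \<in> keys u" for x n
      by (rule F.dpow_carrier[OF dp_gen_plus]) (use u that in blast)
    have "h (Poly_Mapping.single u 1)
        = (\<Otimes>x\<in>keys u. h (dpow (free_pd S) (lookup u x) (dp_gen x)))"
      unfolding single_eq_finprod_gens[OF u]
      using gen by (intro pd_hom_finprod[OF F pd_alg_axioms h]) auto
    also have "\<dots> = mon g u"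
      unfolding mon_def using u g
      by (intro finprod_cong') (auto simp: hom(7)[OF dp_gen_plus] eq subset_iff simp del: free_pd_simps)
    finally have "h (c \<odot>\<^bsub>free_pd S\<^esub> Poly_Mapping.single u 1) = c \<odot> mon g u"
      using hom(5)[OF c] by simp
    thus ?thesis by (simp add: dp_smult_def)
  qed
  have "f \<in> carrier (free_pd S) \<and> h f = lift f"
  proof (induction f rule: poly_mapping_single_induct)
    case zero
    show ?case using pd_hom_zero[OF F pd_alg_axioms h] by (simp add: free_pd_def)
  next
    case (single u c)
    hence "keys u \<subseteq> S" using f by (auto simp: free_pd_def)
    thus ?case using \<open>keys u \<subseteq> S \<Longrightarrow> h (Poly_Mapping.single u c) = c \<odot> mon g u\<close>
      by (auto simp: lift_single free_pd_def)
  next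
    case (add p q)
    thus ?case using hom(2)[of p q] F.a_closed[of p q] by (simp add: lift_add)
  qed
  thus ?thesis ..
qed

end

section \<open>The cotriple\<close>

context pd_alg
begin

lemma counit_lift: "pd_alg_lift A (plus_ideal A) (\<lambda>a. a)"
  by unfold_locales

lemma pd_alg_cotriple: "pd_alg (cotriple A)"
  unfolding cotriple_def by (rule pd_alg_free_pd)

lemma pd_hom_counit: "pd_hom (cotriple A) A (counit A)"
  unfolding cotriple_def counit_def by (rule pd_alg_lift.pd_hom_lift[OF counit_lift])

lemma counit_dp_gen: "a \<in> plus_ideal A \<Longrightarrow> counit A (dp_gen a) = a"
  unfolding counit_def by (rule pd_alg_lift.lift_dp_gen[OF counit_lift])

end

lemma pd_hom_cotriple_map:
  assumes "pd_alg A" "pd_alg B" "pd_hom A B f"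
  shows "pd_hom (cotriple A) (cotriple B) (cotriple_map B f)"
    and "a \<in> plus_ideal A \<Longrightarrow> cotriple_map B f (dp_gen a) = dp_gen (f a)"
proof -
  have "pd_alg_lift (cotriple B) (plus_ideal A) (\<lambda>a. dp_gen (f a))"
    unfolding pd_alg_lift_def pd_alg_lift_axioms_def
    using pd_alg.pd_alg_cotriple[OF assms(2)] pd_homD(8)[OF assms(3)]
    by (auto simp: cotriple_def intro!: dp_gen_plus)
  from pd_alg_lift.pd_hom_lift[OF this] pd_alg_lift.lift_dp_gen[OF this]
  show "pd_hom (cotriple A) (cotriple B) (cotriple_map B f)"
    and "a \<in> plus_ideal A \<Longrightarrow> cotriple_map B f (dp_gen a) = dp_gen (f a)"
    by (auto simp: cotriple_def cotriple_map_def)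
qed

text \<open>Both composites are morphisms out of a free algebra and send the generator
  \<open>dp_gen y\<close> to \<open>counit A y\<close>, so they are the same lift.\<close>

lemma counit_counit:
  assumes A: "pd_alg A" and x: "x \<in> carrier (cotriple (cotriple A))"
  shows "counit A (counit (cotriple A) x) = counit A (cotriple_map A (counit A) x)"
proof -
  interpret A: pd_alg A by (rule A)
  interpret G: pd_alg "cotriple A" by (rule A.pd_alg_cotriple)
  note hom = pd_hom_cotriple_map[OF G.pd_alg_axioms A A.pd_hom_counit]
  have l: "pd_alg_lift A (plus_ideal (cotriple A)) (counit A)"
    unfolding pd_alg_lift_def pd_alg_lift_axioms_def
    using A pd_homD(8)[OF A.pd_hom_counit] by blast
  have "(counit A \<circ> counit (cotriple A)) x = pd_lift A (counit A) x"
    using pd_hom_comp[OF G.pd_hom_counit A.pd_hom_counit] G.counit_dp_gen x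
    by (intro pd_alg_lift.lift_unique[OF l]) (auto simp: cotriple_def comp_def)
  moreover have "(counit A \<circ> cotriple_map A (counit A)) x = pd_lift A (counit A) x"
    using pd_hom_comp[OF hom(1) A.pd_hom_counit] hom(2) x
      A.counit_dp_gen pd_homD(8)[OF A.pd_hom_counit]
    by (intro pd_alg_lift.lift_unique[OF l]) (auto simp: cotriple_def comp_def)
  ultimately show ?thesis by simp
qed

section \<open>Beck derivations with trivial action of \<open>P\<close>\<close>

text \<open>The block of a fixed element is completed by \<open>p - 1\<close> of the other
  \<open>m * p + (p - 1)\<close> elements, and the remaining \<open>m * p\<close> elements are
  partitioned into \<open>m\<close> blocks.\<close>

lemma block_count_Suc:
  assumes "p > 0"
  shows "block_count (Suc m) p = block_count m p * ((m * p + (p - 1)) choose (m * p))"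
proof -
  let ?n = "m * p + (p - 1)"
  have n: "Suc m * p = Suc ?n" using assms by simp
  have "block_count (Suc m) p * (fact (Suc m) * fact p ^ Suc m) = fact (Suc ?n)"
    unfolding block_count_fact[OF assms] n ..
  also have "\<dots> = Suc m * p * fact ?n"
    by (simp only: fact_Suc of_nat_id n)
  also have "fact ?n = fact (m * p) * fact (p - 1) * (?n choose (m * p))"
    using binomial_fact_lemma[of "m * p" ?n] by simp
  also have "Suc m * p * (fact (m * p) * fact (p - 1) * (?n choose (m * p)))
      = Suc m * (p * fact (p - 1)) * (?n choose (m * p)) * fact (m * p)"
    by (simp only: mult_ac)
  also have "p * fact (p - 1) = (fact p :: nat)"
    using assms by (simp add: fact_reduce)
  also have "fact (m * p) = block_count m p * (fact m * fact p ^ m)"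
    using assms by (simp add: block_count_fact)
  also have "Suc m * fact p * (?n choose (m * p)) * (block_count m p * (fact m * fact p ^ m))
      = block_count m p * (?n choose (m * p)) * (fact (Suc m) * fact p ^ Suc m)"
    by (simp only: fact_Suc power_Suc of_nat_id mult_ac)
  finally show ?thesis by simp
qed

text \<open>In the absorption identity the passage from \<open>r\<close> to \<open>Suc r\<close>
  multiplies by \<open>m * p + Suc r\<close>, which is prime to \<open>p\<close> as long as
  \<open>Suc r < p\<close>.\<close>

lemma prime_not_dvd_choose:
  fixes p m r :: nat
  assumes "Factorial_Ring.prime p" "r < p"
  shows "\<not> p dvd ((m * p + r) choose r)"
  using assms(2)
proof (induction r)
  case 0
  thus ?case using assms(1) by auto
next
  case (Suc r)
  show ?case
  proof
    assume "p dvd ((m * p + Suc r) choose Suc r)"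
    hence "p dvd ((m * p + Suc r) choose Suc r) * Suc r" by (rule dvd_mult2)
    hence "p dvd Suc (m * p + r) * ((m * p + r) choose r)"
      by (simp only: Suc_times_binomial_eq add_Suc_right)
    hence "p dvd m * p + Suc r"
      using Suc by (simp only: prime_dvd_mult_iff[OF assms(1)]) auto
    hence "p dvd Suc r" by (simp only: dvd_add_right_iff[OF dvd_triv_right])
    thus False using Suc.prems by (auto dest: dvd_imp_le)
  qed
qed

text \<open>By \<open>block_count_Suc\<close> this is a product of binomial coefficients
  \<open>(m * p + (p - 1)) choose (p - 1)\<close>, none divisible by \<open>p\<close>.\<close>

lemma prime_not_dvd_block_count:
  assumes "Factorial_Ring.prime p"
  shows "\<not> p dvd block_count m p"
proof (induction m)
  case 0
  thus ?case using assms by (auto simp: block_count_def)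
next
  case (Suc m)
  have p: "p > 0" using assms by (rule prime_gt_0_nat)
  have "(m * p + (p - 1)) choose (m * p) = (m * p + (p - 1)) choose (p - 1)"
    using binomial_symmetric[of "m * p" "m * p + (p - 1)"] by simp
  thus ?case using Suc prime_not_dvd_choose[OF assms, of "p - 1" m] p assms
    by (simp add: block_count_Suc prime_dvd_mult_iff)
qed

lemma of_nat_fact_CHAR:
  assumes "Factorial_Ring.prime CHAR('k)"
  shows "of_nat (fact (CHAR('k) - 1)) = (- 1 :: 'k::field)"
proof -
  let ?p = "CHAR('k)"
  have "[int (fact (?p - 1)) = - 1] (mod int ?p)"
    using wilson_theorem[OF assms] by simp
  hence "int ?p dvd int (fact (?p - 1) + 1)"
    by (simp add: cong_iff_dvd_diff add.commute)
  hence "?p dvd fact (?p - 1) + 1"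
    by (simp only: int_dvd_int_iff)
  hence "of_nat (fact (?p - 1) + 1) = (0 :: 'k)"
    by (simp only: of_nat_eq_0_iff_char_dvd)
  thus ?thesis by (simp add: eq_neg_iff_add_eq_0 add.commute)
qed

context pd_alg
begin

section \<open>Beck and special derivations as explicit conditions\<close>

lemma trivial_P_simps [simp]:
  "carrier (restrict_scalars h (trivial_P_module A)) = carrier A"
  "x \<oplus>\<^bsub>restrict_scalars h (trivial_P_module A)\<^esub> y = x \<oplus> y"
  "\<zero>\<^bsub>restrict_scalars h (trivial_P_module A)\<^esub> = \<zero>"
  "q \<odot>\<^bsub>restrict_scalars h (trivial_P_module A)\<^esub> x = h q 0 \<otimes> x"
  "x \<ominus>\<^bsub>restrict_scalars h (trivial_P_module A)\<^esub> y = x \<ominus> y"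
  "carrier (trivial_P_module A) = carrier A"
  "x \<oplus>\<^bsub>trivial_P_module A\<^esub> y = x \<oplus> y"
  "\<zero>\<^bsub>trivial_P_module A\<^esub> = \<zero>"
  "q' \<odot>\<^bsub>trivial_P_module A\<^esub> x = q' 0 \<otimes> x"
  "x \<ominus>\<^bsub>trivial_P_module A\<^esub> y = x \<ominus> y"
  by (simp_all add: restrict_scalars_def trivial_P_module_def self_module_def a_minus_def a_inv_def m_inv_def)

text \<open>A general \<open>h\<close> covers both \<open>B = A\<close> with the identity and
  \<open>B = \<GG>(A)\<close> with the counit. The \<open>P\<close>-term drops out since the degree
  0 entry of \<open>P\<close> is zero and \<open>h\<close> preserves zero.\<close>

lemma beck_derivations_iff:
  fixes B :: "('k, 'b) pdalg"
  assumes "h \<zero>\<^bsub>B\<^esub> = \<zero>"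
    and "\<And>b. b \<in> plus_ideal B \<Longrightarrow> h (b [^]\<^bsub>B\<^esub> (CHAR('k) - 1 :: nat)) \<in> carrier A"
    and "plus_ideal B \<subseteq> carrier B"
  shows "D \<in> beck_derivations B (restrict_scalars (V_map h) (trivial_P_module A)) \<longleftrightarrow>
    D \<in> carrier B \<rightarrow>\<^sub>E carrier A \<and>
    (\<forall>a\<in>carrier B. \<forall>b\<in>carrier B. D (a \<oplus>\<^bsub>B\<^esub> b) = D a \<oplus> D b) \<and>
    (\<forall>c. \<forall>a\<in>carrier B. D (c \<odot>\<^bsub>B\<^esub> a) = h (c \<odot>\<^bsub>B\<^esub> \<one>\<^bsub>B\<^esub>) \<otimes> D a) \<and>
    (\<forall>a\<in>carrier B. \<forall>b\<in>carrier B. D (a \<otimes>\<^bsub>B\<^esub> b) = h a \<otimes> D b \<oplus> h b \<otimes> D a) \<and>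
    (\<forall>b\<in>plus_ideal B. D (dpow B CHAR('k) b) = \<ominus> (h (b [^]\<^bsub>B\<^esub> (CHAR('k) - 1 :: nat)) \<otimes> D b))"
proof -
  have *: "(\<zero> \<otimes> D b \<ominus> h (b [^]\<^bsub>B\<^esub> (CHAR('k) - 1 :: nat)) \<otimes> D b)
      = \<ominus> (h (b [^]\<^bsub>B\<^esub> (CHAR('k) - 1 :: nat)) \<otimes> D b)"
    if "D \<in> carrier B \<rightarrow>\<^sub>E carrier A" "b \<in> plus_ideal B" for b
  proof -
    have "D b \<in> carrier A" using that assms(3) by auto
    thus ?thesis using assms(2)[OF that(2)] by (simp add: a_minus_def)
  qed
  show ?thesis
    unfolding beck_derivations_def derivations_def
    using * assms(1)
    by (cases "D \<in> carrier B \<rightarrow>\<^sub>E carrier A")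
      (simp_all add: V_map_def V_monom_def restrict_scalars_def[of _ "restrict_scalars _ _"])
qed

lemma restrict_scalars_V_map_id:
  "restrict_scalars (V_map (\<lambda>x. x)) (trivial_P_module A) = trivial_P_module A"
  by (simp add: restrict_scalars_def trivial_P_module_def self_module_def V_map_def comp_def)

lemma beck_derivations_self_iff:
  "D \<in> beck_derivations A (trivial_P_module A) \<longleftrightarrow>
    D \<in> carrier A \<rightarrow>\<^sub>E carrier A \<and>
    (\<forall>a\<in>carrier A. \<forall>b\<in>carrier A. D (a \<oplus> b) = D a \<oplus> D b) \<and>
    (\<forall>c. \<forall>a\<in>carrier A. D (c \<odot> a) = c \<odot> D a) \<and>
    (\<forall>a\<in>carrier A. \<forall>b\<in>carrier A. D (a \<otimes> b) = a \<otimes> D b \<oplus> b \<otimes> D a) \<and>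
    (\<forall>b\<in>plus_ideal A. D (dpow A CHAR('k) b) = \<ominus> (b [^] (CHAR('k) - 1 :: nat) \<otimes> D b))"
proof -
  have "(c \<odot> \<one>) \<otimes> D a = c \<odot> D a"
    if "D \<in> carrier A \<rightarrow>\<^sub>E carrier A" "a \<in> carrier A" for a c
    using that by (intro smult_one_mult) auto
  moreover have "plus_ideal A \<subseteq> carrier A" by auto
  ultimately show ?thesis
    by (subst beck_derivations_iff[of "\<lambda>x. x" A D, unfolded restrict_scalars_V_map_id])
      (auto simp: PiE_iff)
qed

lemma special_derivations_iff:
  "D \<in> special_derivations A \<longleftrightarrow>
    D \<in> carrier A \<rightarrow>\<^sub>E carrier A \<and>
    (\<forall>a\<in>carrier A. \<forall>b\<in>carrier A. D (a \<oplus> b) = D a \<oplus> D b) \<and>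
    (\<forall>c. \<forall>a\<in>carrier A. D (c \<odot> a) = c \<odot> D a) \<and>
    (\<forall>a\<in>carrier A. \<forall>b\<in>carrier A. D (a \<otimes> b) = a \<otimes> D b \<oplus> b \<otimes> D a) \<and>
    (\<forall>x\<in>plus_ideal A. \<forall>i. D (dpow A i x) = (if i = 0 then \<zero> else dpow A (i - 1) x \<otimes> D x))"
proof -
  have "D \<in> carrier A \<rightarrow>\<^sub>E carrier A \<Longrightarrow> a \<in> carrier A \<Longrightarrow> (c \<odot> \<one>) \<otimes> D a = c \<odot> D a" for a c
    by (rule smult_one_mult) auto
  thus ?thesis
    unfolding special_derivations_def derivations_def self_module_def by auto
qed

lemma pow_eq_dpow: "x \<in> plus_ideal A \<Longrightarrow> x [^] i = of_nat (fact i) \<odot> dpow A i x"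
  using dpow_pow[of x "Suc 0" i] by (simp add: dpow_1 power_coeff_1)

lemma smult_cancel:
  assumes "c \<noteq> 0" "x \<in> carrier A" "y \<in> carrier A" "c \<odot> x = c \<odot> y"
  shows "x = y"
proof -
  have "(inverse c * c) \<odot> x = (inverse c * c) \<odot> y"
    using assms(2,3) by (simp only: smult_assoc1 assms(4))
  thus ?thesis using assms(1-3) by simp
qed

lemma pow_pred_CHAR:
  assumes "Factorial_Ring.prime CHAR('k)" "x \<in> plus_ideal A" "y \<in> carrier A"
  shows "\<ominus> (x [^] (CHAR('k) - 1 :: nat) \<otimes> y) = dpow A (CHAR('k) - 1) x \<otimes> y"
proof -
  have "x [^] (CHAR('k) - 1 :: nat) \<otimes> y = (- 1) \<odot> (dpow A (CHAR('k) - 1) x \<otimes> y)"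
    using assms(2,3)
    by (simp only: pow_eq_dpow of_nat_fact_CHAR[OF assms(1)] smult_assoc2 dpow_carrier)
  thus ?thesis using assms by (simp add: smult_minus_left)
qed

theorem beck_derivations_eq_special_derivations:
  assumes p: "Factorial_Ring.prime CHAR('k)"
  shows "beck_derivations A (trivial_P_module A) = special_derivations A"
proof (intro equalityI subsetI)
  fix D assume D: "D \<in> special_derivations A"
  have "D (dpow A CHAR('k) b) = \<ominus> (b [^] (CHAR('k) - 1 :: nat) \<otimes> D b)" if b: "b \<in> plus_ideal A" for b
  proof -
    have "D b \<in> carrier A" using D b by (auto simp: special_derivations_iff)
    thus ?thesis using D b p
      by (subst pow_pred_CHAR) (auto simp: special_derivations_iff prime_gt_0_nat)
  qed
  thus "D \<in> beck_derivations A (trivial_P_module A)"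
    using D by (simp add: special_derivations_iff beck_derivations_self_iff)
next
  fix D assume D: "D \<in> beck_derivations A (trivial_P_module A)"
  let ?p = "CHAR('k)"
  have p0: "?p > 0" using p by (rule prime_gt_0_nat)
  have Dc [simp]: "D a \<in> carrier A" if "a \<in> carrier A" for a
    using D that by (auto simp: beck_derivations_self_iff)
  have Dsm: "D (c \<odot> a) = c \<odot> D a" if "a \<in> carrier A" for c a
    using D that by (simp add: beck_derivations_self_iff)
  have Dm: "D (a \<otimes> b) = a \<otimes> D b \<oplus> b \<otimes> D a" if "a \<in> carrier A" "b \<in> carrier A" for a b
    using D that by (simp add: beck_derivations_self_iff)
  have Dp: "D (dpow A ?p x) = dpow A (?p - 1) x \<otimes> D x" if "x \<in> plus_ideal A" for x
    using D that by (simp add: beck_derivations_self_iff pow_pred_CHAR[OF p, unfolded One_nat_def])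
  have D1: "D \<one> = \<zero>"
    using Dm[of \<one> \<one>] by (simp add: add.l_cancel_one')
  \<comment> \<open>The element \<open>x\<close> varies in the induction, because for multiples of
    \<open>p\<close> the hypothesis is applied to \<open>dpow A ?p x\<close>.\<close>
  have "D (dpow A i x) = dpow A (i - 1) x \<otimes> D x" if "i > 0" "x \<in> plus_ideal A" for i x
    using that
  proof (induction i arbitrary: x rule: less_induct)
    case (less i x)
    note x = less.prems(2)
    have xc: "x \<in> carrier A" using x by simp
    consider "i = 1" | "i > 1" "\<not> ?p dvd i" | "i = ?p" | "i > 1" "?p dvd i" "i \<noteq> ?p"
      using less.prems by linarith
    thus ?case
    proof cases
      case 1
      thus ?thesis using x by (simp add: dpow_0 dpow_1)
    next
      case 2
      define j where "j = i - 2"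
      have i: "i = Suc (Suc j)" using 2 by (simp add: j_def)
      have nz: "of_nat i \<noteq> (0 :: 'k)" using 2 by (simp add: of_nat_eq_0_iff_char_dvd)
      have "of_nat i \<odot> dpow A i x = dpow A (Suc j) x \<otimes> x"
        using dpow_mult_dpow[OF x, of "Suc j" 1] x by (simp add: i dpow_1 add.commute)
      hence "of_nat i \<odot> D (dpow A i x) = D (dpow A (Suc j) x \<otimes> x)"
        using x by (simp flip: Dsm)
      also have "\<dots> = dpow A (Suc j) x \<otimes> D x \<oplus> x \<otimes> (dpow A j x \<otimes> D x)"
        using less.IH[of "Suc j" x] x by (simp add: Dm i)
      also have "x \<otimes> (dpow A j x \<otimes> D x) = (dpow A j x \<otimes> dpow A 1 x) \<otimes> D x"
        using x by (simp add: m_ac dpow_1)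
      \<comment> \<open>The binomial coefficient \<open>Suc j\<close> and the other summand add up
        to \<open>i\<close>, which is nonzero in \<open>k\<close> and cancels.\<close>
      also have "\<dots> = of_nat (Suc j) \<odot> (dpow A (Suc j) x \<otimes> D x)"
        unfolding dpow_mult_dpow[OF x] using x by (simp add: smult_assoc2)
      also have "dpow A (Suc j) x \<otimes> D x \<oplus> of_nat (Suc j) \<odot> (dpow A (Suc j) x \<otimes> D x)
          = of_nat i \<odot> (dpow A (Suc j) x \<otimes> D x)"
        using x smult_l_distr[of "dpow A (Suc j) x \<otimes> D x" 1 "of_nat (Suc j)"]
        by (simp add: i)
      finally show ?thesis
        using smult_cancel[OF nz] x by (simp add: i)
    next
      case 3
      thus ?thesis using Dp[OF x] by simp
    next
      case 4
      then obtain m0 where m0: "i = m0 * ?p" by (auto elim: dvdE)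
      then obtain m where m: "m0 = Suc m" using 4 by (cases m0) auto
      have mpos: "m > 0" using 4 m m0 by (cases m) auto
      have "Suc m * 1 < Suc m * ?p"
        using prime_gt_1_nat[OF p] by (intro mult_less_mono2) auto
      hence lt: "Suc m < i" by (simp add: m0 m)
      let ?y = "dpow A ?p x" and ?z = "dpow A (i - 1) x \<otimes> D x"
      let ?N = "of_nat (block_count (Suc m) ?p) :: 'k"
      have y: "?y \<in> plus_ideal A" using x p0 by (rule dpow_closed)
      have nz: "?N \<noteq> 0"
        using prime_not_dvd_block_count[OF p] by (simp add: of_nat_eq_0_iff_char_dvd)
      have i1: "m * ?p + (?p - 1) = i - 1" using p0 by (simp add: m0 m)
      \<comment> \<open>As \<open>?N\<close> is invertible, \<open>D (dpow A i x)\<close> can be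
        read off from \<open>dpow A (Suc m) ?y\<close>, to which the hypothesis applies because
        \<open>Suc m < i\<close>.\<close>
      have "?N \<odot> D (dpow A i x) = D (dpow A (Suc m) ?y)"
        using x p0 by (simp add: dpow_dpow Dsm m0 m)
      also have "\<dots> = dpow A m ?y \<otimes> (dpow A (?p - 1) x \<otimes> D x)"
        using less.IH[OF lt _ y] Dp[OF x] by simp
      also have "\<dots> = (dpow A m ?y \<otimes> dpow A (?p - 1) x) \<otimes> D x"
        using x y by (simp add: m_assoc)
      also have "dpow A m ?y \<otimes> dpow A (?p - 1) x
          = of_nat (block_count m ?p) \<odot> (dpow A (m * ?p) x \<otimes> dpow A (?p - 1) x)"
        using x p0 by (simp add: dpow_dpow smult_assoc2)
      \<comment> \<open>By \<open>block_count_Suc\<close> the coefficients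
        \<open>block_count m ?p\<close> and the binomial of the product multiply to
        \<open>?N\<close> again.\<close>
      also have "\<dots> = ?N \<odot> dpow A (i - 1) x"
        using x unfolding dpow_mult_dpow[OF x] i1 block_count_Suc[OF p0]
        by (simp add: smult_smult)
      also have "(?N \<odot> dpow A (i - 1) x) \<otimes> D x = ?N \<odot> ?z"
        using x by (simp add: smult_assoc2)
      finally show ?thesis
        using smult_cancel[OF nz] x by simp
    qed
  qed
  thus "D \<in> special_derivations A"
    using D D1 by (simp add: special_derivations_iff beck_derivations_self_iff dpow_0)
qed

end

section \<open>The universal property of \<open>\<Omega>\<^sub>p(A)\<close>\<close>

lemma V_simps:
  "q \<in> carrier (V A) \<longleftrightarrow> (\<forall>i. q i \<in> carrier A) \<and> finite {i. q i \<noteq> \<zero>\<^bsub>A\<^esub>}"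
  "\<zero>\<^bsub>V A\<^esub> = (\<lambda>_. \<zero>\<^bsub>A\<^esub>)" "\<one>\<^bsub>V A\<^esub> = V_monom A \<one>\<^bsub>A\<^esub> 0"
  "q \<oplus>\<^bsub>V A\<^esub> r = (\<lambda>i. q i \<oplus>\<^bsub>A\<^esub> r i)"
  "q \<otimes>\<^bsub>V A\<^esub> r = (\<lambda>l. \<Oplus>\<^bsub>A\<^esub>i\<in>{..l}. q i \<otimes>\<^bsub>A\<^esub> V_twist A i (r (l - i)))"
  by (simp_all add: V_def)

lemma omega_free_simps:
  "carrier (omega_free A) = {w. (\<forall>s\<in>carrier A. w s \<in> carrier (V A)) \<and>
     (\<forall>s. s \<notin> carrier A \<longrightarrow> w s = \<zero>\<^bsub>V A\<^esub>) \<and> finite {s. w s \<noteq> \<zero>\<^bsub>V A\<^esub>}}"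
  "\<zero>\<^bsub>omega_free A\<^esub> = (\<lambda>_. \<zero>\<^bsub>V A\<^esub>)"
  "w \<oplus>\<^bsub>omega_free A\<^esub> z = (\<lambda>s. w s \<oplus>\<^bsub>V A\<^esub> z s)"
  "r \<odot>\<^bsub>omega_free A\<^esub> w = (\<lambda>s. r \<otimes>\<^bsub>V A\<^esub> w s)"
  by (simp_all add: omega_free_def free_left_module_def)

locale pd_alg_char = pd_alg A for A :: "('k::field, 'a) pdalg" (structure) +
  assumes prime_char: "Factorial_Ring.prime CHAR('k)"
begin

lemma V_closed: "q \<in> carrier (V A) \<Longrightarrow> q i \<in> carrier A"
  by (simp add: V_simps)

lemma V_twist_closed [simp]: "a \<in> carrier A \<Longrightarrow> V_twist A i a \<in> carrier A"
  by (simp add: V_twist_def)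

lemma V_twist_zero [simp]: "V_twist A i \<zero> = \<zero>"
  using prime_gt_0_nat[OF prime_char] by (simp add: V_twist_def power_0_left)

lemma V_twist_one [simp]: "V_twist A i \<one> = \<one>"
  by (simp add: V_twist_def)

text \<open>For \<open>i > 0\<close> the twist is an iterated Frobenius of the augmentation, which
  is additive in characteristic \<open>p\<close>.\<close>

lemma V_twist_add:
  "a \<in> carrier A \<Longrightarrow> b \<in> carrier A \<Longrightarrow> V_twist A i (a \<oplus> b) = V_twist A i a \<oplus> V_twist A i b"
  by (simp add: V_twist_def aug_add smult_l_distr freshmans_dream'[OF prime_char])

lemma V_zero_closed [simp]: "\<zero>\<^bsub>V A\<^esub> \<in> carrier (V A)"
  by (simp add: V_simps)

lemma V_monom_closed [simp]: "a \<in> carrier A \<Longrightarrow> V_monom A a i \<in> carrier (V A)"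
  by (auto simp: V_simps V_monom_def intro: finite_subset[of _ "{i}"])

lemma V_one_closed [simp]: "\<one>\<^bsub>V A\<^esub> \<in> carrier (V A)"
  by (simp add: V_simps(3))

lemma V_add_closed: "q \<in> carrier (V A) \<Longrightarrow> r \<in> carrier (V A) \<Longrightarrow> q \<oplus>\<^bsub>V A\<^esub> r \<in> carrier (V A)"
  by (auto simp: V_simps intro: finite_subset[of _ "{i. q i \<noteq> \<zero>} \<union> {i. r i \<noteq> \<zero>}"])

lemma V_mult_closed:
  assumes "q \<in> carrier (V A)" "r \<in> carrier (V A)"
  shows "q \<otimes>\<^bsub>V A\<^esub> r \<in> carrier (V A)"
proof -
  have q: "q i \<in> carrier A" and r: "r i \<in> carrier A" for i
    using assms by (simp_all add: V_simps)
  obtain m where m: "q i = \<zero>" if "i \<ge> m" for i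
    using assms(1) by (auto simp: V_simps finite_nat_set_iff_bounded) (metis leD)
  obtain n where n: "r i = \<zero>" if "i \<ge> n" for i
    using assms(2) by (auto simp: V_simps finite_nat_set_iff_bounded) (metis leD)
  \<comment> \<open>From degree \<open>m + n\<close> on, each term has a zero factor: either
    \<open>i \<ge> m\<close> or \<open>l - i \<ge> n\<close>.\<close>
  have "(\<Oplus>i\<in>{..l}. q i \<otimes> V_twist A i (r (l - i))) = \<zero>" if "l \<ge> m + n" for l
  proof -
    have "q i \<otimes> V_twist A i (r (l - i)) = \<zero>" if "i \<le> l" for i
      using m[of i] n[of "l - i"] q[of i] r[of "l - i"] \<open>l \<ge> m + n\<close> that
      by (cases "i \<ge> m") auto
    hence "(\<Oplus>i\<in>{..l}. q i \<otimes> V_twist A i (r (l - i))) = (\<Oplus>i\<in>{..l}. \<zero>)"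
      by (intro add.finprod_cong') auto
    thus ?thesis by simp
  qed
  hence "{l. (\<Oplus>i\<in>{..l}. q i \<otimes> V_twist A i (r (l - i))) \<noteq> \<zero>} \<subseteq> {..<m + n}"
    by (auto simp: not_le[symmetric])
  thus ?thesis using q r by (auto simp: V_simps intro: finite_subset)
qed

lemma V_mult_zero:
  "q \<in> carrier (V A) \<Longrightarrow> q \<otimes>\<^bsub>V A\<^esub> \<zero>\<^bsub>V A\<^esub> = \<zero>\<^bsub>V A\<^esub>"
  by (simp add: V_simps)

lemma V_mult_one:
  assumes "q \<in> carrier (V A)"
  shows "q \<otimes>\<^bsub>V A\<^esub> \<one>\<^bsub>V A\<^esub> = q"
proof
  fix l
  have "(\<Oplus>i\<in>{..l}. q i \<otimes> V_twist A i (V_monom A \<one> 0 (l - i))) = (\<Oplus>i\<in>{..l}. if l = i then q i else \<zero>)"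
    using V_closed[OF assms] by (intro add.finprod_cong') (auto simp: V_monom_def)
  also have "\<dots> = q l"
    using V_closed[OF assms] by (intro add.finprod_singleton) auto
  finally show "(q \<otimes>\<^bsub>V A\<^esub> \<one>\<^bsub>V A\<^esub>) l = q l" by (simp add: V_simps)
qed

lemma V_r_distr:
  assumes "q \<in> carrier (V A)" "r \<in> carrier (V A)" "t \<in> carrier (V A)"
  shows "q \<otimes>\<^bsub>V A\<^esub> (r \<oplus>\<^bsub>V A\<^esub> t) = q \<otimes>\<^bsub>V A\<^esub> r \<oplus>\<^bsub>V A\<^esub> q \<otimes>\<^bsub>V A\<^esub> t"
proof
  fix l
  note c = V_closed[OF assms(1)] V_closed[OF assms(2)] V_closed[OF assms(3)]
  have "(\<Oplus>i\<in>{..l}. q i \<otimes> V_twist A i (r (l - i) \<oplus> t (l - i)))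
     = (\<Oplus>i\<in>{..l}. q i \<otimes> V_twist A i (r (l - i)) \<oplus> q i \<otimes> V_twist A i (t (l - i)))"
    using c by (intro add.finprod_cong') (auto simp: V_twist_add r_distr)
  also have "\<dots> = (\<Oplus>i\<in>{..l}. q i \<otimes> V_twist A i (r (l - i)))
      \<oplus> (\<Oplus>i\<in>{..l}. q i \<otimes> V_twist A i (t (l - i)))"
    using c by (intro finsum_addf) auto
  finally show "(q \<otimes>\<^bsub>V A\<^esub> (r \<oplus>\<^bsub>V A\<^esub> t)) l = (q \<otimes>\<^bsub>V A\<^esub> r \<oplus>\<^bsub>V A\<^esub> q \<otimes>\<^bsub>V A\<^esub> t) l"
    by (simp add: V_simps)
qed

text \<open>Taking the degree 0 entry is compatible with products; this is what makes the action
  with \<open>P\<close> equal to zero consistent.\<close>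

lemma V_mult_at_0: "q \<in> carrier (V A) \<Longrightarrow> r \<in> carrier (V A) \<Longrightarrow> (q \<otimes>\<^bsub>V A\<^esub> r) 0 = q 0 \<otimes> r 0"
  by (simp add: V_simps V_twist_def)

section \<open>The free module on the symbols\<close>

abbreviation "F \<equiv> omega_free A"
abbreviation "N \<equiv> omega_submodule A"
abbreviation "dsym \<equiv> omega_symbol A"

lemma F_mem: "w \<in> carrier F \<Longrightarrow> w s \<in> carrier (V A)"
  by (cases "s \<in> carrier A") (auto simp: omega_free_simps)

lemma F_zero_outside: "w \<in> carrier F \<Longrightarrow> s \<notin> carrier A \<Longrightarrow> w s = \<zero>\<^bsub>V A\<^esub>"
  by (simp add: omega_free_simps)

lemma F_finite: "w \<in> carrier F \<Longrightarrow> finite {s. w s \<noteq> \<zero>\<^bsub>V A\<^esub>}"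
  by (simp add: omega_free_simps)

lemma F_add_closed:
  assumes w: "w \<in> carrier F" and z: "z \<in> carrier F"
  shows "w \<oplus>\<^bsub>F\<^esub> z \<in> carrier F"
proof -
  have "finite {s. w s \<oplus>\<^bsub>V A\<^esub> z s \<noteq> \<zero>\<^bsub>V A\<^esub>}"
    by (rule finite_subset[OF _ finite_UnI[OF F_finite[OF w] F_finite[OF z]]]) (auto simp: V_simps)
  moreover have "w s \<oplus>\<^bsub>V A\<^esub> z s = \<zero>\<^bsub>V A\<^esub>" if "s \<notin> carrier A" for s
    using F_zero_outside[OF w that] F_zero_outside[OF z that] by (simp add: V_simps)
  moreover have "w s \<oplus>\<^bsub>V A\<^esub> z s \<in> carrier (V A)" for s
    by (rule V_add_closed[OF F_mem[OF w] F_mem[OF z]])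
  ultimately show ?thesis
    by (simp add: omega_free_simps(1,3))
qed

lemma F_smult_closed: "r \<in> carrier (V A) \<Longrightarrow> w \<in> carrier F \<Longrightarrow> r \<odot>\<^bsub>F\<^esub> w \<in> carrier F"
  by (auto simp: omega_free_simps V_mult_closed V_mult_zero
      intro: finite_subset[of _ "{s. w s \<noteq> \<zero>\<^bsub>V A\<^esub>}"])

lemma abelian_group_F: "abelian_group F"
proof (rule abelian_groupI)
  fix w z v assume *: "w \<in> carrier F" "z \<in> carrier F" "v \<in> carrier F"
  note mem = V_closed[OF F_mem[OF *(1)]] V_closed[OF F_mem[OF *(2)]] V_closed[OF F_mem[OF *(3)]]
  show "w \<oplus>\<^bsub>F\<^esub> z \<oplus>\<^bsub>F\<^esub> v = w \<oplus>\<^bsub>F\<^esub> (z \<oplus>\<^bsub>F\<^esub> v)"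
    using mem by (simp add: omega_free_simps V_simps a_assoc)
  show "w \<oplus>\<^bsub>F\<^esub> z = z \<oplus>\<^bsub>F\<^esub> w"
    using mem by (simp add: omega_free_simps V_simps a_comm)
  show "\<zero>\<^bsub>F\<^esub> \<oplus>\<^bsub>F\<^esub> w = w"
    using mem by (simp add: omega_free_simps V_simps)
  have "finite {i. \<ominus> w s i \<noteq> \<zero>}" for s
    using F_mem[OF *(1), of s] by (auto simp: V_simps intro: finite_subset[of _ "{i. w s i \<noteq> \<zero>}"])
  moreover have "finite {s. (\<lambda>i. \<ominus> w s i) \<noteq> (\<lambda>_. \<zero>)}"
    by (rule finite_subset[OF _ F_finite[OF *(1)]]) (auto simp: V_simps)
  ultimately have "(\<lambda>s i. \<ominus> w s i) \<in> carrier F"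
    using mem(1) F_zero_outside[OF *(1)] by (auto simp: omega_free_simps V_simps)
  thus "\<exists>y\<in>carrier F. y \<oplus>\<^bsub>F\<^esub> w = \<zero>\<^bsub>F\<^esub>"
    using mem(1) by (intro bexI[of _ "\<lambda>s i. \<ominus> w s i"]) (auto simp: omega_free_simps V_simps l_neg)
qed (auto simp: F_add_closed, auto simp: omega_free_simps)

sublocale F: abelian_group F by (rule abelian_group_F)

lemma F_smult_r_distr:
  assumes "r \<in> carrier (V A)" "w \<in> carrier F" "z \<in> carrier F"
  shows "r \<odot>\<^bsub>F\<^esub> (w \<oplus>\<^bsub>F\<^esub> z) = r \<odot>\<^bsub>F\<^esub> w \<oplus>\<^bsub>F\<^esub> r \<odot>\<^bsub>F\<^esub> z"
  using V_r_distr[OF assms(1) F_mem[OF assms(2)] F_mem[OF assms(3)]]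
  by (simp add: omega_free_simps)

lemma sym_closed [simp]: "a \<in> carrier A \<Longrightarrow> dsym a \<in> carrier F"
  by (auto simp: omega_free_simps omega_symbol_def intro: finite_subset[of _ "{a}"])

lemma smult_sym:
  assumes "q \<in> carrier (V A)"
  shows "q \<odot>\<^bsub>F\<^esub> dsym a = (\<lambda>s. if s = a then q else \<zero>\<^bsub>V A\<^esub>)"
  using V_mult_one[OF assms] V_mult_zero[OF assms]
  by (auto simp: omega_free_simps(4) omega_symbol_def)

text \<open>Every element is a finite sum of multiples of symbols; these are removed one at a time
  from a finite set that contains the support.\<close>

lemma F_induct [consumes 1, case_names zero smult add]:
  assumes w: "w \<in> carrier F" and "P \<zero>\<^bsub>F\<^esub>"
    and "\<And>q a. q \<in> carrier (V A) \<Longrightarrow> a \<in> carrier A \<Longrightarrow> P (q \<odot>\<^bsub>F\<^esub> dsym a)"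
    and "\<And>w z. w \<in> carrier F \<Longrightarrow> z \<in> carrier F \<Longrightarrow> P w \<Longrightarrow> P z \<Longrightarrow> P (w \<oplus>\<^bsub>F\<^esub> z)"
  shows "P w"
proof -
  have "P w" if "finite U" "w \<in> carrier F" "{s. w s \<noteq> \<zero>\<^bsub>V A\<^esub>} \<subseteq> U" for U w
    using that
  proof (induction U arbitrary: w rule: finite_induct)
    case empty
    hence "w = \<zero>\<^bsub>F\<^esub>" by (auto simp: omega_free_simps)
    thus ?case using assms(2) by simp
  next
    case (insert a U)
    show ?case
    proof (cases "a \<in> carrier A")
      case True
      let ?z = "w(a := \<zero>\<^bsub>V A\<^esub>)"
      have z: "?z \<in> carrier F"
        using insert.prems(1) True
        by (auto simp: omega_free_simps intro: finite_subset[of _ "{s. w s \<noteq> \<zero>\<^bsub>V A\<^esub>}"])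
      have q: "w a \<in> carrier (V A)" using insert.prems(1) by (rule F_mem)
      have "w = w a \<odot>\<^bsub>F\<^esub> dsym a \<oplus>\<^bsub>F\<^esub> ?z"
        using V_closed[OF F_mem[OF insert.prems(1)]]
        by (auto simp: smult_sym[OF q] fun_eq_iff omega_free_simps(3) V_simps)
      moreover have "P ?z"
        using insert.prems(2) by (intro insert.IH z) auto
      ultimately show ?thesis
        using assms(3)[OF q True] assms(4)[OF F_smult_closed[OF q sym_closed[OF True]] z] by simp
    next
      case False
      hence "w a = \<zero>\<^bsub>V A\<^esub>" using insert.prems(1) False by (intro F_zero_outside)
      thus ?thesis using insert by (intro insert.IH) auto
    qed
  qed
  from this[OF F_finite[OF w] w subset_refl] show ?thesis .
qed

section \<open>The submodule of relations and its quotient\<close>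

lemma omega_relations_closed: "omega_relations A \<subseteq> carrier F"
  unfolding omega_relations_def Let_def
  by (auto simp del: One_nat_def intro!: F.minus_closed F_smult_closed F.a_closed sym_closed)

lemma submodule_carrier_F: "submodule (carrier F) (V A) F"
  unfolding submodule_def submodule_axioms_def
  using F.a_group group.subgroup_self[of "add_monoid F"] by (auto intro: F_smult_closed)

lemma N_least: "submodule H (V A) F \<Longrightarrow> omega_relations A \<subseteq> H \<Longrightarrow> N \<subseteq> H"
  by (auto simp: omega_submodule_def generated_submodule_def)

lemma relations_in_N: "omega_relations A \<subseteq> N"
  by (auto simp: omega_submodule_def generated_submodule_def)

lemma N_closed: "N \<subseteq> carrier F"
  by (rule N_least[OF submodule_carrier_F omega_relations_closed])

lemma submodule_N: "submodule N (V A) F"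
proof -
  let ?C = "{H. submodule H (V A) F \<and> omega_relations A \<subseteq> H}"
  have ne: "?C \<noteq> {}" using submodule_carrier_F omega_relations_closed by blast
  have sub: "subgroup H (add_monoid F)" if "H \<in> ?C" for H using that by (auto simp: submodule_def)
  have "subgroup (\<Inter>?C) (add_monoid F)"
    using group.subgroups_Inter[OF F.a_group, of ?C] ne sub by blast
  thus ?thesis
    unfolding submodule_def submodule_axioms_def omega_submodule_def generated_submodule_def
    by (auto simp: submodule_axioms_def submodule_def)
qed

lemma N_smult: "r \<in> carrier (V A) \<Longrightarrow> w \<in> N \<Longrightarrow> r \<odot>\<^bsub>F\<^esub> w \<in> N"
  using submodule_N by (auto simp: submodule_def submodule_axioms_def)

sublocale N: abelian_subgroup N F
  using submodule_N abelian_group_F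
  by (intro abelian_subgroupI3 additive_subgroup.intro) (auto simp: submodule_def)

lemma Omega_simps:
  "carrier (Omega A) = (\<lambda>w. N +>\<^bsub>F\<^esub> w) ` carrier F"
  "X' \<oplus>\<^bsub>Omega A\<^esub> Y' = X' <+>\<^bsub>F\<^esub> Y'"
  by (auto simp: Omega_def quotient_module_def A_RCOSETS_defs a_r_coset_def)

lemma Omega_add:
  "w \<in> carrier F \<Longrightarrow> z \<in> carrier F \<Longrightarrow>
    (N +>\<^bsub>F\<^esub> w) \<oplus>\<^bsub>Omega A\<^esub> (N +>\<^bsub>F\<^esub> z) = N +>\<^bsub>F\<^esub> (w \<oplus>\<^bsub>F\<^esub> z)"
  by (simp add: Omega_simps N.a_rcos_sum)

text \<open>The union that defines the action is constant over the coset: representatives differ by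
  elements of \<open>N\<close>, and \<open>N\<close> is stable under \<open>V(A)\<close>.\<close>

lemma Omega_smult:
  assumes r: "r \<in> carrier (V A)" and w: "w \<in> carrier F"
  shows "r \<odot>\<^bsub>Omega A\<^esub> (N +>\<^bsub>F\<^esub> w) = N +>\<^bsub>F\<^esub> (r \<odot>\<^bsub>F\<^esub> w)"
proof -
  have eq: "N +>\<^bsub>F\<^esub> (r \<odot>\<^bsub>F\<^esub> x) = N +>\<^bsub>F\<^esub> (r \<odot>\<^bsub>F\<^esub> w)" if x: "x \<in> N +>\<^bsub>F\<^esub> w" for x
  proof -
    obtain n where n: "n \<in> N" "x = n \<oplus>\<^bsub>F\<^esub> w"
      using x by (auto simp: a_r_coset_def')
    have "r \<odot>\<^bsub>F\<^esub> x = r \<odot>\<^bsub>F\<^esub> n \<oplus>\<^bsub>F\<^esub> r \<odot>\<^bsub>F\<^esub> w"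
      unfolding n(2) using n(1) N_closed r w by (intro F_smult_r_distr) auto
    hence "r \<odot>\<^bsub>F\<^esub> x \<in> N +>\<^bsub>F\<^esub> (r \<odot>\<^bsub>F\<^esub> w)"
      using N_smult[OF r n(1)] by (auto simp: a_r_coset_def')
    thus ?thesis
      using N.a_repr_independence'[OF _ F_smult_closed[OF r w]] by simp
  qed
  have "w \<in> N +>\<^bsub>F\<^esub> w" using w by (rule N.a_rcos_self)
  hence "(\<Union>x\<in>N +>\<^bsub>F\<^esub> w. N +>\<^bsub>F\<^esub> (r \<odot>\<^bsub>F\<^esub> w)) = N +>\<^bsub>F\<^esub> (r \<odot>\<^bsub>F\<^esub> w)"
    by (intro UN_constant_eq) auto
  moreover have "(\<Union>x\<in>N +>\<^bsub>F\<^esub> w. N +>\<^bsub>F\<^esub> (r \<odot>\<^bsub>F\<^esub> x)) = (\<Union>x\<in>N +>\<^bsub>F\<^esub> w. N +>\<^bsub>F\<^esub> (r \<odot>\<^bsub>F\<^esub> w))"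
    by (rule SUP_cong[OF refl eq])
  ultimately show ?thesis
    by (simp add: Omega_def quotient_module_def)
qed

end

context pd_alg_char
begin

section \<open>Linear maps on the free module and derivations\<close>

abbreviation "M \<equiv> trivial_P_module A"

text \<open>Homomorphisms to \<open>A\<close> with zero action of \<open>P\<close>. They are not
  made extensional, so composites with the coset map and linear extensions qualify as they
  stand.\<close>

definition V_linear :: "(('a \<Rightarrow> nat \<Rightarrow> 'a) \<Rightarrow> 'a) \<Rightarrow> bool" where
  "V_linear H \<longleftrightarrow> H \<in> carrier F \<rightarrow> carrier A \<and>
     (\<forall>w\<in>carrier F. \<forall>z\<in>carrier F. H (w \<oplus>\<^bsub>F\<^esub> z) = H w \<oplus> H z) \<and>
     (\<forall>r\<in>carrier (V A). \<forall>w\<in>carrier F. H (r \<odot>\<^bsub>F\<^esub> w) = r 0 \<otimes> H w)"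

lemma V_linearD:
  assumes "V_linear H"
  shows "w \<in> carrier F \<Longrightarrow> H w \<in> carrier A"
    and "w \<in> carrier F \<Longrightarrow> z \<in> carrier F \<Longrightarrow> H (w \<oplus>\<^bsub>F\<^esub> z) = H w \<oplus> H z"
    and "r \<in> carrier (V A) \<Longrightarrow> w \<in> carrier F \<Longrightarrow> H (r \<odot>\<^bsub>F\<^esub> w) = r 0 \<otimes> H w"
  using assms by (auto simp: V_linear_def)

lemma V_linear_zero:
  assumes H: "V_linear H"
  shows "H \<zero>\<^bsub>F\<^esub> = \<zero>"
  using V_linearD(1)[OF H, of "\<zero>\<^bsub>F\<^esub>"] V_linearD(2)[OF H, of "\<zero>\<^bsub>F\<^esub>" "\<zero>\<^bsub>F\<^esub>"]
  by (simp add: add.l_cancel_one')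

lemma V_linear_minus:
  assumes H: "V_linear H" and w: "w \<in> carrier F" and z: "z \<in> carrier F"
  shows "H (w \<ominus>\<^bsub>F\<^esub> z) = H w \<ominus> H z"
proof -
  note lin = V_linearD[OF H]
  have "H (\<ominus>\<^bsub>F\<^esub> z) \<oplus> H z = \<zero>"
    using z by (simp add: lin(2)[symmetric] F.l_neg V_linear_zero[OF H])
  hence "H (\<ominus>\<^bsub>F\<^esub> z) = \<ominus> H z"
    using z by (intro sum_zero_eq_neg) (simp_all add: lin)
  thus ?thesis using w z by (simp add: F.minus_eq a_minus_def lin)
qed

lemma ball_omega_relations:
  "(\<forall>w\<in>omega_relations A. Q w) \<longleftrightarrow>
     (\<forall>c. Q (dsym (c \<odot> \<one>))) \<and>
     (\<forall>c c'. \<forall>a\<in>carrier A. \<forall>b\<in>carrier A. Q (dsym (c \<odot> a \<oplus> c' \<odot> b) \<ominus>\<^bsub>F\<^esub>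
        (V_monom A (c \<odot> \<one>) 0 \<odot>\<^bsub>F\<^esub> dsym a \<oplus>\<^bsub>F\<^esub> V_monom A (c' \<odot> \<one>) 0 \<odot>\<^bsub>F\<^esub> dsym b))) \<and>
     (\<forall>a\<in>carrier A. \<forall>b\<in>carrier A. Q (dsym (a \<otimes> b) \<ominus>\<^bsub>F\<^esub>
        (V_monom A a 0 \<odot>\<^bsub>F\<^esub> dsym b \<oplus>\<^bsub>F\<^esub> V_monom A b 0 \<odot>\<^bsub>F\<^esub> dsym a))) \<and>
     (\<forall>a\<in>plus_ideal A. Q (dsym (dpow A CHAR('k) a) \<ominus>\<^bsub>F\<^esub> (V_monom A \<one> 1 \<odot>\<^bsub>F\<^esub> dsym a
        \<ominus>\<^bsub>F\<^esub> V_monom A (a [^] (CHAR('k) - 1 :: nat)) 0 \<odot>\<^bsub>F\<^esub> dsym a)))"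
  unfolding omega_relations_def Let_def ball_Un by blast

text \<open>Applied to a relation, \<open>H\<close> yields the difference of the two sides of a
  derivation condition. The relation for \<open>\<gamma>\<^sub>p\<close> loses its
  \<open>P\<close>-term, since the degree 0 entry of \<open>P\<close> is zero.\<close>

lemma V_linear_kills_relations_iff:
  assumes H: "V_linear H"
  defines "D \<equiv> \<lambda>a\<in>carrier A. H (dsym a)"
  shows "(\<forall>w\<in>omega_relations A. H w = \<zero>) \<longleftrightarrow> D \<in> beck_derivations A M"
proof -
  note lin = V_linearD[OF H] V_linear_minus[OF H]
  have Dc [simp]: "D a \<in> carrier A" if "a \<in> carrier A" for a
    using that by (simp add: D_def lin)
  have HD: "H (dsym a) = D a" if "a \<in> carrier A" for a using that by (simp add: D_def)
  have el: "H (V_monom A b 0 \<odot>\<^bsub>F\<^esub> dsym a) = b \<otimes> D a"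
    if "a \<in> carrier A" "b \<in> carrier A" for a b
    using that by (simp add: lin HD) (simp add: V_monom_def)
  have P: "H (V_monom A \<one> 1 \<odot>\<^bsub>F\<^esub> dsym a) = \<zero>" if "a \<in> carrier A" for a
    using that by (simp add: lin HD) (simp add: V_monom_def)
  note cl = F_smult_closed sym_closed V_monom_closed F.a_closed F.minus_closed
  have r2: "H (dsym (c \<odot> a \<oplus> c' \<odot> b) \<ominus>\<^bsub>F\<^esub> (V_monom A (c \<odot> \<one>) 0 \<odot>\<^bsub>F\<^esub> dsym a
      \<oplus>\<^bsub>F\<^esub> V_monom A (c' \<odot> \<one>) 0 \<odot>\<^bsub>F\<^esub> dsym b)) = D (c \<odot> a \<oplus> c' \<odot> b) \<ominus> (c \<odot> D a \<oplus> c' \<odot> D b)"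
    if "a \<in> carrier A" "b \<in> carrier A" for c a c' b
    using that by (simp add: lin(4) lin(2) cl el HD smult_one_mult)
  have r3: "H (dsym (a \<otimes> b) \<ominus>\<^bsub>F\<^esub> (V_monom A a 0 \<odot>\<^bsub>F\<^esub> dsym b
      \<oplus>\<^bsub>F\<^esub> V_monom A b 0 \<odot>\<^bsub>F\<^esub> dsym a)) = D (a \<otimes> b) \<ominus> (a \<otimes> D b \<oplus> b \<otimes> D a)"
    if "a \<in> carrier A" "b \<in> carrier A" for a b
    using that by (simp add: lin(4) lin(2) cl el HD)
  have r4: "H (dsym (dpow A CHAR('k) a) \<ominus>\<^bsub>F\<^esub> (V_monom A \<one> 1 \<odot>\<^bsub>F\<^esub> dsym a
      \<ominus>\<^bsub>F\<^esub> V_monom A (a [^] (CHAR('k) - 1 :: nat)) 0 \<odot>\<^bsub>F\<^esub> dsym a))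
      = D (dpow A CHAR('k) a) \<ominus> (\<ominus> (a [^] (CHAR('k) - 1 :: nat) \<otimes> D a))"
    if "a \<in> plus_ideal A" for a
  proof -
    have a: "a \<in> carrier A" using that by simp
    have "H (V_monom A \<one> 1 \<odot>\<^bsub>F\<^esub> dsym a \<ominus>\<^bsub>F\<^esub> V_monom A (a [^] (CHAR('k) - 1 :: nat)) 0 \<odot>\<^bsub>F\<^esub> dsym a)
        = \<ominus> (a [^] (CHAR('k) - 1 :: nat) \<otimes> D a)"
      using a by (subst lin(4)) (simp_all only: cl el P one_closed nat_pow_closed, simp add: a_minus_def)
    thus ?thesis using that a
      by (subst lin(4)) (simp_all only: cl HD one_closed nat_pow_closed dpow_carrier)
  qed
  have "(\<forall>w\<in>omega_relations A. H w = \<zero>) \<longleftrightarrow>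
     (\<forall>c. D (c \<odot> \<one>) = \<zero>) \<and>
     (\<forall>c c'. \<forall>a\<in>carrier A. \<forall>b\<in>carrier A. D (c \<odot> a \<oplus> c' \<odot> b) \<ominus> (c \<odot> D a \<oplus> c' \<odot> D b) = \<zero>) \<and>
     (\<forall>a\<in>carrier A. \<forall>b\<in>carrier A. D (a \<otimes> b) \<ominus> (a \<otimes> D b \<oplus> b \<otimes> D a) = \<zero>) \<and>
     (\<forall>a\<in>plus_ideal A. D (dpow A CHAR('k) a) \<ominus> (\<ominus> (a [^] (CHAR('k) - 1 :: nat) \<otimes> D a)) = \<zero>)"
  proof -
    have HD1: "H (dsym (c \<odot> \<one>)) = D (c \<odot> \<one>)" for c by (rule HD) simp
    show ?thesis
      unfolding ball_omega_relations HD1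
      by (intro conj_cong refl all_cong1 ball_cong) (simp_all only: r2 r3 r4)
  qed
  also have "\<dots> \<longleftrightarrow>
     (\<forall>c. D (c \<odot> \<one>) = \<zero>) \<and>
     (\<forall>c c'. \<forall>a\<in>carrier A. \<forall>b\<in>carrier A. D (c \<odot> a \<oplus> c' \<odot> b) = c \<odot> D a \<oplus> c' \<odot> D b) \<and>
     (\<forall>a\<in>carrier A. \<forall>b\<in>carrier A. D (a \<otimes> b) = a \<otimes> D b \<oplus> b \<otimes> D a) \<and>
     (\<forall>a\<in>plus_ideal A. D (dpow A CHAR('k) a) = \<ominus> (a [^] (CHAR('k) - 1 :: nat) \<otimes> D a))"
    by (simp add: r_right_minus_eq)
  also have "\<dots> \<longleftrightarrow> D \<in> beck_derivations A M"
  proof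
    assume *: "D \<in> beck_derivations A M"
    \<comment> \<open>The product rule at the unit makes \<open>D\<close> vanish on constants, as
      the first kind of relation requires.\<close>
    hence "D (\<one> \<otimes> \<one>) = \<one> \<otimes> D \<one> \<oplus> \<one> \<otimes> D \<one>"
      unfolding beck_derivations_self_iff by blast
    hence "D \<one> = \<zero>" by (simp add: add.l_cancel_one')
    thus "(\<forall>c. D (c \<odot> \<one>) = \<zero>) \<and>
     (\<forall>c c'. \<forall>a\<in>carrier A. \<forall>b\<in>carrier A. D (c \<odot> a \<oplus> c' \<odot> b) = c \<odot> D a \<oplus> c' \<odot> D b) \<and>
     (\<forall>a\<in>carrier A. \<forall>b\<in>carrier A. D (a \<otimes> b) = a \<otimes> D b \<oplus> b \<otimes> D a) \<and>
     (\<forall>a\<in>plus_ideal A. D (dpow A CHAR('k) a) = \<ominus> (a [^] (CHAR('k) - 1 :: nat) \<otimes> D a))"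
      using * by (simp add: beck_derivations_self_iff)
  next
    assume *: "(\<forall>c. D (c \<odot> \<one>) = \<zero>) \<and>
     (\<forall>c c'. \<forall>a\<in>carrier A. \<forall>b\<in>carrier A. D (c \<odot> a \<oplus> c' \<odot> b) = c \<odot> D a \<oplus> c' \<odot> D b) \<and>
     (\<forall>a\<in>carrier A. \<forall>b\<in>carrier A. D (a \<otimes> b) = a \<otimes> D b \<oplus> b \<otimes> D a) \<and>
     (\<forall>a\<in>plus_ideal A. D (dpow A CHAR('k) a) = \<ominus> (a [^] (CHAR('k) - 1 :: nat) \<otimes> D a))"
    hence l: "D (c \<odot> a \<oplus> c' \<odot> b) = c \<odot> D a \<oplus> c' \<odot> D b"
      if "a \<in> carrier A" "b \<in> carrier A" for c c' a b using that by blast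
    \<comment> \<open>Additivity is the case \<open>c = c' = 1\<close> of the linearity relation;
      homogeneity is the case \<open>c' = 0\<close>.\<close>
    have "D (a \<oplus> b) = D a \<oplus> D b" if "a \<in> carrier A" "b \<in> carrier A" for a b
      using l[of a b 1 1] that by simp
    moreover have "D (c \<odot> a) = c \<odot> D a" if "a \<in> carrier A" for a c
      using l[of a a c 0] that by simp
    moreover have "D \<in> carrier A \<rightarrow>\<^sub>E carrier A" by (auto simp: D_def lin)
    ultimately show "D \<in> beck_derivations A M"
      unfolding beck_derivations_self_iff using * by blast
  qed
  finally show ?thesis .
qed

text \<open>The kernel of \<open>H\<close> is a submodule containing the relations, and
  \<open>N\<close> is the smallest such.\<close>

lemma V_linear_kills_N:
  assumes H: "V_linear H" and rel: "\<And>w. w \<in> omega_relations A \<Longrightarrow> H w = \<zero>" and "w \<in> N"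
  shows "H w = \<zero>"
proof -
  note lin = V_linearD[OF H]
  let ?K = "{w \<in> carrier F. H w = \<zero>}"
  have "subgroup ?K (add_monoid F)"
  proof (rule group.subgroupI[OF F.a_group])
    show "?K \<noteq> {}" using V_linear_zero[OF H] by auto
    fix w assume w: "w \<in> ?K"
    have "H (\<zero>\<^bsub>F\<^esub> \<ominus>\<^bsub>F\<^esub> w) = \<zero> \<ominus> \<zero>"
      using w V_linear_minus[OF H, of "\<zero>\<^bsub>F\<^esub>" w] by (simp add: V_linear_zero[OF H])
    thus "inv\<^bsub>add_monoid F\<^esub> w \<in> ?K"
      using w F.a_inv_closed[of w] by (simp add: F.minus_eq a_minus_def a_inv_def[symmetric])
  qed (auto simp: lin)
  moreover have "r \<odot>\<^bsub>F\<^esub> w \<in> ?K" if "r \<in> carrier (V A)" "w \<in> ?K" for r w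
    using that V_closed[OF that(1)] by (simp add: lin F_smult_closed)
  ultimately have "submodule ?K (V A) F"
    unfolding submodule_def submodule_axioms_def by blast
  hence "N \<subseteq> ?K" using rel omega_relations_closed by (intro N_least) auto
  thus ?thesis using \<open>w \<in> N\<close> by auto
qed

text \<open>The linear map with \<open>dsym a \<mapsto> E a\<close>. As \<open>P\<close> acts by
  zero, only the degree 0 entry of each coefficient contributes.\<close>

definition extension :: "('a \<Rightarrow> 'a) \<Rightarrow> ('a \<Rightarrow> nat \<Rightarrow> 'a) \<Rightarrow> 'a" where
  "extension E w = (\<Oplus>a\<in>{a. w a \<noteq> \<zero>\<^bsub>V A\<^esub>}. w a 0 \<otimes> E a)"

lemma extension_superset:
  assumes "E \<in> carrier A \<rightarrow> carrier A" "w \<in> carrier F" "finite U" "{a. w a \<noteq> \<zero>\<^bsub>V A\<^esub>} \<subseteq> U"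
    "U \<subseteq> carrier A"
  shows "extension E w = (\<Oplus>a\<in>U. w a 0 \<otimes> E a)"
  unfolding extension_def
  using assms V_closed[OF F_mem[OF assms(2)]]
  by (intro add.finprod_mono_neutral_cong_left) (auto simp: V_simps Pi_def)

lemma V_linear_extension:
  assumes E: "E \<in> carrier A \<rightarrow> carrier A"
  shows "V_linear (extension E)"
  unfolding V_linear_def
proof (intro conjI ballI funcsetI)
  note ext = extension_superset[OF E]
  have supp: "{a. w a \<noteq> \<zero>\<^bsub>V A\<^esub>} \<subseteq> carrier A" if "w \<in> carrier F" for w
    using F_zero_outside[OF that] by blast
  have cl: "w a 0 \<otimes> E a \<in> carrier A" if "w \<in> carrier F" "a \<in> carrier A" for w a
    using V_closed[OF F_mem[OF that(1)]] E that(2) by (intro m_closed) auto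
  fix w assume w: "w \<in> carrier F"
  show "extension E w \<in> carrier A"
    unfolding extension_def using supp[OF w] cl[OF w] by (intro finsum_closed) blast
  show "extension E (w \<oplus>\<^bsub>F\<^esub> z) = extension E w \<oplus> extension E z" if z: "z \<in> carrier F" for z
  proof -
    let ?U = "{a. w a \<noteq> \<zero>\<^bsub>V A\<^esub>} \<union> {a. z a \<noteq> \<zero>\<^bsub>V A\<^esub>}"
    have U: "finite ?U" "?U \<subseteq> carrier A"
      using F_finite[OF w] F_finite[OF z] supp[OF w] supp[OF z] by auto
    have sub: "{a. (w \<oplus>\<^bsub>F\<^esub> z) a \<noteq> \<zero>\<^bsub>V A\<^esub>} \<subseteq> ?U"
      by (auto simp: omega_free_simps(3) V_simps)
    have "extension E (w \<oplus>\<^bsub>F\<^esub> z) = (\<Oplus>a\<in>?U. (w \<oplus>\<^bsub>F\<^esub> z) a 0 \<otimes> E a)"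
      using sub U F_add_closed[OF w z] by (intro ext) auto
    also have "\<dots> = (\<Oplus>a\<in>?U. w a 0 \<otimes> E a \<oplus> z a 0 \<otimes> E a)"
      using V_closed[OF F_mem[OF w]] V_closed[OF F_mem[OF z]] E U(2)
      by (intro add.finprod_cong') (auto simp: omega_free_simps(3) V_simps(4) l_distr Pi_def subset_iff)
    also have "\<dots> = (\<Oplus>a\<in>?U. w a 0 \<otimes> E a) \<oplus> (\<Oplus>a\<in>?U. z a 0 \<otimes> E a)"
      using cl[OF w] cl[OF z] U(2) by (intro finsum_addf) blast+
    also have "\<dots> = extension E w \<oplus> extension E z"
      using U by (subst (1 2) ext) (auto simp: w z)
    finally show ?thesis .
  qed
  show "extension E (r \<odot>\<^bsub>F\<^esub> w) = r 0 \<otimes> extension E w" if r: "r \<in> carrier (V A)" for r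
  proof -
    let ?U = "{a. w a \<noteq> \<zero>\<^bsub>V A\<^esub>}"
    have U: "finite ?U" "?U \<subseteq> carrier A" using F_finite[OF w] supp[OF w] by auto
    \<comment> \<open>Multiplication by \<open>r\<close> may shrink the support, so the sum is kept
      over the support of \<open>w\<close>.\<close>
    have "extension E (r \<odot>\<^bsub>F\<^esub> w) = (\<Oplus>a\<in>?U. (r \<odot>\<^bsub>F\<^esub> w) a 0 \<otimes> E a)"
      using U F_smult_closed[OF r w] V_mult_zero[OF r]
      by (intro ext) (auto simp: omega_free_simps(4))
    also have "\<dots> = (\<Oplus>a\<in>?U. r 0 \<otimes> (w a 0 \<otimes> E a))"
      using V_closed[OF F_mem[OF w]] V_closed[OF r] E U(2)
      by (intro add.finprod_cong')
        (auto simp: omega_free_simps(4) V_mult_at_0[OF r F_mem[OF w]] m_assoc Pi_def subset_iff)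
    also have "\<dots> = r 0 \<otimes> extension E w"
      unfolding extension_def
      using cl[OF w] U V_closed[OF r] by (intro finsum_rdistr[symmetric]) auto
    finally show ?thesis .
  qed
qed

lemma extension_sym:
  assumes E: "E \<in> carrier A \<rightarrow> carrier A" and a: "a \<in> carrier A"
  shows "extension E (dsym a) = E a"
proof -
  have "extension E (dsym a) = (\<Oplus>b\<in>{a}. dsym a b 0 \<otimes> E b)"
    using a by (intro extension_superset[OF E] sym_closed) (auto simp: omega_symbol_def)
  also have "\<dots> = E a"
    using E a by (auto simp: omega_symbol_def V_simps V_monom_def Pi_def)
  finally show ?thesis .
qed

lemma V_linear_coset:
  assumes h: "h \<in> module_homs (V A) (Omega A) M"
  shows "V_linear (\<lambda>w. h (N +>\<^bsub>F\<^esub> w))"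
proof -
  have c: "N +>\<^bsub>F\<^esub> w \<in> carrier (Omega A)" if "w \<in> carrier F" for w
    using that by (simp add: Omega_simps)
  show ?thesis
    using h unfolding V_linear_def module_homs_def
    by (auto simp: c Omega_add[symmetric] Omega_smult[symmetric])
qed

lemma coset_N:
  assumes "w \<in> N"
  shows "N +>\<^bsub>F\<^esub> w = N +>\<^bsub>F\<^esub> \<zero>\<^bsub>F\<^esub>"
proof -
  have "w \<in> carrier F" using assms N_closed by blast
  hence "w \<in> N +>\<^bsub>F\<^esub> \<zero>\<^bsub>F\<^esub>" using assms by (auto simp: a_r_coset_def')
  thus ?thesis using N.a_repr_independence'[of w "\<zero>\<^bsub>F\<^esub>"] by simp
qed

definition hom_derivation :: "(('a \<Rightarrow> nat \<Rightarrow> 'a) set \<Rightarrow> 'a) \<Rightarrow> 'a \<Rightarrow> 'a" where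
  "hom_derivation h = (\<lambda>a\<in>carrier A. h (universal_derivation A a))"

text \<open>Injective because the symbols generate; surjective because the linear extension of a
  derivation vanishes on \<open>N\<close> and hence descends to cosets.\<close>

theorem bij_betw_hom_derivation:
  "bij_betw hom_derivation (module_homs (V A) (Omega A) M) (beck_derivations A M)"
proof (rule bij_betw_imageI)
  show "inj_on hom_derivation (module_homs (V A) (Omega A) M)"
  proof (rule inj_onI)
    fix h h' assume hom: "h \<in> module_homs (V A) (Omega A) M" "h' \<in> module_homs (V A) (Omega A) M"
      and eq: "hom_derivation h = hom_derivation h'"
    note l = V_linearD[OF V_linear_coset[OF hom(1)]] and l' = V_linearD[OF V_linear_coset[OF hom(2)]]
    have "h (N +>\<^bsub>F\<^esub> w) = h' (N +>\<^bsub>F\<^esub> w)" if "w \<in> carrier F" for w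
      using that
    proof (induction w rule: F_induct)
      case zero
      show ?case using V_linear_zero[OF V_linear_coset[OF hom(1)]]
          V_linear_zero[OF V_linear_coset[OF hom(2)]] by simp
    next
      case (smult q a)
      thus ?case using fun_cong[OF eq, of a]
        by (simp add: l l' hom_derivation_def universal_derivation_def)
    qed (simp add: l l')
    hence "h C = h' C" if "C \<in> carrier (Omega A)" for C
      using that by (auto simp: Omega_simps)
    thus "h = h'"
      using hom by (auto simp: module_homs_def intro: PiE_ext)
  qed
  show "hom_derivation ` module_homs (V A) (Omega A) M = beck_derivations A M"
  proof (intro equalityI subsetI)
    fix D assume "D \<in> hom_derivation ` module_homs (V A) (Omega A) M"
    then obtain h where h: "h \<in> module_homs (V A) (Omega A) M" "D = hom_derivation h" by auto
    note lin = V_linear_coset[OF h(1)]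
    have "h (N +>\<^bsub>F\<^esub> w) = \<zero>" if "w \<in> omega_relations A" for w
      using coset_N[of w] that relations_in_N V_linear_zero[OF lin] by auto
    thus "D \<in> beck_derivations A M"
      using V_linear_kills_relations_iff[OF lin]
      by (simp add: h(2) hom_derivation_def universal_derivation_def)
  next
    fix E assume E: "E \<in> beck_derivations A M"
    hence Ext: "E \<in> carrier A \<rightarrow>\<^sub>E carrier A" by (simp add: beck_derivations_self_iff)
    hence Ec: "E \<in> carrier A \<rightarrow> carrier A" by auto
    note lin = V_linear_extension[OF Ec]
    note linD = V_linearD[OF lin]
    have "(\<lambda>a\<in>carrier A. extension E (dsym a)) = E"
      using Ext extension_sym[OF Ec] by (auto intro!: PiE_ext)
    hence "extension E w = \<zero>" if "w \<in> omega_relations A" for w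
      using V_linear_kills_relations_iff[OF lin] E that by auto
    hence ker: "extension E w = \<zero>" if "w \<in> N" for w
      using V_linear_kills_N[OF lin] that by blast
    \<comment> \<open>Any representative may be chosen: two of them differ by an element of
      \<open>N\<close>, on which the extension is zero.\<close>
    define h where "h = (\<lambda>C\<in>carrier (Omega A). extension E (SOME w. w \<in> carrier F \<and> C = N +>\<^bsub>F\<^esub> w))"
    have h: "h (N +>\<^bsub>F\<^esub> w) = extension E w" if w: "w \<in> carrier F" for w
    proof -
      let ?v = "SOME v. v \<in> carrier F \<and> N +>\<^bsub>F\<^esub> w = N +>\<^bsub>F\<^esub> v"
      have v: "?v \<in> carrier F \<and> N +>\<^bsub>F\<^esub> w = N +>\<^bsub>F\<^esub> ?v"
        by (rule someI[of _ w]) (simp add: w)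
      hence "?v \<in> N +>\<^bsub>F\<^esub> w" using N.a_rcos_self by blast
      then obtain n where n: "n \<in> N" "?v = n \<oplus>\<^bsub>F\<^esub> w" by (auto simp: a_r_coset_def')
      have "extension E ?v = extension E n \<oplus> extension E w"
        unfolding n(2) using n(1) N_closed w by (intro linD) auto
      also have "\<dots> = extension E w" using ker[OF n(1)] linD(1)[OF w] by simp
      finally show ?thesis using w by (simp add: h_def Omega_simps)
    qed
    have "h \<in> module_homs (V A) (Omega A) M"
      unfolding module_homs_def
    proof (intro CollectI conjI ballI)
      show "h \<in> carrier (Omega A) \<rightarrow>\<^sub>E carrier M"
        using h linD(1) by (auto simp: Omega_simps) (simp add: h_def Omega_simps)
    next
      fix C C' assume "C \<in> carrier (Omega A)" "C' \<in> carrier (Omega A)"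
      then obtain w z where "w \<in> carrier F" "z \<in> carrier F" "C = N +>\<^bsub>F\<^esub> w" "C' = N +>\<^bsub>F\<^esub> z"
        by (auto simp: Omega_simps(1))
      thus "h (C \<oplus>\<^bsub>Omega A\<^esub> C') = h C \<oplus>\<^bsub>M\<^esub> h C'"
        by (simp add: Omega_add h linD)
    next
      fix r C assume r: "r \<in> carrier (V A)" and "C \<in> carrier (Omega A)"
      then obtain w where "w \<in> carrier F" "C = N +>\<^bsub>F\<^esub> w" by (auto simp: Omega_simps(1))
      thus "h (r \<odot>\<^bsub>Omega A\<^esub> C) = r \<odot>\<^bsub>M\<^esub> h C"
        using r by (simp add: Omega_smult h linD F_smult_closed)
    qed
    moreover have "hom_derivation h = E"
      using Ext extension_sym[OF Ec] by (auto simp: hom_derivation_def universal_derivation_def h intro!: PiE_ext)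
    ultimately show "E \<in> hom_derivation ` module_homs (V A) (Omega A) M" by blast
  qed
qed

end

section \<open>Cohomology in degree zero\<close>

lemma pd_hom_pow:
  assumes "pd_alg A" "pd_alg B" "pd_hom A B h" "a \<in> carrier A"
  shows "h (a [^]\<^bsub>A\<^esub> (n::nat)) = h a [^]\<^bsub>B\<^esub> n"
proof -
  interpret A: pd_alg A by fact
  interpret B: pd_alg B by fact
  show ?thesis using assms(4) by (induction n) (simp_all add: pd_homD[OF assms(3)])
qed

context pd_alg_char
begin

abbreviation "G \<equiv> cotriple A"
abbreviation "\<epsilon> \<equiv> counit A"

sublocale G: pd_alg "cotriple A" by (rule pd_alg_cotriple)

lemmas counit_hom = pd_homD[OF pd_hom_counit]

lemma counit_zero: "\<epsilon> \<zero>\<^bsub>G\<^esub> = \<zero>"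
  by (rule pd_hom_zero[OF pd_alg_cotriple pd_alg_axioms pd_hom_counit])

lemma beck_derivations_G_iff:
  "D \<in> beck_derivations G (restrict_scalars (V_map \<epsilon>) M) \<longleftrightarrow>
    D \<in> carrier G \<rightarrow>\<^sub>E carrier A \<and>
    (\<forall>x\<in>carrier G. \<forall>y\<in>carrier G. D (x \<oplus>\<^bsub>G\<^esub> y) = D x \<oplus> D y) \<and>
    (\<forall>c. \<forall>x\<in>carrier G. D (c \<odot>\<^bsub>G\<^esub> x) = c \<odot> D x) \<and>
    (\<forall>x\<in>carrier G. \<forall>y\<in>carrier G. D (x \<otimes>\<^bsub>G\<^esub> y) = \<epsilon> x \<otimes> D y \<oplus> \<epsilon> y \<otimes> D x) \<and>
    (\<forall>x\<in>plus_ideal G. D (dpow G CHAR('k) x) = \<ominus> (\<epsilon> x [^] (CHAR('k) - 1 :: nat) \<otimes> D x))"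
proof -
  have pow: "\<epsilon> (x [^]\<^bsub>G\<^esub> n) = \<epsilon> x [^] n" if "x \<in> carrier G" for x and n :: nat
    by (rule pd_hom_pow[OF pd_alg_cotriple pd_alg_axioms pd_hom_counit that])
  have "\<epsilon> (c \<odot>\<^bsub>G\<^esub> \<one>\<^bsub>G\<^esub>) \<otimes> D x = c \<odot> D x"
    if "D \<in> carrier G \<rightarrow>\<^sub>E carrier A" "x \<in> carrier G" for c x
  proof -
    have "D x \<in> carrier A" using that by auto
    thus ?thesis by (simp add: counit_hom smult_one_mult)
  qed
  moreover have "plus_ideal G \<subseteq> carrier G" by auto
  ultimately show ?thesis
    by (subst beck_derivations_iff[where B = G and h = \<epsilon>, OF counit_zero])
      (auto simp: counit_hom pow PiE_iff)
qed

text \<open>The values of \<open>D\<close> on both faces lie in \<open>A\<close>, so a vanishing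
  difference there means equality.\<close>

lemma cohomology0_iff:
  "D \<in> cohomology0 A M \<longleftrightarrow> D \<in> beck_derivations G (restrict_scalars (V_map \<epsilon>) M) \<and>
     (\<forall>x\<in>carrier (cotriple G). D (counit G x) = D (cotriple_map A \<epsilon> x))"
proof (cases "D \<in> beck_derivations G (restrict_scalars (V_map \<epsilon>) M)")
  case True
  hence Dc: "D x \<in> carrier A" if "x \<in> carrier G" for x
    using that by (auto simp: beck_derivations_G_iff)
  have 1: "D (counit G x) \<in> carrier A" if "x \<in> carrier (cotriple G)" for x
    by (rule Dc[OF pd_homD(1)[OF G.pd_hom_counit that]])
  have 2: "D (cotriple_map A \<epsilon> x) \<in> carrier A" if "x \<in> carrier (cotriple G)" for x
    by (rule Dc[OF pd_homD(1)[OF pd_hom_cotriple_map(1)[OF pd_alg_cotriple pd_alg_axioms pd_hom_counit] that]])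
  have "coboundary0 A M D = \<zero>\<^bsub>cochains1 A M\<^esub> \<longleftrightarrow>
      (\<forall>x\<in>carrier (cotriple G). D (counit G x) \<ominus> D (cotriple_map A \<epsilon> x) = \<zero>)"
    by (auto simp: coboundary0_def cochains1_def beck_derivation_group_def fun_eq_iff)
  also have "\<dots> \<longleftrightarrow> (\<forall>x\<in>carrier (cotriple G). D (counit G x) = D (cotriple_map A \<epsilon> x))"
    using 1 2 by (simp add: r_right_minus_eq)
  finally show ?thesis
    using True by (simp add: cohomology0_def a_kernel_def' cochains0_def beck_derivation_group_def)
next
  case False
  thus ?thesis by (simp add: cohomology0_def a_kernel_def' cochains0_def beck_derivation_group_def)
qed

text \<open>
  For \<open>y\<close> in the augmentation ideal of \<open>\<GG>(A)\<close>, the generator \<open>dp_gen y\<close> of \<open>\<GG>(\<GG>(A))\<close> is mapped to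
  \<open>y\<close> by the counit and to \<open>dp_gen (\<epsilon> y)\<close> by the other face, so a cocycle takes the same value
  on \<open>y\<close> and on \<open>dp_gen (\<epsilon> y)\<close>.
\<close>

lemma cocycle_factors:
  assumes D: "D \<in> cohomology0 A M" and xy: "x \<in> carrier G" "y \<in> carrier G" "\<epsilon> x = \<epsilon> y"
  shows "D x = D y"
proof -
  note D' = D[unfolded cohomology0_iff beck_derivations_G_iff]
  have Dc: "D x \<in> carrier A" if "x \<in> carrier G" for x using D' that by auto
  have add: "D (x \<oplus>\<^bsub>G\<^esub> y) = D x \<oplus> D y" if "x \<in> carrier G" "y \<in> carrier G" for x y
    using D' that by blast
  have "D (\<one>\<^bsub>G\<^esub> \<otimes>\<^bsub>G\<^esub> \<one>\<^bsub>G\<^esub>) = \<epsilon> \<one>\<^bsub>G\<^esub> \<otimes> D \<one>\<^bsub>G\<^esub> \<oplus> \<epsilon> \<one>\<^bsub>G\<^esub> \<otimes> D \<one>\<^bsub>G\<^esub>"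
    using D' G.one_closed by blast
  hence D1: "D \<one>\<^bsub>G\<^esub> = \<zero>" using Dc[OF G.one_closed] by (simp add: counit_hom add.l_cancel_one')
  have const: "D (c \<odot>\<^bsub>G\<^esub> \<one>\<^bsub>G\<^esub>) = \<zero>" for c
    using D' D1 G.one_closed smult_zero_right by metis
  have gen: "D y = D (dp_gen (\<epsilon> y))" if "y \<in> plus_ideal G" for y
  proof -
    have "dp_gen y \<in> carrier (cotriple G)"
      using pd_alg.plus_carrier[OF pd_alg_free_pd dp_gen_plus[OF that]] by (simp add: cotriple_def)
    hence "D (counit G (dp_gen y)) = D (cotriple_map A \<epsilon> (dp_gen y))"
      using D' by blast
    thus ?thesis
      using that by (simp add: G.counit_dp_gen
          pd_hom_cotriple_map(2)[OF pd_alg_cotriple pd_alg_axioms pd_hom_counit])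
  qed
  \<comment> \<open>Subtracting the constant term moves an element into the augmentation ideal
    without changing its image under \<open>D\<close>.\<close>
  define t where "t = (\<lambda>x. x \<oplus>\<^bsub>G\<^esub> (- aug G x) \<odot>\<^bsub>G\<^esub> \<one>\<^bsub>G\<^esub>)"
  have t: "t x \<in> plus_ideal G" if "x \<in> carrier G" for x
    using that by (simp add: t_def plus_ideal_def G.aug_add G.aug_smult_one del: G.plus_carrier)
  have Dt: "D (t x) = D x" if "x \<in> carrier G" for x
    using that by (simp add: t_def add const Dc)
  \<comment> \<open>The counit preserves augmentations, so equal images force equal constant
    terms.\<close>
  have "\<epsilon> (t x) = \<epsilon> (t y)"
    using xy counit_hom(6)[of x] counit_hom(6)[of y] by (simp add: t_def counit_hom)
  thus ?thesis
    using gen[OF t[OF xy(1)]] gen[OF t[OF xy(2)]] Dt xy(1,2) by simp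
qed

text \<open>By the splitting of \<open>A\<close> into \<open>k\<close> and \<open>A\<^sub>+\<close>,
  a generator covers the component in \<open>A\<^sub>+\<close> and a scalar the rest.\<close>

lemma counit_surj:
  assumes "a \<in> carrier A"
  shows "\<exists>x\<in>carrier G. \<epsilon> x = a"
proof -
  let ?b = "a \<oplus> (- aug A a) \<odot> \<one>"
  have b: "?b \<in> plus_ideal A"
    using assms by (simp add: plus_ideal_def aug_add aug_smult_one del: plus_carrier)
  have g: "dp_gen ?b \<in> carrier G"
    using pd_alg.plus_carrier[OF pd_alg_free_pd dp_gen_plus[OF b]] by (simp add: cotriple_def)
  have "\<epsilon> (dp_gen ?b \<oplus>\<^bsub>G\<^esub> aug A a \<odot>\<^bsub>G\<^esub> \<one>\<^bsub>G\<^esub>) = ?b \<oplus> aug A a \<odot> \<one>"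
    using g b by (simp add: counit_hom counit_dp_gen)
  also have "\<dots> = a"
    using assms by (simp add: smult_minus_left a_assoc l_neg)
  finally show ?thesis using g
    by (intro bexI[of _ "dp_gen ?b \<oplus>\<^bsub>G\<^esub> aug A a \<odot>\<^bsub>G\<^esub> \<one>\<^bsub>G\<^esub>"]) simp_all
qed

definition pullback :: "('a \<Rightarrow> 'a) \<Rightarrow> ('a, 'k) dpoly \<Rightarrow> 'a" where
  "pullback E = (\<lambda>x\<in>carrier G. E (\<epsilon> x))"

theorem bij_betw_pullback: "bij_betw pullback (beck_derivations A M) (cohomology0 A M)"
proof (rule bij_betw_imageI)
  show "inj_on pullback (beck_derivations A M)"
  proof (rule inj_onI)
    fix E E' assume E: "E \<in> beck_derivations A M" "E' \<in> beck_derivations A M"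
      and eq: "pullback E = pullback E'"
    have "E a = E' a" if a: "a \<in> carrier A" for a
    proof -
      obtain x where "x \<in> carrier G" "\<epsilon> x = a" using counit_surj[OF a] by blast
      thus ?thesis using fun_cong[OF eq, of x] by (simp add: pullback_def)
    qed
    thus "E = E'" using E by (auto simp: beck_derivations_self_iff intro: PiE_ext)
  qed
  show "pullback ` beck_derivations A M = cohomology0 A M"
  proof (intro equalityI subsetI)
    fix D assume "D \<in> pullback ` beck_derivations A M"
    then obtain E where E: "E \<in> beck_derivations A M" "D = pullback E" by auto
    have Dx: "D x = E (\<epsilon> x)" if "x \<in> carrier G" for x using that by (simp add: E(2) pullback_def)
    have "D \<in> carrier G \<rightarrow>\<^sub>E carrier A"
      using E(1) by (auto simp: E(2) pullback_def beck_derivations_self_iff counit_hom)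
    hence "D \<in> beck_derivations G (restrict_scalars (V_map \<epsilon>) M)"
      using E(1) unfolding beck_derivations_self_iff beck_derivations_G_iff
      by (simp add: Dx counit_hom G.dpow_carrier)
    moreover have "D (counit G x) = D (cotriple_map A \<epsilon> x)" if x: "x \<in> carrier (cotriple G)" for x
      using pd_homD(1)[OF G.pd_hom_counit x]
        pd_homD(1)[OF pd_hom_cotriple_map(1)[OF pd_alg_cotriple pd_alg_axioms pd_hom_counit] x]
        counit_counit[OF pd_alg_axioms x]
      by (simp add: Dx)
    ultimately show "D \<in> cohomology0 A M" by (simp add: cohomology0_iff)
  next
    fix D assume D: "D \<in> cohomology0 A M"
    note D' = D[unfolded cohomology0_iff beck_derivations_G_iff]
    \<comment> \<open>This is a section of sets only; \<open>cocycle_factors\<close> makes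
      \<open>E\<close> independent of its choice.\<close>
    obtain s where s: "\<And>a. a \<in> carrier A \<Longrightarrow> s a \<in> carrier G" "\<And>a. a \<in> carrier A \<Longrightarrow> \<epsilon> (s a) = a"
      using counit_surj by metis
    define E where "E = (\<lambda>a\<in>carrier A. D (s a))"
    have E: "E (\<epsilon> x) = D x" if "x \<in> carrier G" for x
      using that cocycle_factors[OF D, of "s (\<epsilon> x)" x] s counit_hom(1)[OF that] by (simp add: E_def)
    have sx: "\<exists>x\<in>carrier G. a = \<epsilon> x" if "a \<in> carrier A" for a
      using counit_surj[OF that] by blast
    have Eext: "E \<in> carrier A \<rightarrow>\<^sub>E carrier A" using D' s by (auto simp: E_def)
    have "E \<in> beck_derivations A M"
      unfolding beck_derivations_self_iff
    proof (intro conjI ballI allI Eext)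
      fix a b assume "a \<in> carrier A" "b \<in> carrier A"
      then obtain x y where xy: "x \<in> carrier G" "y \<in> carrier G" "a = \<epsilon> x" "b = \<epsilon> y"
        using sx by metis
      have "E (\<epsilon> (x \<oplus>\<^bsub>G\<^esub> y)) = D (x \<oplus>\<^bsub>G\<^esub> y)" "E (\<epsilon> (x \<otimes>\<^bsub>G\<^esub> y)) = D (x \<otimes>\<^bsub>G\<^esub> y)"
        using xy by (simp_all add: E)
      thus "E (a \<oplus> b) = E a \<oplus> E b" "E (a \<otimes> b) = a \<otimes> E b \<oplus> b \<otimes> E a"
        using D' xy by (simp_all add: counit_hom E)
    next
      fix c a assume "a \<in> carrier A"
      then obtain x where x: "x \<in> carrier G" "a = \<epsilon> x" using sx by metis
      have "E (\<epsilon> (c \<odot>\<^bsub>G\<^esub> x)) = D (c \<odot>\<^bsub>G\<^esub> x)" using x by (simp add: E)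
      thus "E (c \<odot> a) = c \<odot> E a" using D' x by (simp add: counit_hom E)
    next
      fix a assume a: "a \<in> plus_ideal A"
      then obtain x where x: "x \<in> carrier G" "a = \<epsilon> x" using sx by blast
      \<comment> \<open>Preimages of elements of \<open>A\<^sub>+\<close> lie in the augmentation
        ideal of \<open>G\<close>, where the condition on the \<open>p\<close>-map of
        \<open>D\<close> is available.\<close>
      hence xp: "x \<in> plus_ideal G" using a counit_hom(6)[of x] by (simp add: plus_ideal_def del: plus_carrier G.plus_carrier)
      have "E (\<epsilon> (dpow G CHAR('k) x)) = D (dpow G CHAR('k) x)"
        using G.dpow_carrier[OF xp] by (rule E)
      thus "E (dpow A CHAR('k) a) = \<ominus> (a [^] (CHAR('k) - 1 :: nat) \<otimes> E a)"
        using D' x xp by (simp add: counit_hom(7) E)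
    qed
    moreover have "pullback E = D"
      using D' E by (auto simp: pullback_def intro!: PiE_ext)
    ultimately show "D \<in> pullback ` beck_derivations A M" by blast
  qed
qed

text \<open>Both bijections pass through Beck derivations. The two formulas determine
  \<open>\<phi>\<close> and \<open>\<psi>\<close> on their domains, because the counit is surjective
  and the classes of the symbols generate \<open>Omega A\<close>.\<close>

theorem cohomology0_homs_special_derivations:
  "\<exists>\<phi> \<psi>.
    bij_betw \<phi> (cohomology0 A M) (module_homs (V A) (Omega A) M) \<and>
    bij_betw \<psi> (module_homs (V A) (Omega A) M) (special_derivations A) \<and>
    (\<forall>D \<in> cohomology0 A M. \<forall>x \<in> carrier G. \<phi> D (universal_derivation A (\<epsilon> x)) = D x) \<and>
    (\<forall>h \<in> module_homs (V A) (Omega A) M. \<forall>a \<in> carrier A. \<psi> h a = h (universal_derivation A a))"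
proof -
  let ?H = "module_homs (V A) (Omega A) M" and ?B = "beck_derivations A M"
  define \<phi> where "\<phi> = inv_into ?H hom_derivation \<circ> inv_into ?B pullback"
  note inv1 = bij_betw_inv_into[OF bij_betw_hom_derivation]
    and inv2 = bij_betw_inv_into[OF bij_betw_pullback]
  have "bij_betw \<phi> (cohomology0 A M) ?H"
    unfolding \<phi>_def by (rule bij_betw_trans[OF inv2 inv1])
  moreover have "bij_betw hom_derivation ?H (special_derivations A)"
    using bij_betw_hom_derivation
    by (simp add: beck_derivations_eq_special_derivations[OF prime_char])
  moreover have "\<phi> D (universal_derivation A (\<epsilon> x)) = D x"
    if D: "D \<in> cohomology0 A M" and x: "x \<in> carrier G" for D x
  proof -
    let ?E = "inv_into ?B pullback D"
    have E: "?E \<in> ?B" using bij_betwE[OF inv2] D by blast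
    have "hom_derivation (\<phi> D) = ?E"
      using bij_betw_inv_into_right[OF bij_betw_hom_derivation E] by (simp add: \<phi>_def)
    hence "\<phi> D (universal_derivation A (\<epsilon> x)) = ?E (\<epsilon> x)"
      using counit_hom(1)[OF x] by (auto simp: hom_derivation_def dest: fun_cong[of _ _ "\<epsilon> x"])
    also have "\<dots> = pullback ?E x" using x by (simp add: pullback_def)
    also have "pullback ?E = D" by (rule bij_betw_inv_into_right[OF bij_betw_pullback D])
    finally show ?thesis .
  qed
  moreover have "hom_derivation h a = h (universal_derivation A a)" if "a \<in> carrier A" for h a
    using that by (simp add: hom_derivation_def)
  ultimately show ?thesis by blast
qed

end

theorem corollary2p10:
  fixes n :: nat and A :: "('k::field, (nat, 'k) dpoly) pdalg"
  assumes "Factorial_Ring.prime CHAR('k)" and "n \<ge> 1"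
  defines "A \<equiv> divided_power_algebra n"
  shows "\<exists>\<phi> \<psi>.
    bij_betw \<phi> (cohomology0 A (trivial_P_module A))
               (module_homs (V A) (Omega A) (trivial_P_module A)) \<and>
    bij_betw \<psi> (module_homs (V A) (Omega A) (trivial_P_module A)) (Witt n) \<and>
    (\<forall>D \<in> cohomology0 A (trivial_P_module A). \<forall>x \<in> carrier (cotriple A).
       \<phi> D (universal_derivation A (counit A x)) = D x) \<and>
    (\<forall>h \<in> module_homs (V A) (Omega A) (trivial_P_module A). \<forall>a \<in> carrier A.
       \<psi> h a = h (universal_derivation A a))"
proof -
  \<comment> \<open>\<open>O(n)\<close> is the free divided power algebra on \<open>n\<close>
    generators, so the result for general \<open>A\<close> applies.\<close>
  have "pd_alg A" unfolding A_def divided_power_algebra_def by (rule pd_alg_free_pd)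
  then interpret pd_alg_char A
    using assms(1) by (intro pd_alg_char.intro pd_alg_char_axioms.intro)
  show ?thesis
    using cohomology0_homs_special_derivations by (simp only: Witt_def A_def)
qed

end
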